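(* Let $u$ be an inner function on the open unit disk and let $\mathscr{S}$ be a non-trivial (that is, $\{0\}\neq\mathscr{S}\neq\mathcal{K}_u^{\perp}$) $D_u$-invariant subspace of $\mathcal{K}_u^{\perp}$ of the form $\mathscr{S}=X_{-}\oplus Y_{+}$, where $X_{-}$ is a closed subspace of $\overline{H^2_0}$ and $Y_{+}$ is a closed subspace of $uH^2$. (i) If $u(0)\neq0$, then $\mathscr{S}$ takes one of the forms: $\gamma uH^2$ or $\overline{z\mathcal{K}_{\alpha}}\oplus uH^2$, where $\gamma$ and $\alpha$ are inner. (ii) If $u(0)=0$, then $\mathscr{S}$ takes one of the following forms: $\overline{H^2_0}$, $\overline{z\mathcal{K}_{\alpha}}$, $\gamma uH^2$, $\overline{H^2_0}\oplus\gamma uH^2$, or $\overline{z\mathcal{K}_{\alpha}}\oplus\gamma uH^2$, where $\gamma$ and $\alpha$ are inner.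
   Context: $L^2=L^2(\mathbb{T},dm)$, where $\mathbb{T}$ is the unit circle and $m$ is normalized Lebesgue measure. $H^2=\{f\in L^2:\widehat f(n)=0\ \forall n<0\}$ is the Hardy space and $\overline{H^2_0}=\{\overline{zf}:f\in H^2\}$. For an inner function $u$, $\mathcal{K}_u=H^2\cap(uH^2)^{\perp}$, $P_u$ is the orthogonal projection of $L^2$ onto $\mathcal{K}_u$, and $\mathcal{K}_u^{\perp}=\overline{H^2_0}\oplus uH^2$ is the orthogonal complement of $\mathcal{K}_u$ in $L^2$. The dual of the compressed shift is $D_u:\mathcal{K}_u^{\perp}\to\mathcal{K}_u^{\perp}$, $D_uf=(I-P_u)(zf)$. A subspace $\mathscr{S}$ is $D_u$-invariant if $D_u\mathscr{S}\subseteq\mathscr{S}$. For an inner function $\alpha$, $\overline{z\mathcal{K}_{\alpha}}=\{\overline{z}\,\overline{k}:k\in\mathcal{K}_{\alpha}\}\subseteq\overline{H^2_0}$ (the bar denotes complex conjugation). *)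

theory Defs
  imports "HOL-Analysis.Analysis"
begin

section \<open>The space \<open>L\<^sup>2\<close> of the unit circle\<close>

text \<open>Normalized Lebesgue measure on the unit circle, as a Borel probability measure on the
  complex plane concentrated on the circle.\<close>

definition circle_measure :: "complex measure" where
  "circle_measure = distr (uniform_measure lborel {0..2 * pi}) borel cis"

text \<open>Elements of \<open>L\<^sup>2\<close> are represented by functions rather than by classes modulo
  almost-everywhere equality. In return, every set that stands for a subset of \<open>L\<^sup>2\<close> is saturated,
  i.e. closed under almost-everywhere equality, so that equality and inclusion of such sets
  mean equality and inclusion of the corresponding sets of classes.\<close>

definition L2 :: "(complex \<Rightarrow> complex) set" where
  "L2 = {f \<in> borel_measurable circle_measure.
           integrable circle_measure (\<lambda>z. (cmod (f z))\<^sup>2)}"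

definition saturate :: "(complex \<Rightarrow> complex) set \<Rightarrow> (complex \<Rightarrow> complex) set" where
  "saturate A = {g \<in> L2. \<exists>f\<in>A. AE z in circle_measure. g z = f z}"

definition L2_inner :: "(complex \<Rightarrow> complex) \<Rightarrow> (complex \<Rightarrow> complex) \<Rightarrow> complex" where
  "L2_inner f g = (LINT z|circle_measure. f z * cnj (g z))"

definition L2_norm :: "(complex \<Rightarrow> complex) \<Rightarrow> real" where
  "L2_norm f = sqrt (LINT z|circle_measure. (cmod (f z))\<^sup>2)"

definition L2_zero :: "(complex \<Rightarrow> complex) set" where
  "L2_zero = saturate {\<lambda>z. 0}"

definition L2_subspace :: "(complex \<Rightarrow> complex) set \<Rightarrow> bool" where
  "L2_subspace M \<longleftrightarrow> M \<subseteq> L2 \<and> saturate M = M \<and> (\<lambda>z. 0) \<in> M \<and>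
     (\<forall>f\<in>M. \<forall>g\<in>M. (\<lambda>z. f z + g z) \<in> M) \<and>
     (\<forall>c. \<forall>f\<in>M. (\<lambda>z. c * f z) \<in> M)"

definition L2_closed :: "(complex \<Rightarrow> complex) set \<Rightarrow> bool" where
  "L2_closed M \<longleftrightarrow>
     (\<forall>F. \<forall>g\<in>L2. (\<forall>n::nat. F n \<in> M) \<and> (\<lambda>n. L2_norm (\<lambda>z. F n z - g z)) \<longlonglongrightarrow> 0
        \<longrightarrow> g \<in> M)"

definition L2_perp :: "(complex \<Rightarrow> complex) set \<Rightarrow> (complex \<Rightarrow> complex) set" where
  "L2_perp A = {f \<in> L2. \<forall>g\<in>A. L2_inner f g = 0}"

text \<open>The sum of two subspaces. It is only used for a subspace of \<open>conj_H2_0\<close> and a subspace of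
  \<open>H2\<close>, and is then automatically an orthogonal direct sum.\<close>

definition L2_sum :: "(complex \<Rightarrow> complex) set \<Rightarrow> (complex \<Rightarrow> complex) set \<Rightarrow>
    (complex \<Rightarrow> complex) set" (infixl "\<oplus>\<^sub>2" 65) where
  "X \<oplus>\<^sub>2 Y = saturate {\<lambda>z. x z + y z |x y. x \<in> X \<and> y \<in> Y}"


section \<open>Hardy space and inner functions\<close>

definition fourier_coeff :: "(complex \<Rightarrow> complex) \<Rightarrow> int \<Rightarrow> complex" where
  "fourier_coeff f n = (LINT z|circle_measure. f z * z powi (- n))"

definition H2 :: "(complex \<Rightarrow> complex) set" where
  "H2 = {f \<in> L2. \<forall>n<0. fourier_coeff f n = 0}"

definition conj_z :: "(complex \<Rightarrow> complex) set \<Rightarrow> (complex \<Rightarrow> complex) set" where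
  "conj_z A = saturate {\<lambda>z. cnj (z * f z) |f. f \<in> A}"

definition conj_H2_0 :: "(complex \<Rightarrow> complex) set" where
  "conj_H2_0 = conj_z H2"

text \<open>An inner function lives on the open unit disk; on the circle it is represented by its
  radial limits.\<close>

definition inner_function :: "(complex \<Rightarrow> complex) \<Rightarrow> bool" where
  "inner_function u \<longleftrightarrow> u holomorphic_on ball 0 1 \<and> bounded (u ` ball 0 1) \<and>
     (AE \<zeta> in circle_measure. \<exists>l. cmod l = 1 \<and>
        ((\<lambda>r::real. u (of_real r * \<zeta>)) \<longlongrightarrow> l) (at_left 1))"

definition boundary :: "(complex \<Rightarrow> complex) \<Rightarrow> complex \<Rightarrow> complex" where
  "boundary u \<zeta> = Lim (at_left 1) (\<lambda>r::real. u (of_real r * \<zeta>))"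

definition mult_H2 :: "(complex \<Rightarrow> complex) \<Rightarrow> (complex \<Rightarrow> complex) set" where
  "mult_H2 u = saturate {\<lambda>z. boundary u z * f z |f. f \<in> H2}"


section \<open>Model spaces and the dual of the compressed shift\<close>

definition model_space :: "(complex \<Rightarrow> complex) \<Rightarrow> (complex \<Rightarrow> complex) set" where
  "model_space u = H2 \<inter> L2_perp (mult_H2 u)"

text \<open>The orthogonal projection of \<open>L\<^sup>2\<close> onto the model space; the representative that is chosen
  is immaterial, as it is determined up to almost-everywhere equality.\<close>

definition model_proj :: "(complex \<Rightarrow> complex) \<Rightarrow> (complex \<Rightarrow> complex) \<Rightarrow> (complex \<Rightarrow> complex)" where
  "model_proj u f =
     (SOME g. g \<in> model_space u \<and> (\<lambda>z. f z - g z) \<in> L2_perp (model_space u))"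

definition dual_shift :: "(complex \<Rightarrow> complex) \<Rightarrow> (complex \<Rightarrow> complex) \<Rightarrow> (complex \<Rightarrow> complex)" where
  "dual_shift u f = (\<lambda>z. z * f z - model_proj u (\<lambda>w. w * f w) z)"

definition dual_shift_invariant :: "(complex \<Rightarrow> complex) \<Rightarrow> (complex \<Rightarrow> complex) set \<Rightarrow> bool" where
  "dual_shift_invariant u S \<longleftrightarrow>
     L2_subspace S \<and> S \<subseteq> L2_perp (model_space u) \<and> dual_shift u ` S \<subseteq> S"

end

theory Submission
  imports Defs "HOL-Complex_Analysis.Cauchy_Integral_Formula"
begin

text \<open>
  For \<open>y \<in> uH\<^sup>2\<close> the operator acts as \<open>D\<^sub>u y = z y\<close>. For \<open>x\<close> in the conjugate space, with
  \<open>c\<close> the Fourier coefficient of \<open>x\<close> of index \<open>-1\<close>, it gives \<open>D\<^sub>u x = (z x - c) + c cnj (u 0) u\<close>,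
  because the projection of \<open>1\<close> onto the model space is \<open>1 - cnj (u 0) u\<close>. Hence \<open>Y\<close> is invariant under
  multiplication by \<open>z\<close> and \<open>X\<close> is, after conjugation, invariant under the backward shift, and Beurling's
  theorem describes both. If \<open>u 0 \<noteq> 0\<close> then either all the coefficients \<open>c\<close> vanish, which forces
  \<open>X = 0\<close>, or \<open>u \<in> Y\<close>, which forces \<open>Y = uH\<^sup>2\<close>. Beurling's theorem yields a function
  on the circle; it is the boundary function of an inner function by Fatou's theorem on radial limits,
  which rests on a weak type estimate obtained from a Vitali covering.
\<close>

section \<open>The Hilbert space structure\<close>

text \<open>The formula for \<open>dual_shift\<close> displays a summand in \<open>conj_H2_0\<close>
  and one in \<open>H2\<close>, and these spaces meet only in zero. This is why invariance of the
  sum \<open>S\<close> splits into a condition on \<open>X\<close> and one on \<open>Y\<close>,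
  linked only through \<open>u 0\<close>. The obstacle that shapes the rest is the gap between disk
  and circle. An inner function is given on the disk and acts through its radial limits, while
  Beurling's argument lives on the circle and yields a function known up to null sets. The way down
  is dominated convergence along one sequence of radii. The way back needs radial limits almost
  everywhere for the extension of an \<open>H2\<close> function, which is the purpose of the maximal
  estimate. Elements of \<open>L2\<close> being functions and not classes, completeness, projections
  and uniqueness of Fourier coefficients are derived modulo null sets; arguments with orthogonal
  projections take the place of Fourier expansions.\<close>

lemma space_circle_measure [simp]: "space circle_measure = UNIV"
  by (simp add: circle_measure_def)

lemma sets_circle_measure [simp, measurable_cong]: "sets circle_measure = sets borel"
  by (simp add: circle_measure_def)

lemma borel_measurable_cis [measurable]: "cis \<in> borel_measurable borel"
  by (intro borel_measurable_continuous_onI continuous_intros)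

lemma emeasure_circle_measure_UNIV: "emeasure circle_measure UNIV = 1"
  unfolding circle_measure_def
  by (subst emeasure_distr) (auto intro!: ennreal_divide_self simp: divide_ennreal)

interpretation circle: finite_measure circle_measure
  by standard (simp add: emeasure_circle_measure_UNIV)

lemma measure_circle_measure_UNIV [simp]: "measure circle_measure UNIV = 1"
  by (simp add: measure_def emeasure_circle_measure_UNIV)

lemma AE_circle_cmod: "AE z in circle_measure. cmod z = 1"
  unfolding circle_measure_def by (subst AE_distr_iff) auto

lemma borel_measurable_cnj [measurable (raw)]:
  "f \<in> borel_measurable M \<Longrightarrow> (\<lambda>x. cnj (f x)) \<in> borel_measurable M"
  by (rule borel_measurable_continuous_on[of cnj]) (auto intro: continuous_intros)

lemma integral_circle_measure:
  fixes f :: "complex \<Rightarrow> complex"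
  assumes [measurable]: "f \<in> borel_measurable borel"
  shows "(LINT z|circle_measure. f z) =
    (LINT t|lborel. indicat_real {0..2*pi} t *\<^sub>R f (cis t)) / (2 * pi)"
proof -
  have "(LINT z|circle_measure. f z) = (LINT t|uniform_measure lborel {0..2*pi}. f (cis t))"
    unfolding circle_measure_def by (subst integral_distr) auto
  also have "\<dots> = (LINT t|density lborel (\<lambda>t. ennreal (indicat_real {0..2*pi} t / (2*pi))). f (cis t))"
    by (intro arg_cong2[where f = "integral\<^sup>L"] refl, unfold uniform_measure_def, intro density_cong)
       (auto simp: indicator_def divide_ennreal inverse_ennreal divide_ennreal_def inverse_eq_divide)
  also have "\<dots> = (LINT t|lborel. (indicat_real {0..2*pi} t / (2*pi)) *\<^sub>R f (cis t))"
    by (subst integral_density) auto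
  also have "\<dots> = (LINT t|lborel. (indicator {0..2*pi} t *\<^sub>R f (cis t)) / (2 * pi))"
    by (intro Bochner_Integration.integral_cong) (auto simp: indicator_def scaleR_conv_of_real)
  finally show ?thesis by simp
qed

lemma borel_measurable_powi [measurable (raw)]:
  fixes f :: "'a \<Rightarrow> complex"
  assumes [measurable]: "f \<in> borel_measurable M"
  shows "(\<lambda>x. f x powi n) \<in> borel_measurable M"
  unfolding power_int_def by measurable

lemma integral_circle_powi:
  "(LINT z|circle_measure. z powi n) = (if n = 0 then 1 else 0)"
proof (cases "n = 0")
  case False
  have "(LINT t|lborel. indicat_real {0..2*pi} t *\<^sub>R cis (of_int n * t)) =
      cis (of_int n * (2*pi)) / (\<i> * of_int n) - cis (of_int n * 0) / (\<i> * of_int n)"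
  proof (rule integral_FTC_atLeastAtMost)
    fix x :: real
    show "((\<lambda>x. cis (of_int n * x) / (\<i> * of_int n)) has_vector_derivative cis (of_int n * x)) (at x within {0..2*pi})"
      using False unfolding has_vector_derivative_def
      by (auto intro!: derivative_eq_intros has_derivative_cis simp: scaleR_conv_of_real field_simps)
  qed (auto intro!: continuous_intros)
  also have "\<dots> = 0" using cis_multiple_2pi[of "of_int n"] by (simp add: mult_ac)
  finally show ?thesis
    using False by (subst integral_circle_measure) (auto simp: cis_power_int)
qed simp

section \<open>Closure properties of \<open>L2\<close>\<close>

lemma L2_iff: "f \<in> L2 \<longleftrightarrow> f \<in> borel_measurable borel \<and> integrable circle_measure (\<lambda>z. (cmod (f z))\<^sup>2)"
  unfolding L2_def using measurable_cong_sets[OF sets_circle_measure refl] by auto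

lemma L2_measurable [measurable_dest]: "f \<in> L2 \<Longrightarrow> f \<in> borel_measurable borel"
  by (simp add: L2_iff)

lemma L2_measurable' [measurable_dest]: "f \<in> L2 \<Longrightarrow> f \<in> borel_measurable circle_measure"
  by (simp add: L2_def)

lemma L2_integrable_square: "f \<in> L2 \<Longrightarrow> integrable circle_measure (\<lambda>z. (cmod (f z))\<^sup>2)"
  by (simp add: L2_iff)

text \<open>A single domination test behind the closure of \<open>L2\<close> under scalars,
  conjugation and multiplication by functions bounded almost everywhere.\<close>

lemma L2_bound:
  assumes g: "g \<in> L2" and f[measurable]: "f \<in> borel_measurable borel"
    and le: "AE z in circle_measure. cmod (f z) \<le> B * cmod (g z)"
  shows "f \<in> L2"
proof -
  note [measurable] = g
  have "integrable circle_measure (\<lambda>z. B\<^sup>2 * (cmod (g z))\<^sup>2)"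
    using L2_integrable_square[OF g] by simp
  moreover have "AE z in circle_measure. norm ((cmod (f z))\<^sup>2) \<le> norm (B\<^sup>2 * (cmod (g z))\<^sup>2)"
    using le
  proof eventually_elim
    case (elim z)
    hence "(cmod (f z))\<^sup>2 \<le> (B * cmod (g z))\<^sup>2" by (intro power_mono) auto
    thus ?case by (simp add: power_mult_distrib)
  qed
  ultimately have "integrable circle_measure (\<lambda>z. (cmod (f z))\<^sup>2)"
    by - (rule Bochner_Integration.integrable_bound[where f = "\<lambda>z. B\<^sup>2 * (cmod (g z))\<^sup>2"], auto)
  with f show ?thesis by (simp add: L2_iff)
qed

lemma L2_bounded:
  assumes "f \<in> borel_measurable borel" "AE z in circle_measure. cmod (f z) \<le> B"
  shows "f \<in> L2"
proof (rule L2_bound)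
  show "(\<lambda>_. 1) \<in> L2" by (simp add: L2_iff)
qed (use assms in auto)

lemma L2_const [simp]: "(\<lambda>_. c) \<in> L2"
  by (rule L2_bounded) auto

lemma L2_powi [simp]: "(\<lambda>z. z powi n) \<in> L2"
  using AE_circle_cmod by (intro L2_bounded[of _ 1]) (auto simp: norm_power_int)

lemma L2_cmult [intro]: "f \<in> L2 \<Longrightarrow> (\<lambda>z. c * f z) \<in> L2"
  by (rule L2_bound[of f _ "cmod c"]) (auto simp: norm_mult)

lemma L2_bounded_mult:
  assumes "f \<in> L2" "h \<in> borel_measurable borel" "AE z in circle_measure. cmod (h z) \<le> B"
  shows "(\<lambda>z. h z * f z) \<in> L2"
proof (rule L2_bound[OF assms(1), of _ B])
  show "AE z in circle_measure. cmod (h z * f z) \<le> B * cmod (f z)"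
    using assms(3) by eventually_elim (auto simp: norm_mult mult_right_mono)
qed (use assms in auto)

lemma L2_cnj [intro]: "f \<in> L2 \<Longrightarrow> (\<lambda>z. cnj (f z)) \<in> L2"
  by (rule L2_bound[of f _ 1]) auto

lemma L2_powi_mult [intro]: "f \<in> L2 \<Longrightarrow> (\<lambda>z. z powi n * f z) \<in> L2"
  using AE_circle_cmod by (intro L2_bounded_mult[of _ _ 1]) (auto simp: norm_power_int)

lemma L2_z_mult [intro]: "f \<in> L2 \<Longrightarrow> (\<lambda>z. z * f z) \<in> L2"
  using L2_powi_mult[of f 1] by simp

lemma L2_add [intro]:
  assumes "f \<in> L2" "g \<in> L2" shows "(\<lambda>z. f z + g z) \<in> L2"
proof -
  note [measurable] = assms
  have "norm ((cmod (f z + g z))\<^sup>2) \<le> norm (2 * (cmod (f z))\<^sup>2 + 2 * (cmod (g z))\<^sup>2)" for z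
  proof -
    have "(cmod (f z + g z))\<^sup>2 \<le> (cmod (f z) + cmod (g z))\<^sup>2"
      by (intro power_mono norm_triangle_ineq) auto
    also have "\<dots> \<le> 2 * (cmod (f z))\<^sup>2 + 2 * (cmod (g z))\<^sup>2"
      using zero_le_power2[of "cmod (f z) - cmod (g z)"]
      by (simp add: power2_sum power2_diff)
    finally show ?thesis by simp
  qed
  hence *: "AE z in circle_measure. norm ((cmod (f z + g z))\<^sup>2) \<le> norm (2 * (cmod (f z))\<^sup>2 + 2 * (cmod (g z))\<^sup>2)"
    by (intro AE_I2)
  have "integrable circle_measure (\<lambda>z. 2 * (cmod (f z))\<^sup>2 + 2 * (cmod (g z))\<^sup>2)"
    by (intro Bochner_Integration.integrable_add integrable_mult_right L2_integrable_square assms)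
  hence "integrable circle_measure (\<lambda>z. (cmod (f z + g z))\<^sup>2)"
    by (rule Bochner_Integration.integrable_bound[OF _ _ *]) measurable
  thus ?thesis using assms by (simp add: L2_iff)
qed

lemma L2_uminus [intro]: "f \<in> L2 \<Longrightarrow> (\<lambda>z. - f z) \<in> L2"
  using L2_cmult[of f "-1"] by simp

lemma L2_diff [intro]: "f \<in> L2 \<Longrightarrow> g \<in> L2 \<Longrightarrow> (\<lambda>z. f z - g z) \<in> L2"
  using L2_add[of f "\<lambda>z. - g z"] by auto

lemma L2_mult_integrable:
  assumes "f \<in> L2" "g \<in> L2" shows "integrable circle_measure (\<lambda>z. f z * g z)"
proof (rule Bochner_Integration.integrable_bound)
  note [measurable] = assms
  show "integrable circle_measure (\<lambda>z. (cmod (f z))\<^sup>2 + (cmod (g z))\<^sup>2)"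
    using assms[THEN L2_integrable_square] by auto
  have "norm (f z * g z) \<le> norm ((cmod (f z))\<^sup>2 + (cmod (g z))\<^sup>2)" for z
    using sum_squares_bound[of "cmod (f z)" "cmod (g z)"] norm_ge_zero[of "f z * g z"] unfolding norm_mult
    by (auto simp: norm_mult intro: order_trans[of _ "2 * cmod (f z) * cmod (g z)"])
  thus "AE z in circle_measure. norm (f z * g z) \<le> norm ((cmod (f z))\<^sup>2 + (cmod (g z))\<^sup>2)"
    by simp
  show "(\<lambda>z. f z * g z) \<in> borel_measurable circle_measure" by measurable
qed

lemma L2_integrable: "f \<in> L2 \<Longrightarrow> integrable circle_measure f"
  using L2_mult_integrable[of f "\<lambda>_. 1"] by simp

lemma L2_inner_integrable: "f \<in> L2 \<Longrightarrow> g \<in> L2 \<Longrightarrow> integrable circle_measure (\<lambda>z. f z * cnj (g z))"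
  by (rule L2_mult_integrable) auto

section \<open>Inner product and norm\<close>

lemma L2_inner_add_left:
  "f \<in> L2 \<Longrightarrow> g \<in> L2 \<Longrightarrow> h \<in> L2 \<Longrightarrow> L2_inner (\<lambda>z. f z + g z) h = L2_inner f h + L2_inner g h"
  unfolding L2_inner_def by (simp add: ring_distribs L2_inner_integrable)

lemma L2_inner_diff_left:
  "f \<in> L2 \<Longrightarrow> g \<in> L2 \<Longrightarrow> h \<in> L2 \<Longrightarrow> L2_inner (\<lambda>z. f z - g z) h = L2_inner f h - L2_inner g h"
  unfolding L2_inner_def by (simp add: ring_distribs L2_inner_integrable)

lemma L2_inner_cmult_left: "L2_inner (\<lambda>z. c * f z) h = c * L2_inner f h"
  unfolding L2_inner_def by (simp add: mult.assoc)

lemma L2_inner_commute: "L2_inner g f = cnj (L2_inner f g)"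
proof -
  have "cnj (L2_inner f g) = (LINT z|circle_measure. cnj (f z * cnj (g z)))"
    unfolding L2_inner_def by (rule Bochner_Integration.integral_cnj[symmetric])
  thus ?thesis by (simp add: L2_inner_def mult.commute)
qed

lemma L2_inner_add_right:
  "f \<in> L2 \<Longrightarrow> g \<in> L2 \<Longrightarrow> h \<in> L2 \<Longrightarrow> L2_inner h (\<lambda>z. f z + g z) = L2_inner h f + L2_inner h g"
  by (subst (1 2 3) L2_inner_commute) (simp add: L2_inner_add_left)

lemma L2_inner_diff_right:
  "f \<in> L2 \<Longrightarrow> g \<in> L2 \<Longrightarrow> h \<in> L2 \<Longrightarrow> L2_inner h (\<lambda>z. f z - g z) = L2_inner h f - L2_inner h g"
  by (subst (1 2 3) L2_inner_commute) (simp add: L2_inner_diff_left)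

lemma L2_inner_cmult_right: "L2_inner h (\<lambda>z. c * f z) = cnj c * L2_inner h f"
  by (subst (1 2) L2_inner_commute) (simp add: L2_inner_cmult_left)

lemma L2_inner_cong_AE:
  assumes "AE z in circle_measure. f z = f' z" "AE z in circle_measure. g z = g' z"
    "f \<in> borel_measurable borel" "f' \<in> borel_measurable borel"
    "g \<in> borel_measurable borel" "g' \<in> borel_measurable borel"
  shows "L2_inner f g = L2_inner f' g'"
  unfolding L2_inner_def
proof (rule integral_cong_AE)
  note [measurable] = assms(3-)
  show "(\<lambda>z. f z * cnj (g z)) \<in> borel_measurable circle_measure"
    "(\<lambda>z. f' z * cnj (g' z)) \<in> borel_measurable circle_measure" by measurable
qed (use assms(1,2) in auto)

lemma L2_norm_nonneg [simp]: "L2_norm f \<ge> 0"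
  unfolding L2_norm_def by simp

lemma L2_norm_power2: "(L2_norm f)\<^sup>2 = (LINT z|circle_measure. (cmod (f z))\<^sup>2)"
  unfolding L2_norm_def by simp

lemma L2_inner_self: "L2_inner f f = of_real ((L2_norm f)\<^sup>2)"
  unfolding L2_norm_power2 L2_inner_def
  by (simp flip: integral_complex_of_real complex_norm_square of_real_power)

lemma L2_norm_cong_AE:
  assumes "AE z in circle_measure. cmod (f z) = cmod (g z)"
    "f \<in> borel_measurable borel" "g \<in> borel_measurable borel"
  shows "L2_norm f = L2_norm g"
  unfolding L2_norm_def
  by (intro arg_cong[where f = sqrt] integral_cong_AE) (use assms in auto)

lemma L2_norm_eq_0_iff:
  assumes "f \<in> L2" shows "L2_norm f = 0 \<longleftrightarrow> (AE z in circle_measure. f z = 0)"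
  unfolding L2_norm_def using integral_nonneg_eq_0_iff_AE[OF L2_integrable_square[OF assms]] by simp

lemma L2_norm_cmult: "L2_norm (\<lambda>z. c * f z) = cmod c * L2_norm f"
  by (simp add: L2_norm_def norm_mult power_mult_distrib real_sqrt_mult)

lemma L2_norm_minus_commute: "L2_norm (\<lambda>z. f z - g z) = L2_norm (\<lambda>z. g z - f z)"
  by (simp add: L2_norm_def norm_minus_commute)

lemma L2_norm_add_power2:
  assumes "f \<in> L2" "g \<in> L2"
  shows "(L2_norm (\<lambda>z. f z + g z))\<^sup>2 = (L2_norm f)\<^sup>2 + (L2_norm g)\<^sup>2 + 2 * Re (L2_inner f g)"
proof -
  have "complex_of_real ((L2_norm (\<lambda>z. f z + g z))\<^sup>2) =
      of_real ((L2_norm f)\<^sup>2) + of_real ((L2_norm g)\<^sup>2) + (L2_inner f g + cnj (L2_inner f g))"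
    using assms L2_inner_commute[of g f] unfolding L2_inner_self[symmetric]
    by (simp add: L2_inner_add_left L2_inner_add_right L2_add)
  also have "L2_inner f g + cnj (L2_inner f g) = of_real (2 * Re (L2_inner f g))"
    by (rule complex_add_cnj)
  finally show ?thesis unfolding of_real_add[symmetric] of_real_eq_iff .
qed

lemma L2_norm_diff_power2:
  assumes "f \<in> L2" "g \<in> L2"
  shows "(L2_norm (\<lambda>z. f z - g z))\<^sup>2 = (L2_norm f)\<^sup>2 + (L2_norm g)\<^sup>2 - 2 * Re (L2_inner f g)"
  using L2_norm_add_power2[of f "\<lambda>z. -1 * g z"] assms
    L2_inner_cmult_right[of f "-1" g] L2_norm_cmult[of "-1" g] by auto

text \<open>With the absolute values inside the integral this gives the bound on the inner product
  and, for the second factor \<open>1\<close>, the bound of the \<open>L1\<close> norm by the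
  \<open>L2\<close> norm, the total mass being 1.\<close>

lemma L2_Cauchy_Schwarz_abs:
  assumes "f \<in> L2" "g \<in> L2"
  shows "(LINT z|circle_measure. cmod (f z) * cmod (g z)) \<le> L2_norm f * L2_norm g"
proof -
  note [measurable] = assms
  have int: "integrable circle_measure (\<lambda>z. cmod (f z) * cmod (g z))"
    using L2_mult_integrable[OF assms] by (simp flip: norm_mult add: integrable_norm)
  have "ennreal ((LINT z|circle_measure. cmod (f z) * cmod (g z))\<^sup>2) =
      (\<integral>\<^sup>+z. ennreal (cmod (f z)) * ennreal (cmod (g z)) \<partial>circle_measure)\<^sup>2"
    by (simp add: nn_integral_eq_integral[OF int] ennreal_power flip: ennreal_mult)
  also have "\<dots> \<le> (\<integral>\<^sup>+z. (ennreal (cmod (f z)))\<^sup>2 \<partial>circle_measure) * (\<integral>\<^sup>+z. (ennreal (cmod (g z)))\<^sup>2 \<partial>circle_measure)"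
    by (rule Cauchy_Schwarz_nn_integral) auto
  also have "\<dots> = ennreal ((L2_norm f)\<^sup>2 * (L2_norm g)\<^sup>2)"
    using assms[THEN L2_integrable_square]
    by (simp add: ennreal_power nn_integral_eq_integral L2_norm_power2 ennreal_mult)
  finally have "(LINT z|circle_measure. cmod (f z) * cmod (g z))\<^sup>2 \<le> (L2_norm f * L2_norm g)\<^sup>2"
    by (simp add: power_mult_distrib)
  thus ?thesis by (rule power2_le_imp_le) simp
qed

lemma L2_Cauchy_Schwarz:
  assumes "f \<in> L2" "g \<in> L2"
  shows "cmod (L2_inner f g) \<le> L2_norm f * L2_norm g"
proof -
  have "cmod (L2_inner f g) \<le> (LINT z|circle_measure. cmod (f z * cnj (g z)))"
    unfolding L2_inner_def by (rule integral_norm_bound)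
  also have "\<dots> \<le> L2_norm f * L2_norm g"
    using L2_Cauchy_Schwarz_abs[OF assms] by (simp add: norm_mult)
  finally show ?thesis .
qed

lemma L2_norm_triangle:
  assumes "f \<in> L2" "g \<in> L2"
  shows "L2_norm (\<lambda>z. f z + g z) \<le> L2_norm f + L2_norm g"
proof (rule power2_le_imp_le)
  have "Re (L2_inner f g) \<le> L2_norm f * L2_norm g"
    using L2_Cauchy_Schwarz[OF assms] complex_Re_le_cmod order_trans by blast
  thus "(L2_norm (\<lambda>z. f z + g z))\<^sup>2 \<le> (L2_norm f + L2_norm g)\<^sup>2"
    unfolding L2_norm_add_power2[OF assms] power2_sum by simp
qed auto

lemma L2_norm_triangle':
  assumes "f \<in> L2" "g \<in> L2" "h \<in> L2"
  shows "L2_norm (\<lambda>z. f z - h z) \<le> L2_norm (\<lambda>z. f z - g z) + L2_norm (\<lambda>z. g z - h z)"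
  using L2_norm_triangle[of "\<lambda>z. f z - g z" "\<lambda>z. g z - h z"] assms by auto

lemma L1_le_L2_norm:
  assumes "f \<in> L2" shows "(LINT z|circle_measure. cmod (f z)) \<le> L2_norm f"
  using L2_Cauchy_Schwarz_abs[OF assms, of "\<lambda>_. 1"] by (simp add: L2_norm_def)

section \<open>Completeness, orthogonal projection and density\<close>

text \<open>Riesz-Fischer. Along a fast subsequence the \<open>L1\<close> norms of the increments
  are summable, so it converges almost everywhere; Fatou's lemma for integrals then carries the
  Cauchy estimate over to the limit.\<close>

lemma L2_complete:
  assumes F: "\<And>n. F n \<in> L2"
    and Cauchy: "\<And>e. e > 0 \<Longrightarrow> \<exists>N. \<forall>m\<ge>N. \<forall>n\<ge>N. L2_norm (\<lambda>z. F m z - F n z) < e"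
  obtains g where "g \<in> L2" "(\<lambda>n. L2_norm (\<lambda>z. F n z - g z)) \<longlonglongrightarrow> 0"
proof -
  note [measurable] = F
  have "\<exists>K. \<forall>i. \<forall>m\<ge>K i. \<forall>n\<ge>K i. L2_norm (\<lambda>z. F m z - F n z) < (1/2)^i"
    by (intro choice allI Cauchy) auto
  then obtain K where K: "\<And>i m n. m \<ge> K i \<Longrightarrow> n \<ge> K i \<Longrightarrow> L2_norm (\<lambda>z. F m z - F n z) < (1/2)^i"
    by blast
  \<comment> \<open>Adding up all thresholds so far gives \<open>k n \<ge> K n\<close> and
    \<open>k (Suc n) \<ge> K n\<close> without monotonicity of \<open>K\<close>; the summand
    \<open>n\<close> makes \<open>k n\<close> tend to infinity.\<close>
  define k where "k = (\<lambda>n. n + (\<Sum>i\<le>n. K i))"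
  have k_ge: "k n \<ge> n" "k n \<ge> K n" "k (Suc n) \<ge> K n" for n
  proof -
    have "K n \<le> (\<Sum>i\<le>n. K i)" by (rule member_le_sum) auto
    thus "k n \<ge> n" "k n \<ge> K n" "k (Suc n) \<ge> K n" by (auto simp: k_def)
  qed
  define D where "D = (\<lambda>n z. cmod (F (k (Suc n)) z - F (k n) z))"
  have [measurable]: "D n \<in> borel_measurable borel" for n unfolding D_def by measurable
  have D_int: "(\<integral>\<^sup>+z. D n z \<partial>circle_measure) \<le> ennreal ((1/2)^n)" for n
  proof -
    have L: "(\<lambda>z. F (k (Suc n)) z - F (k n) z) \<in> L2" using F by auto
    have "(\<integral>\<^sup>+z. D n z \<partial>circle_measure) = ennreal (LINT z|circle_measure. D n z)"
      unfolding D_def using L2_integrable[OF L]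
      by (intro nn_integral_eq_integral) auto
    also have "(LINT z|circle_measure. D n z) \<le> (1/2)^n"
      using L1_le_L2_norm[OF L] K[OF k_ge(3) k_ge(2), of n] unfolding D_def by linarith
    finally show ?thesis by (simp add: ennreal_leI)
  qed
  have "(\<integral>\<^sup>+z. (\<Sum>n. ennreal (D n z)) \<partial>circle_measure) = (\<Sum>n. \<integral>\<^sup>+z. D n z \<partial>circle_measure)"
    by (rule nn_integral_suminf) measurable
  also have "\<dots> \<le> (\<Sum>n. ennreal ((1/2)^n))"
    by (intro suminf_le D_int) auto
  also have "\<dots> < \<infinity>"
    by (subst suminf_ennreal2) auto
  finally have "AE z in circle_measure. (\<Sum>n. ennreal (D n z)) \<noteq> \<infinity>"
    by (intro nn_integral_PInf_AE) auto
  hence conv: "AE z in circle_measure. convergent (\<lambda>n. F (k n) z)"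
  proof eventually_elim
    case (elim z)
    hence "summable (\<lambda>n. D n z)"
      by (intro summable_suminf_not_top) (auto simp: D_def)
    hence "summable (\<lambda>n. F (k (Suc n)) z - F (k n) z)"
      unfolding D_def by (rule summable_norm_cancel)
    hence "convergent (\<lambda>n. \<Sum>i<n. F (k (Suc i)) z - F (k i) z)"
      by (simp add: summable_iff_convergent)
    hence "convergent (\<lambda>n. (F (k n) z - F (k 0) z) + F (k 0) z)"
      by (subst (asm) sum_lessThan_telescope) (intro convergent_add convergent_const)
    thus ?case by simp
  qed
  \<comment> \<open>Taking \<open>lim\<close> preserves measurability even where the sequence
    diverges, so \<open>g\<close> is Borel measurable although it is the limit only almost
    everywhere.\<close>
  define g where "g = (\<lambda>z. lim (\<lambda>n. F (k n) z))"
  have g_meas [measurable]: "g \<in> borel_measurable borel"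
    unfolding g_def by measurable
  have bound: "(\<integral>\<^sup>+z. ennreal ((cmod (F m z - g z))\<^sup>2) \<partial>circle_measure) \<le> ennreal (e\<^sup>2)"
    if N: "\<forall>m\<ge>N. \<forall>n\<ge>N. L2_norm (\<lambda>z. F m z - F n z) < e" and m: "m \<ge> N" for N m e
  proof -
    have "(\<integral>\<^sup>+z. ennreal ((cmod (F m z - g z))\<^sup>2) \<partial>circle_measure) =
        (\<integral>\<^sup>+z. liminf (\<lambda>n. ennreal ((cmod (F m z - F (k n) z))\<^sup>2)) \<partial>circle_measure)"
    proof (rule nn_integral_cong_AE, use conv in eventually_elim)
      case (elim z)
      hence "(\<lambda>n. F (k n) z) \<longlonglongrightarrow> g z" unfolding g_def by (simp add: convergent_LIMSEQ_iff)
      hence "(\<lambda>n. ennreal ((cmod (F m z - F (k n) z))\<^sup>2)) \<longlonglongrightarrow> ennreal ((cmod (F m z - g z))\<^sup>2)"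
        by (intro tendsto_intros)
      thus ?case by (intro lim_imp_Liminf[symmetric]) auto
    qed
    also have "\<dots> \<le> liminf (\<lambda>n. \<integral>\<^sup>+z. ennreal ((cmod (F m z - F (k n) z))\<^sup>2) \<partial>circle_measure)"
      by (rule nn_integral_liminf) measurable
    also have "\<dots> \<le> liminf (\<lambda>n. ennreal (e\<^sup>2))"
    proof (rule Liminf_mono, rule eventually_sequentiallyI)
      fix n assume n: "n \<ge> N"
      have L: "(\<lambda>z. F m z - F (k n) z) \<in> L2" using F by auto
      have "(\<integral>\<^sup>+z. ennreal ((cmod (F m z - F (k n) z))\<^sup>2) \<partial>circle_measure) =
          ennreal ((L2_norm (\<lambda>z. F m z - F (k n) z))\<^sup>2)"
        unfolding L2_norm_power2 by (intro nn_integral_eq_integral L2_integrable_square L) auto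
      also have "\<dots> \<le> ennreal (e\<^sup>2)"
        using N m n k_ge(1)[of n] by (intro ennreal_leI power_mono) (auto intro: less_imp_le)
      finally show "(\<integral>\<^sup>+z. ennreal ((cmod (F m z - F (k n) z))\<^sup>2) \<partial>circle_measure) \<le> ennreal (e\<^sup>2)" .
    qed
    also have "\<dots> = ennreal (e\<^sup>2)" by (simp add: Liminf_const)
    finally show ?thesis .
  qed
  have diff_L2: "(\<lambda>z. F m z - g z) \<in> L2"
    if "\<forall>m\<ge>N. \<forall>n\<ge>N. L2_norm (\<lambda>z. F m z - F n z) < e" "m \<ge> N" for N m e
    using le_less_trans[OF bound[OF that] ennreal_less_top]
    unfolding L2_iff by (auto simp: integrable_iff_bounded)
  obtain N where N: "\<forall>m\<ge>N. \<forall>n\<ge>N. L2_norm (\<lambda>z. F m z - F n z) < 1"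
    using Cauchy[of 1] by auto
  have g: "g \<in> L2"
    using L2_diff[OF F[of N] diff_L2[OF N order.refl]] by simp
  moreover have "(\<lambda>n. L2_norm (\<lambda>z. F n z - g z)) \<longlonglongrightarrow> 0"
  proof (rule LIMSEQ_I)
    fix r :: real assume r: "r > 0"
    obtain N where N: "\<forall>m\<ge>N. \<forall>n\<ge>N. L2_norm (\<lambda>z. F m z - F n z) < r/2"
      using Cauchy[of "r/2"] r by auto
    have "L2_norm (\<lambda>z. F m z - g z) \<le> r/2" if "m \<ge> N" for m
    proof (rule power2_le_imp_le)
      have "ennreal ((L2_norm (\<lambda>z. F m z - g z))\<^sup>2) \<le> ennreal ((r/2)\<^sup>2)"
        using bound[OF N that] L2_integrable_square[OF diff_L2[OF N that]]
        unfolding L2_norm_power2 by (subst (asm) nn_integral_eq_integral) auto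
      thus "(L2_norm (\<lambda>z. F m z - g z))\<^sup>2 \<le> (r/2)\<^sup>2"
        by (subst (asm) ennreal_le_iff) auto
    qed (use r in auto)
    hence "\<forall>n\<ge>N. norm (L2_norm (\<lambda>z. F n z - g z) - 0) < r"
      using r by force
    thus "\<exists>N. \<forall>n\<ge>N. norm (L2_norm (\<lambda>z. F n z - g z) - 0) < r" by blast
  qed
  ultimately show ?thesis by (rule that)
qed

lemma L2_subspaceD:
  assumes "L2_subspace M"
  shows "M \<subseteq> L2" "(\<lambda>z. 0) \<in> M"
    "f \<in> M \<Longrightarrow> g \<in> M \<Longrightarrow> (\<lambda>z. f z + g z) \<in> M"
    "f \<in> M \<Longrightarrow> g \<in> M \<Longrightarrow> (\<lambda>z. f z - g z) \<in> M"
    "f \<in> M \<Longrightarrow> (\<lambda>z. c * f z) \<in> M"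
    "f \<in> M \<Longrightarrow> g \<in> L2 \<Longrightarrow> AE z in circle_measure. g z = f z \<Longrightarrow> g \<in> M"
proof -
  show *: "M \<subseteq> L2" "(\<lambda>z. 0) \<in> M"
    "\<And>f g. f \<in> M \<Longrightarrow> g \<in> M \<Longrightarrow> (\<lambda>z. f z + g z) \<in> M"
    "\<And>f c. f \<in> M \<Longrightarrow> (\<lambda>z. c * f z) \<in> M"
    using assms unfolding L2_subspace_def by blast+
  show "f \<in> M \<Longrightarrow> g \<in> M \<Longrightarrow> (\<lambda>z. f z - g z) \<in> M"
    using *(3)[of f "\<lambda>z. -1 * g z"] *(4)[of g "-1"] by simp
  assume "f \<in> M" "g \<in> L2" "AE z in circle_measure. g z = f z"
  hence "g \<in> saturate M" unfolding saturate_def by blast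
  thus "g \<in> M" using assms unfolding L2_subspace_def by simp
qed

lemma L2_subspaceI:
  assumes "M \<subseteq> L2" "(\<lambda>z. 0) \<in> M"
    "\<And>f g. f \<in> M \<Longrightarrow> g \<in> M \<Longrightarrow> (\<lambda>z. f z + g z) \<in> M"
    "\<And>c f. f \<in> M \<Longrightarrow> (\<lambda>z. c * f z) \<in> M"
    "\<And>f g. f \<in> M \<Longrightarrow> g \<in> L2 \<Longrightarrow> AE z in circle_measure. g z = f z \<Longrightarrow> g \<in> M"
  shows "L2_subspace M"
proof -
  have "saturate M = M" unfolding saturate_def using assms by blast
  thus ?thesis unfolding L2_subspace_def using assms by blast
qed

text \<open>A minimizing sequence is Cauchy by the parallelogram law and its limit is a nearest
  point of \<open>M\<close>; minimality along each line in \<open>M\<close> is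
  orthogonality.\<close>

lemma L2_projection:
  assumes M: "L2_subspace M" "L2_closed M" and f: "f \<in> L2"
  obtains g where "g \<in> M" "\<And>h. h \<in> M \<Longrightarrow> L2_inner (\<lambda>z. f z - g z) h = 0"
proof -
  note MD = L2_subspaceD[OF M(1)]
  note M_L2 = subsetD[OF MD(1)]
  define d where "d = (INF g\<in>M. L2_norm (\<lambda>z. f z - g z))"
  have bdd: "bdd_below ((\<lambda>g. L2_norm (\<lambda>z. f z - g z)) ` M)" by (intro bdd_belowI[of _ 0]) auto
  have d_le: "d \<le> L2_norm (\<lambda>z. f z - g z)" if "g \<in> M" for g
    unfolding d_def by (rule cINF_lower[OF bdd that])
  have d0: "d \<ge> 0" unfolding d_def using MD(2) by (intro cINF_greatest) auto
  have "\<exists>g\<in>M. L2_norm (\<lambda>z. f z - g z) < d + 1 / Suc n" for n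
    using cInf_lessD[of "(\<lambda>g. L2_norm (\<lambda>z. f z - g z)) ` M" "d + 1 / Suc n"] MD(2)
    unfolding d_def by auto
  then obtain G where G: "\<And>n. G n \<in> M" "\<And>n. L2_norm (\<lambda>z. f z - G n z) < d + 1 / Suc n"
    by metis
  \<comment> \<open>The midpoint of \<open>G m\<close> and \<open>G n\<close> lies in
    \<open>M\<close>, so its distance from \<open>f\<close> is at least \<open>d\<close>; hence the
    term \<open>4 * d\<^sup>2\<close>.\<close>
  have par: "(L2_norm (\<lambda>z. G m z - G n z))\<^sup>2 \<le>
      2 * (L2_norm (\<lambda>z. f z - G m z))\<^sup>2 + 2 * (L2_norm (\<lambda>z. f z - G n z))\<^sup>2 - 4 * d\<^sup>2" for m n
  proof -
    have a: "(\<lambda>z. f z - G n z) \<in> L2" "(\<lambda>z. f z - G m z) \<in> L2" using f G M_L2 by auto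
    have "(\<lambda>z. 1/2 * (G n z + G m z)) \<in> M" using G MD(3,5) by blast
    from d_le[OF this] have "d\<^sup>2 \<le> (L2_norm (\<lambda>z. f z - 1/2 * (G n z + G m z)))\<^sup>2"
      using d0 by (intro power_mono) auto
    moreover have "L2_norm (\<lambda>z. (f z - G n z) + (f z - G m z)) =
        L2_norm (\<lambda>z. 2 * (f z - 1/2 * (G n z + G m z)))"
      by (simp add: algebra_simps)
    moreover have "\<dots> = 2 * L2_norm (\<lambda>z. f z - 1/2 * (G n z + G m z))"
      by (subst L2_norm_cmult) simp
    ultimately have "4 * d\<^sup>2 \<le> (L2_norm (\<lambda>z. (f z - G n z) + (f z - G m z)))\<^sup>2"
      by (simp add: power_mult_distrib)
    moreover have "(\<lambda>z. G m z - G n z) = (\<lambda>z. (f z - G n z) - (f z - G m z))" by auto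
    ultimately show ?thesis
      using L2_norm_add_power2[OF a] L2_norm_diff_power2[OF a] by simp
  qed
  have lim_d: "(\<lambda>n. d + 1 / Suc n) \<longlonglongrightarrow> d"
    using LIMSEQ_inverse_real_of_nat_add[of d] by (simp add: inverse_eq_divide)
  have nf: "(\<lambda>n. L2_norm (\<lambda>z. f z - G n z)) \<longlonglongrightarrow> d"
    by (rule tendsto_sandwich[OF _ _ tendsto_const lim_d])
       (use G d_le in \<open>auto intro!: always_eventually less_imp_le\<close>)
  obtain g where g: "g \<in> L2" "(\<lambda>n. L2_norm (\<lambda>z. G n z - g z)) \<longlonglongrightarrow> 0"
  proof (rule L2_complete[of G])
    fix e :: real assume e: "e > 0"
    have "(\<lambda>n. (L2_norm (\<lambda>z. f z - G n z))\<^sup>2) \<longlonglongrightarrow> d\<^sup>2"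
      by (intro tendsto_intros nf)
    from LIMSEQ_D[OF this, of "e\<^sup>2 / 4"] e obtain N where
      N: "\<And>n. n \<ge> N \<Longrightarrow> \<bar>(L2_norm (\<lambda>z. f z - G n z))\<^sup>2 - d\<^sup>2\<bar> < e\<^sup>2 / 4" by auto
    have "L2_norm (\<lambda>z. G m z - G n z) < e" if "m \<ge> N" "n \<ge> N" for m n
    proof (rule power2_less_imp_less)
      show "(L2_norm (\<lambda>z. G m z - G n z))\<^sup>2 < e\<^sup>2"
        using par[of m n] N[OF that(1)] N[OF that(2)] by linarith
    qed (use e in auto)
    thus "\<exists>N. \<forall>m\<ge>N. \<forall>n\<ge>N. L2_norm (\<lambda>z. G m z - G n z) < e" by blast
  qed (use G M_L2 in auto)
  have gM: "g \<in> M" using M(2) G(1) g unfolding L2_closed_def by blast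
  have "L2_norm (\<lambda>z. f z - g z) \<le> d + 0"
  proof (rule LIMSEQ_le_const[OF tendsto_add[OF nf g(2)]], intro exI allI impI)
    fix n show "L2_norm (\<lambda>z. f z - g z) \<le> L2_norm (\<lambda>z. f z - G n z) + L2_norm (\<lambda>z. G n z - g z)"
      using L2_norm_triangle'[of f "G n" g] f g G M_L2 by auto
  qed
  hence ng: "L2_norm (\<lambda>z. f z - g z) \<le> d" by simp
  show ?thesis
  proof (rule that[OF gM])
    fix h assume h: "h \<in> M"
    define w where "w = (\<lambda>z. f z - g z)"
    define a where "a = L2_inner w h"
    have w: "w \<in> L2" unfolding w_def using f g by auto
    have "a = 0"
    proof (cases "L2_norm h = 0")
      case True
      thus ?thesis using L2_Cauchy_Schwarz[OF w M_L2[OF h]] unfolding a_def by simp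
    next
      case False
      \<comment> \<open>The coefficient of the projection of \<open>w\<close> onto the line of
        \<open>h\<close>. Subtracting \<open>c * h\<close> lowers the squared norm by
        \<open>(cmod a)\<^sup>2 / (L2_norm h)\<^sup>2\<close>, which minimality forbids unless
        \<open>a = 0\<close>.\<close>
      define c where "c = a / of_real ((L2_norm h)\<^sup>2)"
      have "(\<lambda>z. g z + c * h z) \<in> M" by (rule MD(3)[OF gM MD(5)[OF h]])
      from d_le[OF this] have "d \<le> L2_norm (\<lambda>z. w z - c * h z)"
        by (simp add: w_def algebra_simps)
      hence "(L2_norm w)\<^sup>2 \<le> (L2_norm (\<lambda>z. w z - c * h z))\<^sup>2"
        using ng unfolding w_def by (intro power_mono) auto
      also have "\<dots> = (L2_norm w)\<^sup>2 + (cmod c * L2_norm h)\<^sup>2 - 2 * Re (cnj c * a)"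
        using w M_L2[OF h] by (subst L2_norm_diff_power2) (auto simp: L2_norm_cmult L2_inner_cmult_right a_def)
      also have "cnj c * a = of_real ((cmod a)\<^sup>2 / (L2_norm h)\<^sup>2)"
        by (simp only: c_def complex_cnj_divide complex_cnj_complex_of_real of_real_divide
            complex_norm_square mult.commute times_divide_eq_right)
      also have "(cmod c * L2_norm h)\<^sup>2 = (cmod a)\<^sup>2 / (L2_norm h)\<^sup>2"
        using False by (simp add: c_def norm_divide power_mult_distrib power_divide power2_eq_square norm_mult field_simps)
      finally have "(cmod a)\<^sup>2 / (L2_norm h)\<^sup>2 \<le> 0" unfolding Re_complex_of_real by linarith
      thus ?thesis using False by (simp add: divide_le_0_iff)
    qed
    thus "L2_inner (\<lambda>z. f z - g z) h = 0" by (simp add: a_def w_def)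
  qed
qed

lemma L2_perp_subspace:
  assumes "A \<subseteq> L2" shows "L2_subspace (L2_perp A)"
proof (rule L2_subspaceI)
  fix f g assume fg: "f \<in> L2_perp A" "g \<in> L2" "AE z in circle_measure. g z = f z"
  hence "L2_inner g h = L2_inner f h" if "h \<in> A" for h
    using that assms by (intro L2_inner_cong_AE) (auto simp: L2_perp_def L2_measurable)
  thus "g \<in> L2_perp A" using fg by (simp add: L2_perp_def)
next
  fix f g assume "f \<in> L2_perp A" "g \<in> L2_perp A"
  thus "(\<lambda>z. f z + g z) \<in> L2_perp A"
    using assms by (auto simp: L2_perp_def L2_add L2_inner_add_left subset_iff)
next
  fix c f assume "f \<in> L2_perp A"
  thus "(\<lambda>z. c * f z) \<in> L2_perp A" by (auto simp: L2_perp_def L2_inner_cmult_left)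
qed (auto simp: L2_perp_def L2_inner_def)

lemma L2_inner_tendsto:
  assumes F: "\<And>n. F n \<in> L2" and "g \<in> L2" "h \<in> L2" and lim: "(\<lambda>n. L2_norm (\<lambda>z. F n z - g z)) \<longlonglongrightarrow> 0"
  shows "(\<lambda>n. L2_inner (F n) h) \<longlonglongrightarrow> L2_inner g h"
proof (rule LIM_zero_cancel, rule Lim_null_comparison)
  show "(\<lambda>n. L2_norm (\<lambda>z. F n z - g z) * L2_norm h) \<longlonglongrightarrow> 0"
    using tendsto_mult_right[OF lim, of "L2_norm h"] by simp
  show "\<forall>\<^sub>F n in sequentially. norm (L2_inner (F n) h - L2_inner g h) \<le> L2_norm (\<lambda>z. F n z - g z) * L2_norm h"
    using L2_Cauchy_Schwarz[OF L2_diff[OF F assms(2)] assms(3)] assms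
    by (simp add: L2_inner_diff_left)
qed

lemma L2_perp_closed:
  assumes "A \<subseteq> L2" shows "L2_closed (L2_perp A)"
  unfolding L2_closed_def
proof (intro allI ballI impI, elim conjE)
  fix F g assume g: "g \<in> L2" and F: "\<forall>n::nat. F n \<in> L2_perp A"
    and lim: "(\<lambda>n. L2_norm (\<lambda>z. F n z - g z)) \<longlonglongrightarrow> 0"
  have "L2_inner g h = 0" if "h \<in> A" for h
  proof (rule LIMSEQ_unique[OF L2_inner_tendsto[OF _ g _ lim]])
    show "(\<lambda>n. L2_inner (F n) h) \<longlonglongrightarrow> 0"
      using F that by (simp add: L2_perp_def)
  qed (use F that assms in \<open>auto simp: L2_perp_def\<close>)
  thus "g \<in> L2_perp A" using g by (simp add: L2_perp_def)
qed

text \<open>The closure \<open>M\<close> of \<open>A\<close> is a closed subspace. The residual of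
  \<open>f\<close> after projection onto \<open>M\<close> annihilates \<open>A\<close>, so it is
  orthogonal to \<open>f\<close> by hypothesis and to the projection by construction; it therefore
  vanishes, and \<open>f\<close> lies in the closure.\<close>

lemma L2_dense:
  assumes A: "A \<subseteq> L2" "(\<lambda>_. 0) \<in> A" "\<And>f g. f \<in> A \<Longrightarrow> g \<in> A \<Longrightarrow> (\<lambda>z. f z + g z) \<in> A"
      "\<And>c f. f \<in> A \<Longrightarrow> (\<lambda>z. c * f z) \<in> A"
    and f: "f \<in> L2" "\<And>w. w \<in> L2_perp A \<Longrightarrow> L2_inner f w = 0" and e: "e > 0"
  shows "\<exists>a\<in>A. L2_norm (\<lambda>z. f z - a z) < e"
proof -
  define M where "M = {g \<in> L2. \<forall>e>0. \<exists>a\<in>A. L2_norm (\<lambda>z. g z - a z) < e}"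
  have M_ex: "\<exists>a\<in>A. L2_norm (\<lambda>z. g z - a z) < e" if "g \<in> M" "e > 0" for g e
    using that unfolding M_def by blast
  have AM: "A \<subseteq> M"
  proof
    fix a assume "a \<in> A"
    moreover have "L2_norm (\<lambda>z. a z - a z) = 0" by (simp add: L2_norm_def)
    ultimately show "a \<in> M" unfolding M_def using A(1) by force
  qed
  have sub: "L2_subspace M"
  proof (rule L2_subspaceI)
    fix g h assume gh: "g \<in> M" "h \<in> M"
    show "(\<lambda>z. g z + h z) \<in> M" unfolding M_def
    proof (intro CollectI conjI allI impI)
      fix e :: real assume "e > 0"
      then obtain a b where ab: "a \<in> A" "b \<in> A" "L2_norm (\<lambda>z. g z - a z) < e/2" "L2_norm (\<lambda>z. h z - b z) < e/2"
        using M_ex[OF gh(1), of "e/2"] M_ex[OF gh(2), of "e/2"] by auto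
      have "L2_norm (\<lambda>z. g z + h z - (a z + b z)) = L2_norm (\<lambda>z. (g z - a z) + (h z - b z))"
        by (simp add: algebra_simps)
      also have "\<dots> \<le> L2_norm (\<lambda>z. g z - a z) + L2_norm (\<lambda>z. h z - b z)"
        using gh ab A(1) by (intro L2_norm_triangle) (auto simp: M_def)
      finally have "L2_norm (\<lambda>z. g z + h z - (a z + b z)) < e" using ab by simp
      thus "\<exists>a\<in>A. L2_norm (\<lambda>z. g z + h z - a z) < e" by (rule bexI[OF _ A(3)[OF ab(1,2)]])
    qed (use gh in \<open>auto simp: M_def\<close>)
  next
    fix c g assume g: "g \<in> M"
    show "(\<lambda>z. c * g z) \<in> M" unfolding M_def
    proof (intro CollectI conjI allI impI)
      fix e :: real assume e: "e > 0"
      \<comment> \<open>The summand 1 covers \<open>c = 0\<close>.\<close>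
      have "e / (cmod c + 1) > 0" using e norm_ge_zero[of c] by (intro divide_pos_pos add_nonneg_pos) auto
      then obtain a where a: "a \<in> A" "L2_norm (\<lambda>z. g z - a z) < e / (cmod c + 1)"
        using M_ex[OF g] by blast
      have "L2_norm (\<lambda>z. c * g z - c * a z) = cmod c * L2_norm (\<lambda>z. g z - a z)"
        by (simp flip: L2_norm_cmult add: algebra_simps)
      also have "\<dots> \<le> cmod c * (e / (cmod c + 1))"
        using a by (intro mult_left_mono) auto
      also have "\<dots> < e" using e add_nonneg_pos[of "cmod c" 1] by (simp add: field_simps)
      finally show "\<exists>a\<in>A. L2_norm (\<lambda>z. c * g z - a z) < e" by (rule bexI[OF _ A(4)[OF a(1), of c]])
    qed (use g in \<open>auto simp: M_def\<close>)
  next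
    fix g h assume gh: "g \<in> M" "h \<in> L2" "AE z in circle_measure. h z = g z"
    have "L2_norm (\<lambda>z. h z - a z) = L2_norm (\<lambda>z. g z - a z)" if "a \<in> A" for a
    proof (rule L2_norm_cong_AE)
      show "AE z in circle_measure. cmod (h z - a z) = cmod (g z - a z)"
        using gh(3) by eventually_elim simp
    qed (use gh A(1) that in \<open>auto simp: M_def L2_diff intro!: L2_measurable\<close>)
    thus "h \<in> M" using gh by (auto simp: M_def)
  qed (use AM A(2) in \<open>auto simp: M_def\<close>)
  have cl: "L2_closed M" unfolding L2_closed_def
  proof (intro allI ballI impI, elim conjE)
    fix F g assume g: "g \<in> L2" and F: "\<forall>n::nat. F n \<in> M"
      and lim: "(\<lambda>n. L2_norm (\<lambda>z. F n z - g z)) \<longlonglongrightarrow> 0"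
    have "\<exists>a\<in>A. L2_norm (\<lambda>z. g z - a z) < e" if e: "e > 0" for e
    proof -
      obtain n where n: "L2_norm (\<lambda>z. F n z - g z) < e/2"
        using LIMSEQ_D[OF lim, of "e/2"] e by auto
      obtain a where a: "a \<in> A" "L2_norm (\<lambda>z. F n z - a z) < e/2"
        using M_ex[OF F[rule_format], of "e/2" n] e by auto
      have "L2_norm (\<lambda>z. g z - a z) \<le> L2_norm (\<lambda>z. g z - F n z) + L2_norm (\<lambda>z. F n z - a z)"
        using g F a A(1) by (intro L2_norm_triangle') (auto simp: M_def)
      thus ?thesis using n a L2_norm_minus_commute[of g "F n"] by force
    qed
    thus "g \<in> M" using g by (simp add: M_def)
  qed
  obtain g where g: "g \<in> M" and orth: "\<And>h. h \<in> M \<Longrightarrow> L2_inner (\<lambda>z. f z - g z) h = 0"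
    using L2_projection[OF sub cl f(1)] by blast
  define w where "w = (\<lambda>z. f z - g z)"
  have gL: "g \<in> L2" and wL: "w \<in> L2" using g f by (auto simp: M_def w_def)
  have "w \<in> L2_perp A" using wL orth AM by (auto simp: L2_perp_def w_def)
  hence "L2_inner f w = 0" by (rule f(2))
  moreover have "L2_inner g w = 0"
    using orth[OF g] L2_inner_commute[of g w] by (simp add: w_def)
  ultimately have "L2_inner w w = 0"
    using f(1) gL wL L2_inner_diff_left[of f g w] by (simp add: w_def)
  hence nw: "L2_norm w = 0" by (simp add: L2_inner_self)
  obtain a where a: "a \<in> A" "L2_norm (\<lambda>z. g z - a z) < e"
    using M_ex[OF g e] by blast
  have "L2_norm (\<lambda>z. f z - a z) \<le> L2_norm w + L2_norm (\<lambda>z. g z - a z)"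
    unfolding w_def using f(1) gL a A(1) by (intro L2_norm_triangle') auto
  thus ?thesis using a nw by force
qed

section \<open>Fourier coefficients\<close>

text \<open>Continuity on the whole plane supplies measurability; the bound on \<open>g\<close>
  comes from the compact circle, on which the measure is concentrated.\<close>

lemma integrable_mult_continuous:
  fixes F g :: "complex \<Rightarrow> complex"
  assumes F: "integrable circle_measure F" and g: "continuous_on UNIV g"
  shows "integrable circle_measure (\<lambda>z. F z * g z)"
proof -
  have "compact (g ` sphere 0 1)"
    using continuous_on_subset[OF g] by (intro compact_continuous_image) auto
  from compact_imp_bounded[OF this] obtain B where B: "\<forall>z\<in>sphere 0 1. cmod (g z) \<le> B"
    unfolding bounded_iff by auto
  have [measurable]: "g \<in> borel_measurable borel" by (rule borel_measurable_continuous_onI[OF g])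
  have [measurable]: "F \<in> borel_measurable circle_measure" using F by auto
  show ?thesis
  proof (rule Bochner_Integration.integrable_bound)
    show "integrable circle_measure (\<lambda>z. B * norm (F z))" using F by auto
    show "AE z in circle_measure. norm (F z * g z) \<le> norm (B * norm (F z))"
      using AE_circle_cmod
    proof eventually_elim
      case (elim z)
      have "norm (F z * g z) \<le> B * norm (F z)"
        using B elim by (auto simp: norm_mult mult.commute[of "cmod (F z)"] intro: mult_right_mono)
      thus ?case using abs_ge_self order_trans by fastforce
    qed
  qed measurable
qed

lemma circle_powi_integrable:
  assumes F: "integrable circle_measure F"
  shows "integrable circle_measure (\<lambda>z. F z * z powi n)"
proof (rule Bochner_Integration.integrable_bound[OF F])
  show "(\<lambda>z. F z * z powi n) \<in> borel_measurable circle_measure"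
    using borel_measurable_integrable[OF F] by measurable
  show "AE z in circle_measure. norm (F z * z powi n) \<le> norm (F z)"
    using AE_circle_cmod by eventually_elim (simp add: norm_mult norm_power_int)
qed

lemma circle_cnj_eq:
  assumes "cmod z = 1" shows "cnj z = z powi (-1)" "z * cnj z = 1" "cnj z * z = 1" "z \<noteq> 0"
proof -
  have *: "z * cnj z = 1" using assms complex_norm_square[of z] by simp
  thus "z * cnj z = 1" "cnj z * z = 1" "z \<noteq> 0" by (auto simp: mult.commute)
  show "cnj z = z powi (-1)" using inverse_unique[OF *] by (simp add: power_int_minus)
qed

lemma circle_cnj_powi:
  assumes "cmod z = 1" shows "cnj z powi n = z powi (- n)" "cnj (z powi n) = z powi (- n)"
proof -
  show "cnj z powi n = z powi (- n)"
    unfolding circle_cnj_eq(1)[OF assms] by (simp add: power_int_minus power_int_inverse)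
  moreover have "cnj (z powi n) = cnj z powi n"
    by (simp add: power_int_def)
  ultimately show "cnj (z powi n) = z powi (- n)" by simp
qed

text \<open>Quantifying over \<open>F\<close> inside the statement is what makes the case of products go through.\<close>

lemma Fourier_annihilator_mult_polynomial:
  assumes "real_polynomial_function g"
  shows "\<forall>F. integrable circle_measure F \<and> (\<forall>n. (LINT z|circle_measure. F z * z powi n) = 0) \<longrightarrow>
     integrable circle_measure (\<lambda>z. F z * of_real (g z)) \<and>
     (\<forall>n. (LINT z|circle_measure. F z * of_real (g z) * z powi n) = 0)"
  using assms
proof induction
  case (linear g)
  interpret bounded_linear g by fact
  \<comment> \<open>From \<open>g z = Re z * g 1 + Im z * g \<i>\<close>, with the real and
    imaginary part expressed through \<open>z\<close> and \<open>cnj z\<close>, the latter being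
    \<open>z powi (-1)\<close> on the circle.\<close>
  define a b where "a = (of_real (g 1) - \<i> * of_real (g \<i>)) / 2"
    and "b = (of_real (g 1) + \<i> * of_real (g \<i>)) / 2"
  have g: "complex_of_real (g z) = a * z + b * z powi (-1)" if "cmod z = 1" for z
  proof -
    have "g z = g (Re z *\<^sub>R 1 + Im z *\<^sub>R \<i>)"
      by (rule arg_cong[where f = g]) (simp add: complex_eq_iff)
    also have "\<dots> = Re z * g 1 + Im z * g \<i>" by (simp only: add scaleR real_scaleR_def)
    finally show ?thesis
      unfolding circle_cnj_eq(1)[OF that, symmetric] by (simp add: a_def b_def complex_eq_iff field_simps)
  qed
  show ?case
  proof (intro allI impI, elim conjE, intro conjI allI)
    fix F n assume F: "integrable circle_measure F" and z: "\<forall>n. (LINT z|circle_measure. F z * z powi n) = 0"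
    show "integrable circle_measure (\<lambda>z. F z * complex_of_real (g z))"
      by (intro integrable_mult_continuous F continuous_intros linear_continuous_on bounded_linear_axioms)
    have m [measurable]: "F \<in> borel_measurable circle_measure" using F by auto
    have [measurable]: "g \<in> borel_measurable borel"
      by (intro borel_measurable_continuous_onI linear_continuous_on bounded_linear_axioms)
    have "(LINT z|circle_measure. F z * complex_of_real (g z) * z powi n) =
       (LINT z|circle_measure. a * (F z * z powi (n+1)) + b * (F z * z powi (n-1)))"
    proof (rule integral_cong_AE)
      show "AE z in circle_measure. F z * complex_of_real (g z) * z powi n =
          a * (F z * z powi (n+1)) + b * (F z * z powi (n-1))"
        using AE_circle_cmod
      proof eventually_elim
        case (elim z)
        show ?case using circle_cnj_eq(4)[OF elim] unfolding g[OF elim]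
          by (simp add: power_int_add power_int_diff field_simps)
      qed
    qed measurable
    also have "\<dots> = 0"
      using z circle_powi_integrable[OF F] by (subst Bochner_Integration.integral_add) auto
    finally show "(LINT z|circle_measure. F z * complex_of_real (g z) * z powi n) = 0" .
  qed
next
  case (const c)
  have "(\<lambda>z. F z * complex_of_real c * z powi n) = (\<lambda>z. complex_of_real c * (F z * z powi n))" for F n
    by (auto simp: mult_ac)
  thus ?case by auto
next
  case (add f g)
  show ?case
  proof (intro allI impI, elim conjE)
    fix F assume "integrable circle_measure F" "\<forall>n. (LINT z|circle_measure. F z * z powi n) = 0"
    with add.IH have *:
      "integrable circle_measure (\<lambda>z. F z * of_real (f z))"
      "integrable circle_measure (\<lambda>z. F z * of_real (g z))"
      "\<And>n. (LINT z|circle_measure. F z * of_real (f z) * z powi n) = 0"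
      "\<And>n. (LINT z|circle_measure. F z * of_real (g z) * z powi n) = 0" by blast+
    have "(LINT z|circle_measure. F z * of_real (f z) * z powi n + F z * of_real (g z) * z powi n) = 0" for n
      using *(3,4) by (subst Bochner_Integration.integral_add) (auto intro!: circle_powi_integrable *)
    moreover have "integrable circle_measure (\<lambda>z. F z * of_real (f z) + F z * of_real (g z))"
      using *(1,2) by auto
    ultimately show "integrable circle_measure (\<lambda>z. F z * complex_of_real (f z + g z)) \<and>
           (\<forall>n. (LINT z|circle_measure. F z * complex_of_real (f z + g z) * z powi n) = 0)"
      by (simp add: ring_distribs)
  qed
next
  case (mult f g)
  show ?case
  proof (intro allI impI)
    fix F assume "integrable circle_measure F \<and> (\<forall>n. (LINT z|circle_measure. F z * z powi n) = 0)"
    with mult.IH(1) have "integrable circle_measure (\<lambda>z. F z * of_real (f z)) \<and>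
       (\<forall>n. (LINT z|circle_measure. F z * of_real (f z) * z powi n) = 0)" by blast
    with spec[OF mult.IH(2), of "\<lambda>z. F z * of_real (f z)"]
    have "integrable circle_measure (\<lambda>z. (F z * of_real (f z)) * of_real (g z)) \<and>
       (\<forall>n. (LINT z|circle_measure. (F z * of_real (f z)) * of_real (g z) * z powi n) = 0)"
      by blast
    thus "integrable circle_measure (\<lambda>z. F z * complex_of_real (f z * g z)) \<and>
           (\<forall>n. (LINT z|circle_measure. F z * complex_of_real (f z * g z) * z powi n) = 0)"
      by (simp add: mult.assoc)
  qed
qed

text \<open>By Stone-Weierstrass a polynomial in the two real coordinates approximates
  \<open>g\<close> uniformly on the circle, and the replacement costs at most \<open>e\<close> times
  the \<open>L1\<close> norm of \<open>F\<close>.\<close>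

lemma Fourier_annihilator_continuous:
  assumes F: "integrable circle_measure F" "\<And>n. (LINT z|circle_measure. F z * z powi n) = 0"
    and g: "continuous_on UNIV g"
  shows "(LINT z|circle_measure. F z * complex_of_real (g z)) = 0"
proof -
  define B where "B = (LINT z|circle_measure. norm (F z))"
  have "norm (LINT z|circle_measure. F z * complex_of_real (g z)) \<le> e * B" if e: "e > 0" for e
  proof -
    obtain p where p: "real_polynomial_function p" "\<And>z. z \<in> sphere 0 1 \<Longrightarrow> \<bar>g z - p z\<bar> < e"
      using Stone_Weierstrass_real_polynomial_function[of "sphere (0::complex) 1" g e]
        continuous_on_subset[OF g] e by auto
    have pF: "integrable circle_measure (\<lambda>z. F z * of_real (p z))"
      "(LINT z|circle_measure. F z * of_real (p z)) = 0"
      using Fourier_annihilator_mult_polynomial[OF p(1)] F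
      by (metis, metis (mono_tags, lifting) Bochner_Integration.integral_cong mult.right_neutral power_int_0_right)
    have gF: "integrable circle_measure (\<lambda>z. F z * of_real (g z))"
      by (intro integrable_mult_continuous F continuous_intros g)
    have "(LINT z|circle_measure. F z * complex_of_real (g z)) =
       (LINT z|circle_measure. F z * of_real (g z) - F z * of_real (p z))"
      using pF gF by simp
    also have "norm \<dots> \<le> (LINT z|circle_measure. norm (F z * of_real (g z) - F z * of_real (p z)))"
      by (rule integral_norm_bound)
    also have "\<dots> \<le> (LINT z|circle_measure. e * norm (F z))"
    proof (rule integral_mono_AE)
      show "AE z in circle_measure. norm (F z * of_real (g z) - F z * of_real (p z)) \<le> e * norm (F z)"
        using AE_circle_cmod
      proof eventually_elim
        case (elim z)
        have "norm (F z * of_real (g z) - F z * of_real (p z)) = norm (F z) * \<bar>g z - p z\<bar>"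
          by (simp flip: right_diff_distrib of_real_diff add: norm_mult)
        also have "\<dots> \<le> norm (F z) * e" using p(2)[of z] elim by (intro mult_left_mono) auto
        finally show ?case by (simp add: mult.commute)
      qed
    qed (use pF gF F in auto)
    finally show ?thesis by (simp add: B_def)
  qed
  moreover have "B \<ge> 0" unfolding B_def by simp
  ultimately have "norm (LINT z|circle_measure. F z * complex_of_real (g z)) \<le> 0 + e" if "e > 0" for e
  proof -
    \<comment> \<open>Dividing by \<open>B + 1\<close> allows for \<open>B = 0\<close>.\<close>
    have "e / (B + 1) * B \<le> e" using that \<open>B \<ge> 0\<close> by (simp add: field_simps)
    moreover have "e / (B + 1) > 0" using that \<open>B \<ge> 0\<close> by simp
    ultimately show ?thesis
      using \<open>\<And>e. e > 0 \<Longrightarrow> norm (LINT z|circle_measure. F z * complex_of_real (g z)) \<le> e * B\<close>[of "e / (B+1)"]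
      by linarith
  qed
  hence "norm (LINT z|circle_measure. F z * complex_of_real (g z)) \<le> 0" by (rule field_le_epsilon)
  thus ?thesis by simp
qed

text \<open>Stated for integrable functions because it is later applied to a squared modulus, which
  need not lie in \<open>L2\<close>. Vanishing against continuous functions passes to indicators of
  closed sets and from there to all Borel sets by Dynkin's argument.\<close>

lemma Fourier_unique:
  assumes F: "integrable circle_measure F" "\<And>n. (LINT z|circle_measure. F z * z powi n) = 0"
  shows "AE z in circle_measure. F z = 0"
proof -
  have [measurable]: "F \<in> borel_measurable circle_measure" using F by auto
  have closed: "(LINT z|circle_measure. indicat_real K z *\<^sub>R F z) = 0" if K: "closed K" for K
  proof (cases "K = {}")
    case False
    \<comment> \<open>Continuous cutoffs: 1 on \<open>K\<close>, and 0 at a point off the closed set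
      \<open>K\<close> once \<open>k\<close> exceeds the reciprocal of its distance. The empty set
      is kept apart because \<open>infdist\<close> to it is 0 by convention.\<close>
    define g where "g = (\<lambda>k z. max 0 (1 - real k * infdist z K))"
    have g: "continuous_on UNIV (g k)" for k unfolding g_def by (intro continuous_intros)
    have [measurable]: "g k \<in> borel_measurable borel" for k by (rule borel_measurable_continuous_onI[OF g])
    have "(\<lambda>k. LINT z|circle_measure. F z * complex_of_real (g k z)) \<longlonglongrightarrow>
        (LINT z|circle_measure. indicat_real K z *\<^sub>R F z)"
    proof (rule integral_dominated_convergence)
      show "integrable circle_measure (\<lambda>z. norm (F z))" using F by auto
      show "AE z in circle_measure. norm (F z * complex_of_real (g k z)) \<le> norm (F z)" for k
        by (rule AE_I2) (auto simp: norm_mult g_def infdist_nonneg intro!: mult_right_le_one_le)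
      show "AE z in circle_measure. (\<lambda>k. F z * complex_of_real (g k z)) \<longlonglongrightarrow> indicat_real K z *\<^sub>R F z"
      proof (rule AE_I2)
        fix z
        have "(\<lambda>k. g k z) \<longlonglongrightarrow> indicat_real K z"
        proof (cases "z \<in> K")
          case True
          thus ?thesis by (simp add: g_def)
        next
          case zK: False
          hence d: "infdist z K > 0"
            using in_closed_iff_infdist_zero[OF K False] infdist_nonneg[of z K] by force
          obtain N :: nat where N: "real N * infdist z K > 1" using reals_Archimedean3[OF d] by blast
          have "g k z = 0" if "k \<ge> N" for k
          proof -
            have "real N * infdist z K \<le> real k * infdist z K" using that d by (intro mult_right_mono) auto
            thus ?thesis using N by (simp add: g_def)
          qed
          hence "eventually (\<lambda>k. g k z = indicat_real K z) sequentially"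
            using zK by (auto simp: eventually_sequentially)
          thus ?thesis by (rule tendsto_eventually)
        qed
        hence "(\<lambda>k. F z * complex_of_real (g k z)) \<longlonglongrightarrow> F z * complex_of_real (indicat_real K z)"
          by (intro tendsto_intros)
        thus "(\<lambda>k. F z * complex_of_real (g k z)) \<longlonglongrightarrow> indicat_real K z *\<^sub>R F z"
          by (simp add: scaleR_conv_of_real mult.commute)
      qed
    next
      have [measurable]: "K \<in> sets borel" using K by simp
      show "(\<lambda>z. indicat_real K z *\<^sub>R F z) \<in> borel_measurable circle_measure" by measurable
      show "(\<lambda>z. F z * complex_of_real (g k z)) \<in> borel_measurable circle_measure" for k by measurable
    qed
    moreover have "(LINT z|circle_measure. F z * complex_of_real (g k z)) = 0" for k
      by (rule Fourier_annihilator_continuous[OF F g])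
    ultimately show ?thesis by (simp add: LIMSEQ_const_iff)
  qed simp
  have int: "integrable circle_measure (\<lambda>z. indicat_real A z *\<^sub>R F z)" if "A \<in> sets borel" for A
    using that F by (intro integrable_mult_indicator) auto
  have "(LINT z|circle_measure. indicat_real A z *\<^sub>R F z) = 0" if A: "A \<in> sigma_sets UNIV (Collect closed)" for A
  proof -
    note sb = borel_eq_closed[THEN arg_cong[where f = sets]]
    have *: "sigma_sets UNIV (Collect closed) = sets (borel :: complex measure)"
      unfolding sb by (rule sets_measure_of[symmetric]) simp
    have "Int_stable (Collect closed :: complex set set)" "Collect closed \<subseteq> Pow (UNIV :: complex set)"
      by (auto simp: Int_stable_def)
    from this A show ?thesis
    proof (induction rule: sigma_sets_induct_disjoint)
      case (basic A) thus ?case using closed by simp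
    next
      case empty show ?case by simp
    next
      case (compl A)
      have A: "A \<in> sets borel" using compl * by simp
      have "(LINT z|circle_measure. indicat_real (UNIV - A) z *\<^sub>R F z) =
         (LINT z|circle_measure. indicat_real UNIV z *\<^sub>R F z - indicat_real A z *\<^sub>R F z)"
        by (intro Bochner_Integration.integral_cong) (auto simp: indicator_def)
      also have "\<dots> = 0"
        using int[OF A] int[of UNIV] closed[of UNIV] compl by (subst Bochner_Integration.integral_diff) auto
      finally show ?case .
    next
      case (union A)
      have A: "range A \<subseteq> sets circle_measure" using union * by auto
      have "set_lebesgue_integral circle_measure (\<Union>i. A i) F = (\<Sum>i. set_lebesgue_integral circle_measure (A i) F)"
        using A union(1) int[of "\<Union>i. A i"]
        by (intro lebesgue_integral_countable_add)
           (auto simp: disjoint_family_on_def set_integrable_def)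
      also have "\<dots> = 0" using union unfolding set_lebesgue_integral_def by simp
      finally show ?case unfolding set_lebesgue_integral_def .
    qed
  qed
  moreover have "sigma_sets UNIV (Collect closed) = sets (borel :: complex measure)"
    unfolding borel_eq_closed by (rule sets_measure_of[symmetric]) simp
  ultimately have "set_lebesgue_integral circle_measure A F = set_lebesgue_integral circle_measure A (\<lambda>_. 0)"
    if "A \<in> sets circle_measure" for A
    using that unfolding set_lebesgue_integral_def by simp
  thus ?thesis
    using F by (intro circle.density_unique_banach) auto
qed

section \<open>Calculus of Fourier coefficients\<close>

lemma fourier_coeff_eq_inner:
  assumes "f \<in> L2" shows "fourier_coeff f n = L2_inner f (\<lambda>z. z powi n)"
  unfolding fourier_coeff_def L2_inner_def
proof (rule integral_cong_AE)
  note [measurable] = assms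
  show "AE z in circle_measure. f z * z powi - n = f z * cnj (z powi n)"
    using AE_circle_cmod by eventually_elim (simp add: circle_cnj_powi)
qed (use assms in measurable)

lemma L2_zeroI:
  assumes "f \<in> L2" "\<And>n. fourier_coeff f n = 0"
  shows "AE z in circle_measure. f z = 0"
proof (rule Fourier_unique[OF L2_integrable[OF assms(1)]])
  fix n show "(LINT z|circle_measure. f z * z powi n) = 0"
    using assms(2)[of "-n"] by (simp add: fourier_coeff_def)
qed

lemma fourier_coeff_cong_AE:
  assumes "AE z in circle_measure. f z = g z" "f \<in> borel_measurable borel" "g \<in> borel_measurable borel"
  shows "fourier_coeff f n = fourier_coeff g n"
  unfolding fourier_coeff_def
proof (rule integral_cong_AE)
  note [measurable] = assms(2,3)
  show "(\<lambda>z. f z * z powi - n) \<in> borel_measurable circle_measure"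
    "(\<lambda>z. g z * z powi - n) \<in> borel_measurable circle_measure" by measurable
qed (use assms(1) in auto)

lemma fourier_coeff_powi: "fourier_coeff (\<lambda>z. z powi m) n = (if m = n then 1 else 0)"
proof -
  have "fourier_coeff (\<lambda>z. z powi m) n = (LINT z|circle_measure. z powi (m - n))"
    unfolding fourier_coeff_def
  proof (rule integral_cong_AE)
    show "AE z in circle_measure. z powi m * z powi - n = z powi (m - n)"
      using AE_circle_cmod
      by eventually_elim (simp add: circle_cnj_eq(4) power_int_diff power_int_minus divide_inverse)
  qed measurable
  thus ?thesis by (simp add: integral_circle_powi)
qed

lemma fourier_coeff_add:
  "f \<in> L2 \<Longrightarrow> g \<in> L2 \<Longrightarrow> fourier_coeff (\<lambda>z. f z + g z) n = fourier_coeff f n + fourier_coeff g n"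
  by (simp add: fourier_coeff_eq_inner L2_add L2_inner_add_left)

lemma fourier_coeff_diff:
  "f \<in> L2 \<Longrightarrow> g \<in> L2 \<Longrightarrow> fourier_coeff (\<lambda>z. f z - g z) n = fourier_coeff f n - fourier_coeff g n"
  by (simp add: fourier_coeff_eq_inner L2_diff L2_inner_diff_left)

lemma fourier_coeff_cmult: "fourier_coeff (\<lambda>z. c * f z) n = c * fourier_coeff f n"
  unfolding fourier_coeff_def by (simp add: mult.assoc)

lemma fourier_coeff_z_mult:
  assumes "f \<in> L2"
  shows "fourier_coeff (\<lambda>z. z * f z) n = fourier_coeff f (n - 1)"
  unfolding fourier_coeff_def
proof (rule integral_cong_AE)
  note [measurable] = assms
  show "AE z in circle_measure. z * f z * z powi - n = f z * z powi - (n - 1)"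
    using AE_circle_cmod
  proof eventually_elim
    case (elim z)
    hence "z powi - (n - 1) = z * z powi - n"
      using power_int_add[of z 1 "-n"] circle_cnj_eq(4)[OF elim] by simp
    thus ?case by simp
  qed
qed (use assms in measurable)

lemma fourier_coeff_cnj:
  assumes "f \<in> L2"
  shows "fourier_coeff (\<lambda>z. cnj (f z)) n = cnj (fourier_coeff f (- n))"
proof -
  note [measurable] = assms
  have "fourier_coeff (\<lambda>z. cnj (f z)) n = (LINT z|circle_measure. cnj (f z * z powi n))"
    unfolding fourier_coeff_def
  proof (rule integral_cong_AE)
    show "AE z in circle_measure. cnj (f z) * z powi - n = cnj (f z * z powi n)"
      using AE_circle_cmod by eventually_elim (simp add: circle_cnj_powi)
  qed measurable
  also have "\<dots> = cnj (fourier_coeff f (- n))"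
    unfolding fourier_coeff_def by (subst Bochner_Integration.integral_cnj) simp
  finally show ?thesis .
qed

section \<open>The Hardy space and its orthogonal complement\<close>

lemma H2_L2: "f \<in> H2 \<Longrightarrow> f \<in> L2" by (simp add: H2_def)

lemma H2_eq_perp: "H2 = L2_perp {\<lambda>z. z powi n |n. n < 0}"
  unfolding H2_def L2_perp_def by (auto simp: fourier_coeff_eq_inner)

lemma H2_subspace: "L2_subspace H2" and H2_closed: "L2_closed H2"
  unfolding H2_eq_perp by (rule L2_perp_subspace L2_perp_closed; force)+

lemma H2_z_mult: "f \<in> H2 \<Longrightarrow> (\<lambda>z. z * f z) \<in> H2"
  unfolding H2_def by (auto simp: fourier_coeff_z_mult)

lemma H2_power: "(\<lambda>z. z ^ n) \<in> H2"
  using L2_powi[of "int n"] fourier_coeff_powi[of "int n"] unfolding H2_def by auto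

lemma conj_z_iff:
  "f \<in> conj_z A \<longleftrightarrow> f \<in> L2 \<and> (\<exists>h\<in>A. AE z in circle_measure. f z = cnj (z * h z))"
  unfolding conj_z_def saturate_def by auto

text \<open>The map taking \<open>f\<close> to \<open>cnj (z * f z)\<close> is an involution on the
  circle and carries the index \<open>n\<close> to \<open>- n - 1\<close>, so it exchanges negative
  and nonnegative indices.\<close>

lemma conj_H2_0_eq: "conj_H2_0 = {f \<in> L2. \<forall>n\<ge>0. fourier_coeff f n = 0}"
proof (intro set_eqI iffI)
  fix f assume "f \<in> conj_H2_0"
  then obtain h where h: "h \<in> H2" "f \<in> L2" "AE z in circle_measure. f z = cnj (z * h z)"
    unfolding conj_H2_0_def conj_z_iff by blast
  hence L: "h \<in> L2" by (simp add: H2_def)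
  have "fourier_coeff f n = 0" if "n \<ge> 0" for n
  proof -
    have "fourier_coeff f n = fourier_coeff (\<lambda>z. cnj (z * h z)) n"
      using h(2,3) by (intro fourier_coeff_cong_AE L2_measurable L2_cnj L2_z_mult L)
    also have "\<dots> = cnj (fourier_coeff h (- n - 1))"
      using L by (subst fourier_coeff_cnj) (auto simp: fourier_coeff_z_mult L2_z_mult)
    also have "\<dots> = 0" using h that by (simp add: H2_def)
    finally show ?thesis .
  qed
  thus "f \<in> {f \<in> L2. \<forall>n\<ge>0. fourier_coeff f n = 0}" using h by simp
next
  fix f assume f: "f \<in> {f \<in> L2. \<forall>n\<ge>0. fourier_coeff f n = 0}"
  define h where "h = (\<lambda>z. cnj (z * f z))"
  have "h \<in> H2" unfolding H2_def h_def
    using f by (auto simp: fourier_coeff_cnj fourier_coeff_z_mult L2_z_mult simp del: complex_cnj_mult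
        intro: L2_cnj)
  moreover have "AE z in circle_measure. f z = cnj (z * h z)"
    using AE_circle_cmod
  proof eventually_elim
    case (elim z)
    thus ?case using circle_cnj_eq(3)[OF elim] by (simp add: h_def flip: mult.assoc)
  qed
  ultimately show "f \<in> conj_H2_0" using f
    unfolding conj_H2_0_def conj_z_iff by blast
qed

text \<open>The projection \<open>g\<close> of \<open>f\<close> onto \<open>H2\<close> has no
  coefficient of negative index, and none of nonnegative index either, because \<open>f\<close> has
  none and \<open>f - g\<close> is orthogonal to the powers of \<open>z\<close>. Hence it is null
  and \<open>f\<close> equals its residual.\<close>

lemma conj_H2_0_orth_H2:
  assumes f: "f \<in> conj_H2_0" and h: "h \<in> H2"
  shows "L2_inner f h = 0"
proof -
  have fL: "f \<in> L2" and f0: "\<And>n. n \<ge> 0 \<Longrightarrow> fourier_coeff f n = 0" using f by (auto simp: conj_H2_0_eq)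
  obtain g where g: "g \<in> H2" and orth: "\<And>h. h \<in> H2 \<Longrightarrow> L2_inner (\<lambda>z. f z - g z) h = 0"
    using L2_projection[OF H2_subspace H2_closed fL] by blast
  have gL: "g \<in> L2" using g by (simp add: H2_def)
  have "fourier_coeff g n = 0" for n
  proof (cases "n \<ge> 0")
    case True
    have "fourier_coeff (\<lambda>z. f z - g z) n = 0"
      using orth[OF H2_power[of "nat n"]] True fL gL
      by (subst fourier_coeff_eq_inner) (auto simp: power_int_def)
    thus ?thesis using f0[OF True] fL gL by (simp add: fourier_coeff_diff)
  qed (use g in \<open>auto simp: H2_def\<close>)
  hence g0: "AE z in circle_measure. g z = 0" using L2_zeroI[OF gL] by blast
  have "L2_inner f h = L2_inner (\<lambda>z. f z - g z) h"
    using g0 fL gL H2_L2[OF h] by (intro L2_inner_cong_AE L2_measurable) auto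
  thus ?thesis using orth[OF h] by simp
qed

lemma L2_decompose:
  assumes "f \<in> L2"
  obtains g h where "g \<in> conj_H2_0" "h \<in> H2" "\<And>z. f z = g z + h z"
proof -
  obtain h where h: "h \<in> H2" and orth: "\<And>k. k \<in> H2 \<Longrightarrow> L2_inner (\<lambda>z. f z - h z) k = 0"
    using L2_projection[OF H2_subspace H2_closed assms] by blast
  have L: "(\<lambda>z. f z - h z) \<in> L2" using assms H2_L2[OF h] by auto
  have "fourier_coeff (\<lambda>z. f z - h z) n = 0" if "n \<ge> 0" for n
    using orth[OF H2_power[of "nat n"]] that L
    by (subst fourier_coeff_eq_inner) (auto simp: power_int_def)
  hence "(\<lambda>z. f z - h z) \<in> conj_H2_0" using L by (simp add: conj_H2_0_eq)
  thus ?thesis using h by (intro that[of "\<lambda>z. f z - h z" h]) auto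
qed

lemma H2_poly: "poly p \<in> H2"
proof (induction p)
  case (pCons a p)
  have "(\<lambda>z. a + z * poly p z) \<in> H2"
    using L2_subspaceD(3)[OF H2_subspace L2_subspaceD(5)[OF H2_subspace H2_power[of 0], of a] H2_z_mult[OF pCons.IH]]
    by simp
  thus ?case by simp
qed (use L2_subspaceD(2)[OF H2_subspace] in auto)

text \<open>The annihilator of the polynomials consists of functions without coefficients of
  nonnegative index, so it lies in \<open>conj_H2_0\<close> and is orthogonal to
  \<open>H2\<close>.\<close>

lemma H2_poly_dense:
  assumes f: "f \<in> H2" and e: "e > 0"
  obtains p where "L2_norm (\<lambda>z. f z - poly p z) < e"
proof -
  have "\<exists>a\<in>range poly. L2_norm (\<lambda>z. f z - a z) < e"
  proof (rule L2_dense)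
    fix w assume w: "w \<in> L2_perp (range poly :: (complex \<Rightarrow> complex) set)"
    have "fourier_coeff w n = 0" if "n \<ge> 0" for n
    proof -
      have "(\<lambda>z :: complex. z powi n) = poly (monom 1 (nat n))"
        using that by (auto simp: fun_eq_iff poly_monom power_int_def)
      hence "L2_inner w (\<lambda>z. z powi n) = 0" using w by (auto simp: L2_perp_def)
      thus ?thesis using w by (simp add: fourier_coeff_eq_inner L2_perp_def)
    qed
    hence "w \<in> conj_H2_0" using w by (simp add: conj_H2_0_eq L2_perp_def)
    thus "L2_inner f w = 0" using conj_H2_0_orth_H2[OF _ f] L2_inner_commute[of f w] by simp
  next
    show "(\<lambda>_. 0) \<in> (range poly :: (complex \<Rightarrow> complex) set)"
      by (rule image_eqI[of _ _ 0]) auto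
  next
    fix f g :: "complex \<Rightarrow> complex" assume "f \<in> range poly" "g \<in> range poly"
    then obtain p q where "f = poly p" "g = poly q" by blast
    thus "(\<lambda>z. f z + g z) \<in> range poly" by (intro image_eqI[of _ _ "p + q"]) auto
  next
    fix c and f :: "complex \<Rightarrow> complex" assume "f \<in> range poly"
    then obtain p where "f = poly p" by blast
    thus "(\<lambda>z. c * f z) \<in> range poly" by (intro image_eqI[of _ _ "smult c p"]) auto
  qed (use e f H2_poly H2_L2 in auto)
  thus ?thesis using that by blast
qed

section \<open>Beurling's theorem\<close>

text \<open>The inner products are Fourier coefficients of the squared modulus. That function is
  real, so coefficients of opposite index vanish together, and only the mean
  \<open>(L2_norm f)\<^sup>2\<close> is left.\<close>

lemma circle_cmod_square_const:
  assumes f: "f \<in> L2" and z: "\<And>k. k > 0 \<Longrightarrow> L2_inner f (\<lambda>z. z powi k * f z) = 0"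
  shows "AE z in circle_measure. (cmod (f z))\<^sup>2 = (L2_norm f)\<^sup>2"
proof -
  note [measurable] = f
  have int: "integrable circle_measure (\<lambda>z. complex_of_real ((cmod (f z))\<^sup>2))"
    using L2_integrable_square[OF f] by (rule integrable_of_real)
  have inner: "L2_inner f (\<lambda>z. z powi k * f z) = (LINT z|circle_measure. of_real ((cmod (f z))\<^sup>2) * z powi (- k))" for k
    unfolding L2_inner_def
  proof (rule integral_cong_AE)
    show "AE z in circle_measure. f z * cnj (z powi k * f z) = of_real ((cmod (f z))\<^sup>2) * z powi (- k)"
      using AE_circle_cmod
      by eventually_elim (simp only: complex_norm_square complex_cnj_mult circle_cnj_powi mult_ac)
  qed measurable
  have pos: "(LINT z|circle_measure. complex_of_real ((cmod (f z))\<^sup>2) * z powi (- k)) = 0" if "k > 0" for k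
    using z[OF that] inner by simp
  have neg: "(LINT z|circle_measure. complex_of_real ((cmod (f z))\<^sup>2) * z powi k) = 0" if "k > 0" for k
  proof -
    have "(LINT z|circle_measure. complex_of_real ((cmod (f z))\<^sup>2) * z powi k) =
        (LINT z|circle_measure. cnj (complex_of_real ((cmod (f z))\<^sup>2) * z powi (- k)))"
    proof (rule integral_cong_AE)
      show "AE z in circle_measure. complex_of_real ((cmod (f z))\<^sup>2) * z powi k =
          cnj (complex_of_real ((cmod (f z))\<^sup>2) * z powi (- k))"
        using AE_circle_cmod by eventually_elim (simp add: circle_cnj_powi)
    qed measurable
    also have "\<dots> = 0"
      using pos[OF that] by (subst Bochner_Integration.integral_cnj) simp
    finally show ?thesis .
  qed
  define F where "F = (\<lambda>z. complex_of_real ((cmod (f z))\<^sup>2) - complex_of_real ((L2_norm f)\<^sup>2))"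
  have "AE z in circle_measure. F z = 0"
  proof (rule Fourier_unique)
    show "integrable circle_measure F" unfolding F_def using int by auto
    fix n
    have "(LINT z|circle_measure. F z * z powi n) =
      (LINT z|circle_measure. complex_of_real ((cmod (f z))\<^sup>2) * z powi n - complex_of_real ((L2_norm f)\<^sup>2) * z powi n)"
      by (simp add: F_def ring_distribs)
    also have "\<dots> = (LINT z|circle_measure. complex_of_real ((cmod (f z))\<^sup>2) * z powi n)
         - complex_of_real ((L2_norm f)\<^sup>2) * (if n = 0 then 1 else 0)"
      using circle_powi_integrable[OF int] L2_integrable[OF L2_powi]
      by (subst Bochner_Integration.integral_diff) (auto simp: integral_circle_powi)
    also have "\<dots> = 0"
    proof (cases "n = 0")
      case True
      thus ?thesis unfolding L2_norm_power2
        by (simp flip: integral_complex_of_real)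
    next
      case False
      thus ?thesis using neg[of n] pos[of "-n"] by (cases "n > 0") auto
    qed
    finally show "(LINT z|circle_measure. F z * z powi n) = 0" .
  qed
  thus ?thesis
    unfolding F_def by eventually_elim (simp flip: of_real_diff of_real_power)
qed

text \<open>The generator is the normalized projection \<open>p\<close> onto \<open>M\<close> of
  \<open>z ^ n\<close>, where \<open>n\<close> is the lowest order occurring in \<open>M\<close>. Up
  to conjugation \<open>p\<close> represents the coefficient of index \<open>n\<close>, which
  vanishes on all \<open>z * h\<close> with \<open>h\<close> in \<open>M\<close>. So
  \<open>p\<close> is orthogonal to its own shifts and has constant modulus.\<close>

lemma Beurling:
  assumes M: "L2_subspace M" "L2_closed M" "M \<subseteq> H2"
    and shift: "\<And>f. f \<in> M \<Longrightarrow> (\<lambda>z. z * f z) \<in> M"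
    and nz: "f0 \<in> M" "\<not> (AE z in circle_measure. f0 z = 0)"
  obtains \<phi> where "\<phi> \<in> M" "AE z in circle_measure. cmod (\<phi> z) = 1"
    "\<And>f. f \<in> M \<longleftrightarrow> f \<in> L2 \<and> (\<exists>h\<in>H2. AE z in circle_measure. f z = \<phi> z * h z)"
proof -
  note MD = L2_subspaceD[OF M(1)]
  note M2 = subsetD[OF MD(1)]
  have "\<exists>n. \<exists>f\<in>M. fourier_coeff f (int n) \<noteq> 0"
  proof (rule ccontr)
    assume *: "\<nexists>n. \<exists>f\<in>M. fourier_coeff f (int n) \<noteq> 0"
    have "fourier_coeff f0 n = 0" for n
    proof (cases "n < 0")
      case True
      thus ?thesis using nz(1) M(3) by (auto simp: H2_def)
    next
      case False
      thus ?thesis using * nz(1) by (metis linorder_not_le nonneg_int_cases not_less)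
    qed
    thus False using L2_zeroI[OF M2[OF nz(1)]] nz(2) by blast
  qed
  then obtain n where n: "\<exists>f\<in>M. fourier_coeff f (int n) \<noteq> 0"
    "\<And>m. m < n \<Longrightarrow> \<not> (\<exists>f\<in>M. fourier_coeff f (int m) \<noteq> 0)"
    using exists_least_iff[of "\<lambda>n. \<exists>f\<in>M. fourier_coeff f (int n) \<noteq> 0"] by blast
  \<comment> \<open>For \<open>n = 0\<close> the index is \<open>-1\<close>, where membership in
    \<open>H2\<close> takes over from the minimality of \<open>n\<close>.\<close>
  have below: "fourier_coeff f (int n - 1) = 0" if "f \<in> M" for f
  proof (cases n)
    case 0
    thus ?thesis using that M(3) by (auto simp: H2_def)
  next
    case (Suc m)
    thus ?thesis using n(2)[of m] that by simp
  qed
  obtain f1 where f1: "f1 \<in> M" "fourier_coeff f1 (int n) \<noteq> 0" using n(1) by blast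
  obtain p where p: "p \<in> M" and orth: "\<And>h. h \<in> M \<Longrightarrow> L2_inner (\<lambda>z. z powi int n - p z) h = 0"
    using L2_projection[OF M(1,2) L2_powi] by blast
  have p_inner: "L2_inner p h = cnj (fourier_coeff h (int n))" if "h \<in> M" for h
  proof -
    have "L2_inner p h = L2_inner (\<lambda>z. z powi int n) h"
      using orth[OF that] L2_inner_diff_left[OF L2_powi M2[OF p] M2[OF that], of "int n"] by simp
    thus ?thesis using fourier_coeff_eq_inner[of h "int n"] M2[OF that] L2_inner_commute by metis
  qed
  have p_shift: "L2_inner p (\<lambda>z. z * h z) = 0" if "h \<in> M" for h
    using p_inner[OF shift[OF that]] below[OF that] M2[OF that] by (simp add: fourier_coeff_z_mult)
  have shift': "(\<lambda>z. z powi int k * h z) \<in> M" if "h \<in> M" for h k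
  proof (induction k)
    case (Suc k)
    from shift[OF this] show ?case by (simp add: mult.assoc del: of_nat_Suc)
  qed (use that in simp)
  have p_shift': "L2_inner p (\<lambda>z. z powi k * h z) = 0" if h: "h \<in> M" and k: "k > 0" for h k
  proof -
    obtain j where "k = int (Suc j)" using k by (metis gr0_conv_Suc zero_less_imp_eq_int)
    thus ?thesis using p_shift[OF shift'[OF h, of j]] by (simp add: mult.assoc del: of_nat_Suc)
  qed
  define c where "c = L2_norm p"
  have "c \<noteq> 0"
  proof
    assume "c = 0"
    hence "L2_inner p f1 = 0"
      using L2_Cauchy_Schwarz[OF M2[OF p] M2[OF f1(1)]] by (simp add: c_def)
    thus False using p_inner[OF f1(1)] f1(2) by simp
  qed
  hence c: "c > 0" unfolding c_def using L2_norm_nonneg[of p] by linarith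
  define \<phi> where "\<phi> = (\<lambda>z. complex_of_real (1 / c) * p z)"
  have \<phi>M: "\<phi> \<in> M" unfolding \<phi>_def by (rule MD(5)[OF p])
  have "AE z in circle_measure. (cmod (p z))\<^sup>2 = (L2_norm p)\<^sup>2"
    by (rule circle_cmod_square_const[OF M2[OF p]]) (rule p_shift'[OF p])
  hence mod: "AE z in circle_measure. cmod (\<phi> z) = 1"
  proof eventually_elim
    case (elim z)
    hence "cmod (p z) = c" using c unfolding c_def by (simp add: power2_eq_iff_nonneg)
    thus ?case using c by (simp add: \<phi>_def norm_mult norm_divide)
  qed
  have \<phi>_shift: "L2_inner \<phi> (\<lambda>z. z powi k * h z) = 0" if "h \<in> M" "k > 0" for h k
    unfolding \<phi>_def L2_inner_cmult_left p_shift'[OF that] by simp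
  note [measurable] = M2[OF \<phi>M]
  have mult: "(\<lambda>z. cnj (\<phi> z) * f z) \<in> L2" if "f \<in> L2" for f
    using mod by (intro L2_bounded_mult[OF that, of _ 1]) auto
  have "f \<in> M \<longleftrightarrow> f \<in> L2 \<and> (\<exists>h\<in>H2. AE z in circle_measure. f z = \<phi> z * h z)" for f
  proof safe
    assume f: "f \<in> M"
    note [measurable] = M2[OF f]
    show "f \<in> L2" using f M2 by blast
    \<comment> \<open>As \<open>\<phi>\<close> has modulus 1, its conjugate inverts it. The
      coefficients of \<open>h\<close> of negative index are, up to conjugation, inner products of
      \<open>\<phi>\<close> with positive shifts of \<open>f\<close>.\<close>
    define h where "h = (\<lambda>z. cnj (\<phi> z) * f z)"
    have "fourier_coeff h k = 0" if "k < 0" for k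
    proof -
      have "fourier_coeff h k = L2_inner (\<lambda>z. z powi (- k) * f z) \<phi>"
        unfolding fourier_coeff_def L2_inner_def h_def by (simp add: mult_ac)
      also have "\<dots> = 0"
        using \<phi>_shift[OF f, of "-k"] that L2_inner_commute[of "\<lambda>z. z powi (- k) * f z" \<phi>] by simp
      finally show ?thesis .
    qed
    hence "h \<in> H2" using mult[OF M2[OF f]] by (simp add: H2_def h_def)
    moreover have "AE z in circle_measure. f z = \<phi> z * h z"
      using mod by eventually_elim (simp add: h_def circle_cnj_eq flip: mult.assoc)
    ultimately show "\<exists>h\<in>H2. AE z in circle_measure. f z = \<phi> z * h z" by blast
  next
    fix h assume f: "f \<in> L2" and h: "h \<in> H2" and fh: "AE z in circle_measure. f z = \<phi> z * h z"
    note [measurable] = f H2_L2[OF h]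
    \<comment> \<open>The residual \<open>w\<close> is orthogonal to
      \<open>z powi k * \<phi>\<close> for all \<open>k \<ge> 0\<close>, so
      \<open>cnj \<phi> * w\<close> lies in \<open>conj_H2_0\<close> and is orthogonal to
      \<open>h\<close>. This means that \<open>w\<close> is orthogonal to \<open>f\<close>; being
      orthogonal to \<open>g\<close> too, it vanishes.\<close>
    obtain g where g: "g \<in> M" and orth: "\<And>h. h \<in> M \<Longrightarrow> L2_inner (\<lambda>z. f z - g z) h = 0"
      using L2_projection[OF M(1,2) f] by blast
    define w where "w = (\<lambda>z. f z - g z)"
    have w [measurable]: "w \<in> L2" unfolding w_def using f g M2 by blast
    have "fourier_coeff (\<lambda>z. cnj (\<phi> z) * w z) k = 0" if "k \<ge> 0" for k
    proof -
      have "fourier_coeff (\<lambda>z. cnj (\<phi> z) * w z) k = L2_inner w (\<lambda>z. z powi k * \<phi> z)"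
        unfolding fourier_coeff_def L2_inner_def
      proof (rule integral_cong_AE)
        show "AE z in circle_measure. cnj (\<phi> z) * w z * z powi - k = w z * cnj (z powi k * \<phi> z)"
          using AE_circle_cmod by eventually_elim (simp add: circle_cnj_powi)
      qed measurable
      also have "\<dots> = 0" using orth[OF shift'[OF \<phi>M, of "nat k"]] that by (simp add: w_def)
      finally show ?thesis .
    qed
    hence "(\<lambda>z. cnj (\<phi> z) * w z) \<in> conj_H2_0" using mult[OF w] by (simp add: conj_H2_0_eq)
    hence "L2_inner (\<lambda>z. cnj (\<phi> z) * w z) h = 0" using h by (rule conj_H2_0_orth_H2)
    also have "L2_inner (\<lambda>z. cnj (\<phi> z) * w z) h = L2_inner w f"
      unfolding L2_inner_def
      by (rule integral_cong_AE) (measurable, use fh in eventually_elim, simp add: mult_ac)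
    finally have "L2_inner w f = 0" .
    moreover have "L2_inner w g = 0" using orth[OF g] by (simp add: w_def)
    ultimately have "L2_inner w w = 0"
      using L2_inner_diff_right[OF f M2[OF g] w] by (simp add: w_def)
    hence "AE z in circle_measure. w z = 0"
      using L2_norm_eq_0_iff[OF w] by (simp add: L2_inner_self)
    hence "AE z in circle_measure. f z = g z" by eventually_elim (simp add: w_def)
    thus "f \<in> M" using MD(6)[OF g f] by blast
  qed
  thus ?thesis using that \<phi>M mod by blast
qed

section \<open>Boundary values of inner functions\<close>

text \<open>The exponents form an arbitrary family of integers, so that both Taylor series and the
  two halves of the Poisson kernel are covered.\<close>

lemma integral_power_series:
  assumes g: "integrable circle_measure g" and c: "summable (\<lambda>m. cmod (c m))"
  shows "(\<lambda>m. c m * (LINT z|circle_measure. g z * z powi e m)) sums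
    (LINT z|circle_measure. g z * (\<Sum>m. c m * z powi e m))"
proof -
  have [measurable]: "g \<in> borel_measurable circle_measure" using g by auto
  have int: "integrable circle_measure (\<lambda>z. c m * (g z * z powi e m))" for m
    using circle_powi_integrable[OF g] by auto
  have nrm: "(LINT z|circle_measure. norm (c m * (g z * z powi e m))) = cmod (c m) * (LINT z|circle_measure. norm (g z))" for m
  proof -
    have "(LINT z|circle_measure. norm (c m * (g z * z powi e m))) = (LINT z|circle_measure. cmod (c m) * norm (g z))"
    proof (rule integral_cong_AE)
      show "AE z in circle_measure. norm (c m * (g z * z powi e m)) = cmod (c m) * norm (g z)"
        using AE_circle_cmod by eventually_elim (simp add: norm_mult norm_power_int)
    qed measurable
    thus ?thesis by simp
  qed
  have "(\<lambda>m. LINT z|circle_measure. c m * (g z * z powi e m)) sums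
      (LINT z|circle_measure. (\<Sum>m. c m * (g z * z powi e m)))"
  proof (rule sums_integral[OF int])
    show "AE z in circle_measure. summable (\<lambda>m. norm (c m * (g z * z powi e m)))"
      using AE_circle_cmod
      by eventually_elim (use summable_mult2[OF c] in \<open>simp add: norm_mult norm_power_int\<close>)
    show "summable (\<lambda>m. LINT z|circle_measure. norm (c m * (g z * z powi e m)))"
      unfolding nrm by (rule summable_mult2[OF c])
  qed
  moreover have "(LINT z|circle_measure. (\<Sum>m. c m * (g z * z powi e m))) =
     (LINT z|circle_measure. g z * (\<Sum>m. c m * z powi e m))"
  proof (rule integral_cong_AE)
    show "AE z in circle_measure. (\<Sum>m. c m * (g z * z powi e m)) = g z * (\<Sum>m. c m * z powi e m)"
      using AE_circle_cmod
    proof eventually_elim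
      case (elim z)
      have "summable (\<lambda>m. c m * z powi e m)"
        by (rule summable_norm_cancel) (use c elim in \<open>simp add: norm_mult norm_power_int\<close>)
      from suminf_mult[OF this, of "g z"] show ?case by (simp add: mult_ac)
    qed
  qed measurable
  ultimately show ?thesis by simp
qed

text \<open>Away from the closed disk a function that is holomorphic in the disk may fail to be measurable,
  hence the indicator.\<close>

lemma measurable_dilation:
  assumes u: "u holomorphic_on ball 0 1" and r: "0 \<le> r" "r < 1"
  shows "(\<lambda>z. indicat_real (sphere 0 1) z *\<^sub>R u (complex_of_real r * z)) \<in> borel_measurable borel"
proof (rule borel_measurable_continuous_on_indicator)
  have "(\<lambda>z. complex_of_real r * z) ` sphere 0 1 \<subseteq> ball 0 1"
    using r by (auto simp: norm_mult)
  thus "continuous_on (sphere 0 1) (\<lambda>z. u (complex_of_real r * z))"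
    by (intro continuous_on_compose2[OF holomorphic_on_imp_continuous_on[OF u]] continuous_intros)
qed simp

text \<open>The integral is the coefficient of index \<open>- k\<close> of a dilate of
  \<open>u\<close>: the mean value property for \<open>k = 0\<close>, and the absence of negative
  frequencies for \<open>k > 0\<close>.\<close>

lemma holomorphic_circle_integral:
  assumes u: "u holomorphic_on ball 0 1" and r: "0 < r" "r < 1" and k: "k \<ge> 0"
  shows "(LINT z|circle_measure. (indicat_real (sphere 0 1) z *\<^sub>R u (complex_of_real r * z)) * z powi k) =
    (if k = 0 then u 0 else 0)"
proof -
  define a where "a = (\<lambda>n. (deriv ^^ n) u 0 / fact n)"
  have sums: "(\<lambda>n. a n * w ^ n) sums u w" if "cmod w < 1" for w
    using holomorphic_power_series[OF u, of w] that by (simp add: a_def)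
  \<comment> \<open>Convergence of the Taylor series at the larger radius \<open>s\<close> yields
    absolute convergence at \<open>r\<close>.\<close>
  obtain s where s: "r < s" "s < 1" using dense[OF r(2)] by blast
  have "summable (\<lambda>n. a n * of_real s ^ n)" using sums[of "of_real s"] s r by (auto simp: sums_iff)
  hence "summable (\<lambda>n. norm (a n * of_real r ^ n))" by (rule powser_insidea) (use s r in auto)
  from integral_power_series[OF L2_integrable[OF L2_powi[of k]] this, of int]
  have "(\<lambda>m. a m * of_real r ^ m * (LINT z|circle_measure. z powi k * z powi int m)) sums
    (LINT z|circle_measure. z powi k * (\<Sum>m. a m * of_real r ^ m * z powi int m))" .
  also have "(LINT z|circle_measure. z powi k * (\<Sum>m. a m * of_real r ^ m * z powi int m)) =
     (LINT z|circle_measure. (indicat_real (sphere 0 1) z *\<^sub>R u (complex_of_real r * z)) * z powi k)"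
  proof (rule integral_cong_AE)
    show "AE z in circle_measure. z powi k * (\<Sum>m. a m * of_real r ^ m * z powi int m) =
      (indicat_real (sphere 0 1) z *\<^sub>R u (complex_of_real r * z)) * z powi k"
      using AE_circle_cmod
    proof eventually_elim
      case (elim z)
      show ?case using sums[of "of_real r * z"] elim r
        by (simp add: norm_mult sums_iff power_mult_distrib mult_ac)
    qed
    have [measurable]: "(\<lambda>z. indicat_real (sphere 0 1) z *\<^sub>R u (complex_of_real r * z)) \<in> borel_measurable borel"
      using u r by (intro measurable_dilation) auto
    show "(\<lambda>z. (indicat_real (sphere 0 1) z *\<^sub>R u (complex_of_real r * z)) * z powi k) \<in> borel_measurable circle_measure"
      by measurable
  qed measurable
  finally have "(\<lambda>m. a m * of_real r ^ m * (LINT z|circle_measure. z powi k * z powi int m)) sums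
     (LINT z|circle_measure. (indicat_real (sphere 0 1) z *\<^sub>R u (complex_of_real r * z)) * z powi k)" .
  moreover have "a m * of_real r ^ m * (LINT z|circle_measure. z powi k * z powi int m) =
      (if m = 0 then (if k = 0 then u 0 else 0) else 0)" for m
  proof -
    have "(LINT z|circle_measure. z powi k * z powi int m) = (LINT z|circle_measure. z powi (k + int m))"
    proof (rule integral_cong_AE)
      show "AE z in circle_measure. z powi k * z powi int m = z powi (k + int m)"
        using AE_circle_cmod by eventually_elim (simp only: power_int_add circle_cnj_eq(4) simp_thms)
    qed measurable
    thus ?thesis using k by (simp add: integral_circle_powi a_def)
  qed
  ultimately have "(\<lambda>m. if m = 0 then (if k = 0 then u 0 else 0) else 0) sums
     (LINT z|circle_measure. (indicat_real (sphere 0 1) z *\<^sub>R u (complex_of_real r * z)) * z powi k)"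
    by simp
  thus ?thesis using sums_single[of 0 "\<lambda>_. if k = 0 then u 0 else 0"] by (rule sums_unique2)
qed

lemma inner_function_boundary:
  assumes "inner_function u"
  shows "AE z in circle_measure. cmod (boundary u z) = 1 \<and>
    ((\<lambda>r::real. u (of_real r * z)) \<longlongrightarrow> boundary u z) (at_left 1)"
proof -
  have "AE z in circle_measure. \<exists>l. cmod l = 1 \<and> ((\<lambda>r::real. u (of_real r * z)) \<longlongrightarrow> l) (at_left 1)"
    using assms by (simp add: inner_function_def)
  thus ?thesis
  proof eventually_elim
    case (elim z)
    then obtain l where l: "cmod l = 1" "((\<lambda>r::real. u (of_real r * z)) \<longlongrightarrow> l) (at_left 1)" by blast
    hence "boundary u z = l" unfolding boundary_def by (intro tendsto_Lim) auto
    thus ?case using l by simp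
  qed
qed

text \<open>Measurability of \<open>boundary u\<close>, a limit over all radii, is not clear. It is
  replaced by the limit \<open>b\<close> along one sequence of radii, which is Borel measurable, and
  dominated convergence carries the coefficients of the dilates over to \<open>b\<close>.\<close>

lemma inner_function_boundary_H2:
  assumes u: "inner_function u"
  obtains b where "b \<in> H2" "AE z in circle_measure. boundary u z = b z"
    "AE z in circle_measure. cmod (b z) = 1" "fourier_coeff b 0 = u 0"
proof -
  have hol: "u holomorphic_on ball 0 1" and bdd: "bounded (u ` ball 0 1)"
    using u by (auto simp: inner_function_def)
  obtain B where "\<forall>z\<in>ball 0 1. cmod (u z) \<le> B"
    using bdd unfolding bounded_iff by auto
  hence B: "cmod (u z) \<le> B" if "cmod z < 1" for z using that by simp
  \<comment> \<open>The offset 2 keeps every radius strictly positive.\<close>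
  define r :: "nat \<Rightarrow> real" where "r = (\<lambda>n. 1 - inverse (real (n + 2)))"
  have r: "0 < r n" "r n < 1" for n by (auto simp: r_def field_simps)
  have "(\<lambda>n. inverse (real (n + 2))) \<longlonglongrightarrow> 0"
    using LIMSEQ_ignore_initial_segment[OF LIMSEQ_inverse_real_of_nat, of 1] by simp
  hence "r \<longlonglongrightarrow> 1" unfolding r_def using tendsto_diff[OF tendsto_const] by fastforce
  hence rl: "filterlim r (at_left 1) sequentially"
    using r(2) by (auto simp: filterlim_at less_imp_neq intro!: always_eventually)
  define U where "U = (\<lambda>n z. indicat_real (sphere 0 1) z *\<^sub>R u (complex_of_real (r n) * z))"
  have [measurable]: "U n \<in> borel_measurable borel" for n
    unfolding U_def using r[of n] hol by (intro measurable_dilation) auto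
  define b where "b = (\<lambda>z. lim (\<lambda>n. U n z))"
  have [measurable]: "b \<in> borel_measurable borel" unfolding b_def by measurable
  have lim: "AE z in circle_measure. cmod (boundary u z) = 1 \<and> boundary u z = b z \<and> (\<lambda>n. U n z) \<longlonglongrightarrow> b z"
    using inner_function_boundary[OF u] AE_circle_cmod
  proof eventually_elim
    case (elim z)
    hence "(\<lambda>n. u (of_real (r n) * z)) \<longlonglongrightarrow> boundary u z"
      using filterlim_compose[OF _ rl] by blast
    hence "(\<lambda>n. U n z) \<longlonglongrightarrow> boundary u z" using elim by (simp add: U_def)
    thus ?case using elim limI[of "\<lambda>n. U n z"] unfolding b_def by simp
  qed
  hence mod: "AE z in circle_measure. cmod (b z) = 1" by eventually_elim auto
  have L: "b \<in> L2" by (rule L2_bounded[of _ 1]) (use mod in auto)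
  have coeff: "fourier_coeff b (- k) = (if k = 0 then u 0 else 0)" if k: "k \<ge> 0" for k
  proof -
    have "(\<lambda>n. LINT z|circle_measure. U n z * z powi k) \<longlonglongrightarrow> (LINT z|circle_measure. b z * z powi k)"
    proof (rule integral_dominated_convergence)
      show "AE z in circle_measure. (\<lambda>n. U n z * z powi k) \<longlonglongrightarrow> b z * z powi k"
        using lim by eventually_elim (auto intro: tendsto_intros)
      show "AE z in circle_measure. norm (U n z * z powi k) \<le> B" for n
        using AE_circle_cmod
        by eventually_elim (use r[of n] in \<open>auto simp: U_def norm_mult norm_power_int intro!: B\<close>)
    qed auto
    moreover have "(LINT z|circle_measure. U n z * z powi k) = (if k = 0 then u 0 else 0)" for n
      unfolding U_def by (rule holomorphic_circle_integral[OF hol r k])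
    ultimately show ?thesis unfolding fourier_coeff_def by (simp add: LIMSEQ_const_iff)
  qed
  have "fourier_coeff b n = 0" if "n < 0" for n
    using coeff[of "-n"] that by simp
  hence "b \<in> H2" using L by (simp add: H2_def)
  thus ?thesis using that[of b] lim mod coeff[of 0] by simp
qed

lemma boundary_mult:
  assumes "inner_function g" "inner_function u"
  shows "AE z in circle_measure. boundary (\<lambda>z. g z * u z) z = boundary g z * boundary u z"
  using inner_function_boundary[OF assms(1)] inner_function_boundary[OF assms(2)]
proof eventually_elim
  case (elim z)
  thus ?case unfolding boundary_def[of "\<lambda>z. g z * u z"] by (intro tendsto_Lim tendsto_mult) auto
qed

section \<open>Radial limits\<close>

text \<open>The derivative \<open>cos t - 1 / 2\<close> of the difference is nonnegative because
  \<open>1 < pi / 3\<close>.\<close>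

lemma half_le_sin:
  assumes "0 \<le> x" "x \<le> 1" shows "x / 2 \<le> sin (x::real)"
proof -
  have "sin 0 - 0 / 2 \<le> sin x - x / 2"
  proof (rule DERIV_nonneg_imp_nondecreasing[OF assms(1)])
    fix t assume t: "0 \<le> t" "t \<le> x"
    have "cos (pi / 3) \<le> cos t"
      using t assms pi_gt3 by (intro cos_monotone_0_pi_le) auto
    hence "cos t - 1 / 2 \<ge> 0" by (simp add: cos_60)
    moreover have "((\<lambda>x. sin x - x / 2) has_real_derivative cos t - 1 / 2) (at t)"
      by (auto intro!: derivative_eq_intros)
    ultimately show "\<exists>y. ((\<lambda>x. sin x - x / 2) has_real_derivative y) (at t) \<and> 0 \<le> y" by blast
  qed
  thus ?thesis by simp
qed

text \<open>Short chords control arcs: this confines the parameters, within a unit interval, of the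
  points of a small ball.\<close>

lemma dist_cis_ge:
  assumes "\<bar>s - t\<bar> \<le> 1" shows "\<bar>s - t\<bar> / 2 \<le> dist (cis s) (cis t)"
proof -
  have *: "\<bar>s - t\<bar> / 2 \<le> dist (cis s) (cis t)" if "t \<le> s" "s \<le> t + 1" for s t
  proof -
    have "\<bar>s - t\<bar> / 2 \<le> sin (s - t)" using half_le_sin[of "s - t"] that by simp
    also have "\<dots> = Im (cis (s - t) - 1)" by simp
    also have "\<dots> \<le> cmod (cis (s - t) - 1)" using abs_Im_le_cmod abs_le_D1 by blast
    also have "\<dots> = cmod (cis t * (cis (s - t) - 1))" by (simp add: norm_mult)
    also have "\<dots> = dist (cis s) (cis t)" by (simp add: right_diff_distrib cis_mult dist_norm)
    finally show ?thesis .
  qed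
  show ?thesis
    using *[of t s] *[of s t] assms by (cases "t \<le> s") (auto simp: dist_commute)
qed

text \<open>The parameter interval is covered by 7 unit intervals, as \<open>2 * pi < 7\<close>.
  Within each, two parameters of points in the ball differ by at most \<open>4 * \<rho>\<close>, so
  they fill at most an interval of length \<open>8 * \<rho>\<close>; hence 56. The factor
  \<open>1 / (2 * pi)\<close> is estimated by 1.\<close>

lemma emeasure_circle_cball_le:
  assumes "\<rho> > 0" shows "emeasure circle_measure (cball a \<rho>) \<le> ennreal (56 * \<rho>)"
proof -
  define E where "E = (\<lambda>j::nat. {t \<in> {real j..real j + 1}. dist a (cis t) \<le> \<rho>})"
  have [measurable]: "E j \<in> sets borel" for j unfolding E_def by measurable
  have E: "emeasure lborel (E j) \<le> ennreal (8 * \<rho>)" for j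
  proof (cases "E j = {}")
    case False
    then obtain t where t: "t \<in> E j" by blast
    have "E j \<subseteq> {t - 4 * \<rho>..t + 4 * \<rho>}"
    proof
      fix s assume s: "s \<in> E j"
      have "\<bar>s - t\<bar> / 2 \<le> dist (cis s) (cis t)"
        using s t by (intro dist_cis_ge) (auto simp: E_def)
      also have "\<dots> \<le> \<rho> + \<rho>"
        using s t dist_triangle2[of "cis s" "cis t" a] by (auto simp: E_def dist_commute)
      finally show "s \<in> {t - 4 * \<rho>..t + 4 * \<rho>}" by (auto simp: abs_le_iff)
    qed
    hence "emeasure lborel (E j) \<le> emeasure lborel {t - 4 * \<rho>..t + 4 * \<rho>}"
      by (intro emeasure_mono) auto
    thus ?thesis using assms by simp
  qed simp
  have "emeasure circle_measure (cball a \<rho>) = emeasure lborel ({0..2*pi} \<inter> cis -` cball a \<rho>) / ennreal (2 * pi)"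
  proof -
    have "cis -` cball a \<rho> \<in> sets borel"
      using measurable_sets_borel[OF borel_measurable_cis, of "cball a \<rho>"] by simp
    hence "emeasure (uniform_measure lborel {0..2*pi}) (cis -` cball a \<rho>) =
        emeasure lborel ({0..2*pi} \<inter> cis -` cball a \<rho>) / emeasure lborel {0..2*pi}"
      by (intro emeasure_uniform_measure) auto
    thus ?thesis unfolding circle_measure_def by (subst emeasure_distr) auto
  qed
  also have "\<dots> \<le> emeasure lborel ({0..2*pi} \<inter> cis -` cball a \<rho>)"
  proof -
    have "inverse (ennreal (2 * pi)) \<le> 1"
      using pi_gt3 by (subst inverse_ennreal) (auto simp: field_simps)
    thus ?thesis unfolding divide_ennreal_def by (metis mult.right_neutral mult_left_mono zero_le)
  qed
  also have "\<dots> \<le> emeasure lborel (\<Union>j\<in>{..<7}. E j)"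
  proof (rule emeasure_mono)
    show "{0..2*pi} \<inter> cis -` cball a \<rho> \<subseteq> (\<Union>j\<in>{..<7}. E j)"
    proof
      fix t assume t: "t \<in> {0..2*pi} \<inter> cis -` cball a \<rho>"
      have "real (nat \<lfloor>t\<rfloor>) \<le> t" "t \<le> real (nat \<lfloor>t\<rfloor>) + 1" using t by (auto simp: of_nat_nat)
      moreover from this have "nat \<lfloor>t\<rfloor> < 7" using t pi_less_4 pi_approx(2) by auto
      ultimately show "t \<in> (\<Union>j\<in>{..<7}. E j)"
        using t by (auto simp: E_def intro!: bexI[of _ "nat \<lfloor>t\<rfloor>"])
    qed
  qed measurable
  also have "\<dots> \<le> (\<Sum>j\<in>{..<7}. emeasure lborel (E j))"
    by (rule emeasure_subadditive_finite) auto
  also have "\<dots> \<le> (\<Sum>j\<in>{..<7::nat}. ennreal (8 * \<rho>))" by (intro sum_mono E)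
  also have "\<dots> = ennreal (\<Sum>j\<in>{..<7::nat}. 8 * \<rho>)" using assms by (intro sum_ennreal) auto
  also have "\<dots> = ennreal (56 * \<rho>)" by simp
  finally show ?thesis .
qed

text \<open>The weak type inequality for the Hardy-Littlewood maximal function, with the radius in
  place of the measure of the ball. Vitali's lemma selects disjoint balls whose 5-fold enlargements
  cover all centres; an enlargement has measure at most \<open>56 * 5 * \<rho>\<close>, and
  \<open>\<rho>\<close> is less than \<open>1 / s\<close> times the integral of \<open>g\<close>
  over the ball. A measurable superset \<open>E\<close> stands in for the set of centres
  itself.\<close>

lemma maximal_weak_type:
  fixes g :: "complex \<Rightarrow> real"
  assumes g: "integrable circle_measure g" "\<And>z. g z \<ge> 0" and s: "s > 0"
  obtains E where "E \<in> sets borel"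
    "\<And>\<zeta> \<rho>. \<rho> > 0 \<Longrightarrow> s * \<rho> < (LINT w|circle_measure. indicat_real (cball \<zeta> \<rho>) w * g w) \<Longrightarrow> \<zeta> \<in> E"
    "emeasure circle_measure E \<le> ennreal (280 / s * (LINT w|circle_measure. g w))"
proof -
  define G where "G = (LINT w|circle_measure. g w)"
  define K where "K = {(\<zeta>, \<rho>). \<rho> > 0 \<and> s * \<rho> < (LINT w|circle_measure. indicat_real (cball \<zeta> \<rho>) w * g w)}"
  have [measurable]: "g \<in> borel_measurable circle_measure" using g by auto
  have gi: "integrable circle_measure (\<lambda>w. indicat_real (cball \<zeta> \<rho>) w * g w)" for \<zeta> \<rho>
    using integrable_mult_indicator[OF _ g(1), of "cball \<zeta> \<rho>"] by simp
  \<comment> \<open>Vitali's lemma asks for bounded radii; the total integral bounds them.\<close>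
  have rad: "0 < snd i \<and> snd i \<le> G / s" if "i \<in> K" for i
  proof -
    have "(LINT w|circle_measure. indicat_real (cball (fst i) (snd i)) w * g w) \<le> G"
      unfolding G_def using g gi by (intro integral_mono) (auto simp: indicator_def)
    thus ?thesis using that s by (auto simp: K_def field_simps)
  qed
  have "fst ` K \<subseteq> (\<Union>i\<in>K. cball (fst i) (snd i))"
    using rad by (fastforce simp: less_imp_le)
  then obtain C where C: "countable C" "C \<subseteq> K"
    "pairwise (\<lambda>i j. disjnt (cball (fst i) (snd i)) (cball (fst j) (snd j))) C"
    "fst ` K \<subseteq> (\<Union>i\<in>C. cball (fst i) (5 * snd i))"
    by (rule Vitali_covering_lemma_cballs[OF _ rad])
  \<comment> \<open>The countable, possibly finite family becomes two sequences padded with empty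
    sets.\<close>
  define X Y where "X = (\<lambda>n. if n \<in> to_nat_on C ` C then cball (fst (from_nat_into C n)) (snd (from_nat_into C n)) else {})"
    and "Y = (\<lambda>n. if n \<in> to_nat_on C ` C then cball (fst (from_nat_into C n)) (5 * snd (from_nat_into C n)) else {})"
  have [measurable]: "X n \<in> sets borel" "Y n \<in> sets borel" for n by (auto simp: X_def Y_def)
  have disj: "disjoint_family X"
    unfolding disjoint_family_on_def
  proof (intro ballI impI)
    fix m n :: nat assume mn: "m \<noteq> n"
    show "X m \<inter> X n = {}"
    proof (cases "m \<in> to_nat_on C ` C \<and> n \<in> to_nat_on C ` C")
      case True
      then obtain c d where cd: "c \<in> C" "d \<in> C" "m = to_nat_on C c" "n = to_nat_on C d" by blast
      hence "c \<noteq> d" using mn by blast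
      thus ?thesis using C(1,3) cd by (auto simp: X_def pairwise_def disjnt_def)
    qed (auto simp: X_def)
  qed
  \<comment> \<open>As a measure, \<open>N\<close> adds up the integrals of \<open>g\<close> over
    the disjoint balls.\<close>
  define N where "N = density circle_measure (\<lambda>w. ennreal (g w))"
  have Y_le: "emeasure circle_measure (Y n) \<le> ennreal (280 / s) * emeasure N (X n)" for n
  proof (cases "n \<in> to_nat_on C ` C")
    case True
    define i where "i = from_nat_into C n"
    have "i \<in> K" unfolding i_def using True C(1,2) by auto
    hence i: "snd i > 0" "s * snd i < (LINT w|circle_measure. indicat_real (cball (fst i) (snd i)) w * g w)"
      by (auto simp: K_def)
    have XY: "X n = cball (fst i) (snd i)" "Y n = cball (fst i) (5 * snd i)"
      using True by (auto simp: X_def Y_def i_def)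
    have "emeasure N (X n) = (\<integral>\<^sup>+w. ennreal (g w) * indicator (X n) w \<partial>circle_measure)"
      unfolding N_def by (rule emeasure_density) auto
    also have "\<dots> = (\<integral>\<^sup>+w. ennreal (indicat_real (cball (fst i) (snd i)) w * g w) \<partial>circle_measure)"
      unfolding XY by (intro nn_integral_cong) (auto simp: indicator_def)
    also have "\<dots> = ennreal (LINT w|circle_measure. indicat_real (cball (fst i) (snd i)) w * g w)"
      using g gi by (intro nn_integral_eq_integral) auto
    finally have N: "emeasure N (X n) = ennreal (LINT w|circle_measure. indicat_real (cball (fst i) (snd i)) w * g w)" .
    have "emeasure circle_measure (Y n) \<le> ennreal (56 * (5 * snd i))"
      unfolding XY using i by (intro emeasure_circle_cball_le) auto
    also have "\<dots> \<le> ennreal (280 / s * (LINT w|circle_measure. indicat_real (cball (fst i) (snd i)) w * g w))"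
      using i s by (intro ennreal_leI) (auto simp: field_simps)
    also have "\<dots> = ennreal (280 / s) * emeasure N (X n)"
      unfolding N using s by (intro ennreal_mult') auto
    finally show ?thesis .
  qed (auto simp: Y_def)
  show ?thesis
  proof (rule that[of "\<Union>n. Y n"])
    show "(\<Union>n. Y n) \<in> sets borel" by measurable
    fix \<zeta> \<rho> assume "\<rho> > 0" "s * \<rho> < (LINT w|circle_measure. indicat_real (cball \<zeta> \<rho>) w * g w)"
    hence "(\<zeta>, \<rho>) \<in> K" by (simp add: K_def)
    hence "\<zeta> \<in> (\<Union>i\<in>C. cball (fst i) (5 * snd i))" using C(4) by force
    then obtain i where "i \<in> C" "\<zeta> \<in> cball (fst i) (5 * snd i)" by blast
    hence "\<zeta> \<in> Y (to_nat_on C i)" using C(1) by (simp add: Y_def)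
    thus "\<zeta> \<in> (\<Union>n. Y n)" by blast
  next
    have "emeasure circle_measure (\<Union>n. Y n) \<le> (\<Sum>n. emeasure circle_measure (Y n))"
      by (rule emeasure_subadditive_countably) auto
    also have "\<dots> \<le> (\<Sum>n. ennreal (280 / s) * emeasure N (X n))"
      by (intro suminf_le Y_le) auto
    also have "\<dots> = ennreal (280 / s) * emeasure N (\<Union>n. X n)"
      using disj by (subst ennreal_suminf_cmult, subst suminf_emeasure) (auto simp: N_def)
    also have "emeasure N (\<Union>n. X n) \<le> emeasure N UNIV"
      by (intro emeasure_mono) (auto simp: N_def)
    also have "emeasure N UNIV = ennreal G"
      unfolding N_def G_def using g by (subst emeasure_density) (auto simp: nn_integral_eq_integral)
    also have "ennreal (280 / s) * ennreal G = ennreal (280 / s * G)"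
      using s g by (intro ennreal_mult[symmetric]) (auto simp: G_def)
    finally show "emeasure circle_measure (\<Union>n. Y n) \<le> ennreal (280 / s * (LINT w|circle_measure. g w))"
      by (simp add: G_def mult_left_mono)
  qed
qed

section \<open>Extension to the disk and the Poisson kernel\<close>

text \<open>Coefficients of negative index are dropped, so this is the Poisson extension of
  \<open>f\<close> exactly when \<open>f\<close> lies in \<open>H2\<close>; there \<open>f\<close>
  is its boundary function.\<close>

definition disk_ext :: "(complex \<Rightarrow> complex) \<Rightarrow> complex \<Rightarrow> complex" where
  "disk_ext f z = (\<Sum>n. fourier_coeff f (int n) * z ^ n)"

definition poisson :: "complex \<Rightarrow> complex \<Rightarrow> real" where
  "poisson z w = (1 - (cmod z)\<^sup>2) / (cmod (w - z))\<^sup>2"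

lemma disk_ext_sums:
  assumes f: "f \<in> L2" and z: "cmod z < 1"
  shows "(\<lambda>n. fourier_coeff f (int n) * z ^ n) sums disk_ext f z"
proof -
  have b: "cmod (fourier_coeff f n) \<le> L2_norm f * L2_norm (\<lambda>z. z powi n)" for n
    using L2_Cauchy_Schwarz[OF f L2_powi[of n]] fourier_coeff_eq_inner[OF f, of n] by simp
  have "L2_norm (\<lambda>z. z powi n) = L2_norm (\<lambda>z. 1)" for n
    using AE_circle_cmod by (intro L2_norm_cong_AE) (auto simp: norm_power_int)
  hence b: "cmod (fourier_coeff f n) \<le> L2_norm f" for n using b by (simp add: L2_norm_def)
  have "summable (\<lambda>n. fourier_coeff f (int n) * z ^ n)"
  proof (rule summable_comparison_test)
    show "summable (\<lambda>n. L2_norm f * cmod z ^ n)" using z by (intro summable_mult summable_geometric) auto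
    show "\<exists>N. \<forall>n\<ge>N. norm (fourier_coeff f (int n) * z ^ n) \<le> L2_norm f * cmod z ^ n"
      using b by (auto simp: norm_mult norm_power intro!: mult_right_mono)
  qed
  thus ?thesis unfolding disk_ext_def by (rule summable_sums)
qed

lemma holomorphic_disk_ext: "f \<in> L2 \<Longrightarrow> disk_ext f holomorphic_on ball 0 1"
  using disk_ext_sums[of f]
  by (intro power_series_holomorphic[of 0 1 "\<lambda>n. fourier_coeff f (int n)"]) auto

lemma poisson_nonneg: "cmod z < 1 \<Longrightarrow> poisson z w \<ge> 0"
  unfolding poisson_def by (simp add: power_le_one)

lemma poisson_bounded:
  assumes "cmod z < 1" "cmod w = 1" shows "poisson z w \<le> 1 / (1 - cmod z)\<^sup>2"
proof -
  have "1 - cmod z \<le> cmod (w - z)" using norm_triangle_ineq2[of w z] assms by simp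
  hence "(1 - cmod z)\<^sup>2 \<le> (cmod (w - z))\<^sup>2" using assms by (intro power_mono) auto
  thus ?thesis unfolding poisson_def using assms by (intro frac_le) auto
qed

lemma borel_measurable_poisson [measurable]: "poisson z \<in> borel_measurable borel"
  unfolding poisson_def by measurable

lemma integrable_poisson:
  assumes f: "integrable circle_measure f" and z: "cmod z < 1"
  shows "integrable circle_measure (\<lambda>w. f w * of_real (poisson z w) :: complex)"
proof (rule Bochner_Integration.integrable_bound)
  have [measurable]: "f \<in> borel_measurable circle_measure" using f by auto
  show "integrable circle_measure (\<lambda>w. 1 / (1 - cmod z)\<^sup>2 * norm (f w))" using f by auto
  show "AE w in circle_measure. norm (f w * of_real (poisson z w)) \<le> norm (1 / (1 - cmod z)\<^sup>2 * norm (f w))"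
    using AE_circle_cmod
  proof eventually_elim
    case (elim w)
    show ?case using poisson_bounded[OF z elim] poisson_nonneg[OF z, of w]
      by (simp add: norm_mult mult.commute[of "norm (f w)"] mult_right_mono divide_right_mono flip: times_divide_eq_left)
  qed
  show "(\<lambda>w. f w * of_real (poisson z w)) \<in> borel_measurable circle_measure" by measurable
qed

text \<open>The Cauchy kernel \<open>A\<close> already reproduces the power series, but its modulus
  decays only like the inverse distance. Adding \<open>B\<close>, a series in positive powers of
  \<open>w\<close> that \<open>f\<close> annihilates, gives a nonnegative kernel with inverse square
  decay.\<close>

lemma H2_poisson:
  assumes f: "f \<in> H2" and z: "cmod z < 1"
  shows "disk_ext f z = (LINT w|circle_measure. f w * of_real (poisson z w))"
proof -
  have fL [measurable]: "f \<in> L2" using f by (rule H2_L2)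
  note fi = L2_integrable[OF fL]
  have s1: "summable (\<lambda>m. norm (z ^ m))" and s2: "summable (\<lambda>m. norm (cnj z ^ Suc m))"
    using z by (auto simp: norm_power norm_mult intro!: summable_mult summable_geometric)
  define A B where "A = (\<lambda>w. \<Sum>m. z ^ m * w powi - int m)" and "B = (\<lambda>w. \<Sum>m. cnj z ^ Suc m * w powi int (Suc m))"
  have [measurable]: "A \<in> borel_measurable borel" "B \<in> borel_measurable borel"
    unfolding A_def B_def by measurable
  have "(\<lambda>m. z ^ m * (LINT w|circle_measure. f w * w powi - int m)) sums (LINT w|circle_measure. f w * A w)"
    unfolding A_def by (rule integral_power_series[OF fi s1])
  hence 1: "(LINT w|circle_measure. f w * A w) = disk_ext f z"
    unfolding disk_ext_def fourier_coeff_def by (simp add: sums_iff mult.commute)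
  have "(\<lambda>m. cnj z ^ Suc m * (LINT w|circle_measure. f w * w powi int (Suc m))) sums (LINT w|circle_measure. f w * B w)"
    unfolding B_def by (rule integral_power_series[OF fi s2])
  moreover have "(LINT w|circle_measure. f w * w powi int (Suc m)) = 0" for m
  proof -
    have "fourier_coeff f (- int (Suc m)) = 0" using f unfolding H2_def by auto
    thus ?thesis unfolding fourier_coeff_def by (simp add: add.commute)
  qed
  ultimately have 2: "(LINT w|circle_measure. f w * B w) = 0" by (simp add: sums_iff)
  have AB: "AE w in circle_measure. A w = w / (w - z) \<and> A w + B w = of_real (poisson z w)"
    using AE_circle_cmod
  proof eventually_elim
    case (elim w)
    note c = circle_cnj_eq[OF elim]
    have "w \<noteq> z" "cnj w \<noteq> cnj z" using elim z by auto
    have zw: "cmod (z * cnj w) < 1" "cmod (cnj z * w) < 1" using elim z by (auto simp: norm_mult)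
    have "z ^ m * w powi - int m = (z * cnj w) ^ m" for m
      unfolding circle_cnj_powi(1)[OF elim, symmetric] by (simp add: power_mult_distrib)
    hence "A w = 1 / (1 - z * cnj w)" unfolding A_def using suminf_geometric[OF zw(1)] by simp
    also have "\<dots> = w / (w - z)"
    proof -
      have "1 - z * cnj w = cnj w * (w - z)" using c by (simp add: algebra_simps)
      moreover have "w / (w - z) = (cnj w * w) / (cnj w * (w - z))" using c(4) by simp
      ultimately show ?thesis using c(3) by simp
    qed
    finally have A: "A w = w / (w - z)" .
    have "cnj z ^ Suc m * w powi int (Suc m) = (cnj z * w) * (cnj z * w) ^ m" for m
      by (simp only: power_int_of_nat power_Suc power_mult_distrib mult_ac)
    hence "B w = (\<Sum>m. (cnj z * w) * (cnj z * w) ^ m)" unfolding B_def by (simp only:)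
    also have "\<dots> = (cnj z * w) * (1 / (1 - cnj z * w))"
      using suminf_mult[OF summable_geometric[OF zw(2)], of "cnj z * w"] suminf_geometric[OF zw(2)] by simp
    also have "\<dots> = cnj z / (cnj w - cnj z)"
    proof -
      have "1 - cnj z * w = w * (cnj w - cnj z)" using c by (simp add: algebra_simps)
      hence "(cnj z * w) * (1 / (1 - cnj z * w)) = (w * cnj z) / (w * (cnj w - cnj z))" by simp
      thus ?thesis using c(4) by simp
    qed
    finally have B: "B w = cnj z / (cnj w - cnj z)" .
    have "A w + B w = (w * (cnj w - cnj z) + cnj z * (w - z)) / ((w - z) * (cnj w - cnj z))"
      unfolding A B using \<open>w \<noteq> z\<close> \<open>cnj w \<noteq> cnj z\<close> by (simp add: field_simps)
    also have "w * (cnj w - cnj z) + cnj z * (w - z) = 1 - z * cnj z" using c by (simp add: algebra_simps)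
    also have "\<dots> = of_real (1 - (cmod z)\<^sup>2)" using complex_norm_square[of z] by simp
    also have "(w - z) * (cnj w - cnj z) = of_real ((cmod (w - z))\<^sup>2)"
      using complex_norm_square[of "w - z"] by simp
    finally have "A w + B w = of_real (poisson z w)" by (simp add: poisson_def)
    with A show ?case by simp
  qed
  have iA: "integrable circle_measure (\<lambda>w. f w * A w)"
  proof (rule L2_mult_integrable[OF fL])
    show "A \<in> L2"
    proof (rule L2_bounded[of _ "1 / (1 - cmod z)"])
      show "AE w in circle_measure. cmod (A w) \<le> 1 / (1 - cmod z)"
        using AB AE_circle_cmod
      proof eventually_elim
        case (elim w)
        have "1 - cmod z \<le> cmod (w - z)" using norm_triangle_ineq2[of w z] elim by simp
        thus ?case using elim z by (auto simp: norm_divide intro!: divide_left_mono mult_pos_pos)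
      qed
    qed measurable
  qed
  have "(LINT w|circle_measure. f w * of_real (poisson z w) - f w * A w) = (LINT w|circle_measure. f w * B w)"
  proof (rule integral_cong_AE)
    show "AE w in circle_measure. f w * of_real (poisson z w) - f w * A w = f w * B w"
      using AB
    proof eventually_elim
      case (elim w)
      show ?case unfolding conjunct2[OF elim, symmetric] by (simp add: distrib_left)
    qed
  qed measurable
  thus ?thesis using iA integrable_poisson[OF fi z] 1 2 by simp
qed

text \<open>On the circle the Poisson kernel at \<open>r\<zeta>\<close> is at most a constant times the sum over \<open>k\<close> of
  \<open>4\<^sup>-\<^sup>k / (1 - r)\<close> times the indicator of the ball of radius \<open>2\<^sup>k (1 - r)\<close> around \<open>\<zeta>\<close>.\<close>

lemma disk_ext_le:
  assumes f: "f \<in> H2" and \<zeta>: "cmod \<zeta> = 1" and r: "0 \<le> r" "r < 1" and s: "s \<ge> 0"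
    and max: "\<And>\<rho>. \<rho> > 0 \<Longrightarrow> (LINT w|circle_measure. indicat_real (cball \<zeta> \<rho>) w * cmod (f w)) \<le> s * \<rho>"
  shows "cmod (disk_ext f (of_real r * \<zeta>)) \<le> 64 * s"
proof -
  define d where "d = 1 - r"
  have d: "d > 0" "d \<le> 1" using r by (auto simp: d_def)
  have z: "cmod (of_real r * \<zeta>) < 1" using r \<zeta> by (simp add: norm_mult)
  \<comment> \<open>The largest ball, of radius \<open>2 ^ K * d\<close>, must contain the whole
    circle, whose diameter is 2.\<close>
  obtain K :: nat where K: "2 / d < 2 ^ K" using real_arch_pow[of 2 "2/d"] by auto
  \<comment> \<open>Off the ball of radius \<open>2 ^ j * d\<close> the kernel is at most
    \<open>2 * d / (2 ^ j * d / 2)\<^sup>2\<close>, which equals \<open>c (Suc j)\<close>; for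
    \<open>k = 0\<close> its bound \<open>2 / d\<close> lies well below \<open>c 0\<close>.\<close>
  define c where "c = (\<lambda>k::nat. 32 / (4 ^ k * d))"
  have c0: "c k \<ge> 0" for k using d by (simp add: c_def)
  have P: "poisson (of_real r * \<zeta>) w \<le> (\<Sum>k\<le>K. c k * indicat_real (cball \<zeta> (2 ^ k * d)) w)"
    if w: "cmod w = 1" for w
  proof -
    define k where "k = (LEAST k. cmod (w - \<zeta>) \<le> 2 ^ k * d)"
    have "cmod (w - \<zeta>) \<le> 2" using norm_triangle_ineq4[of w \<zeta>] w \<zeta> by simp
    also have "2 \<le> 2 ^ K * d" using K d by (simp add: field_simps)
    finally have wK: "cmod (w - \<zeta>) \<le> 2 ^ K * d" .
    have k: "cmod (w - \<zeta>) \<le> 2 ^ k * d" unfolding k_def by (rule LeastI[where P = "\<lambda>k. cmod (w - \<zeta>) \<le> 2 ^ k * d", OF wK])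
    have kK: "k \<le> K" unfolding k_def by (rule Least_le[where P = "\<lambda>k. cmod (w - \<zeta>) \<le> 2 ^ k * d", OF wK])
    have num: "0 \<le> 1 - (cmod (of_real r * \<zeta>))\<^sup>2" "1 - (cmod (of_real r * \<zeta>))\<^sup>2 \<le> 2 * d"
      using r \<zeta> zero_le_power2[of "1 - r"]
      by (auto simp: norm_mult power_le_one d_def power2_diff)
    \<comment> \<open>The point \<open>of_real r * \<zeta>\<close> has distance \<open>d\<close>
      from \<open>\<zeta>\<close> and at least \<open>d\<close> from \<open>w\<close>; hence the
      factor 2.\<close>
    have dist: "d \<le> cmod (w - of_real r * \<zeta>)" "cmod (w - \<zeta>) \<le> 2 * cmod (w - of_real r * \<zeta>)"
    proof -
      show *: "d \<le> cmod (w - of_real r * \<zeta>)"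
        using norm_triangle_ineq2[of w "of_real r * \<zeta>"] w \<zeta> r by (simp add: norm_mult d_def)
      have "cmod (of_real r * \<zeta> - \<zeta>) = cmod (of_real (r - 1) * \<zeta>)" by (simp add: algebra_simps)
      also have "\<dots> = d" using \<zeta> r by (simp only: norm_mult norm_of_real d_def) simp
      finally show "cmod (w - \<zeta>) \<le> 2 * cmod (w - of_real r * \<zeta>)"
        using norm_triangle_ineq[of "w - of_real r * \<zeta>" "of_real r * \<zeta> - \<zeta>"] * by simp
    qed
    have "poisson (of_real r * \<zeta>) w \<le> c k"
    proof (cases k)
      case 0
      have "poisson (of_real r * \<zeta>) w \<le> (2 * d) / d\<^sup>2"
        unfolding poisson_def using num dist d by (intro frac_le power_mono) auto
      thus ?thesis using 0 d by (simp add: c_def power2_eq_square field_simps)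
    next
      case (Suc j)
      have "\<not> cmod (w - \<zeta>) \<le> 2 ^ j * d"
        using not_less_Least[of j "\<lambda>k. cmod (w - \<zeta>) \<le> 2 ^ k * d"] Suc k_def by simp
      hence "2 ^ j * d / 2 \<le> cmod (w - of_real r * \<zeta>)" using dist(2) by simp
      hence "poisson (of_real r * \<zeta>) w \<le> (2 * d) / (2 ^ j * d / 2)\<^sup>2"
        unfolding poisson_def using num d by (intro frac_le power_mono) auto
      also have "\<dots> = c k"
        using d Suc power_mult_distrib[of "2::real" 2 j] by (simp add: c_def power2_eq_square field_simps)
      finally show ?thesis .
    qed
    also have "c k = c k * indicat_real (cball \<zeta> (2 ^ k * d)) w"
      using k by (simp add: indicator_def dist_norm norm_minus_commute)
    also have "\<dots> \<le> (\<Sum>k\<le>K. c k * indicat_real (cball \<zeta> (2 ^ k * d)) w)"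
      using kK c0 by (intro member_le_sum) auto
    finally show ?thesis .
  qed
  note fi = L2_integrable[OF H2_L2[OF f]]
  have [measurable]: "f \<in> borel_measurable circle_measure" using fi by auto
  have gi: "integrable circle_measure (\<lambda>w. indicat_real (cball \<zeta> \<rho>) w * cmod (f w))" for \<rho>
    using integrable_mult_indicator[OF _ integrable_norm[OF fi], of "cball \<zeta> \<rho>"] by simp
  have "cmod (disk_ext f (of_real r * \<zeta>)) \<le> (LINT w|circle_measure. norm (f w * of_real (poisson (of_real r * \<zeta>) w)))"
    unfolding H2_poisson[OF f z] by (rule integral_norm_bound)
  also have "\<dots> \<le> (LINT w|circle_measure. (\<Sum>k\<le>K. c k * (indicat_real (cball \<zeta> (2 ^ k * d)) w * cmod (f w))))"
  proof (rule integral_mono_AE)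
    show "AE w in circle_measure. norm (f w * of_real (poisson (of_real r * \<zeta>) w)) \<le>
        (\<Sum>k\<le>K. c k * (indicat_real (cball \<zeta> (2 ^ k * d)) w * cmod (f w)))"
      using AE_circle_cmod
    proof eventually_elim
      case (elim w)
      have "norm (f w * of_real (poisson (of_real r * \<zeta>) w)) = poisson (of_real r * \<zeta>) w * cmod (f w)"
        using poisson_nonneg[OF z, of w] by (simp add: norm_mult)
      also have "\<dots> \<le> (\<Sum>k\<le>K. c k * indicat_real (cball \<zeta> (2 ^ k * d)) w) * cmod (f w)"
        by (intro mult_right_mono P elim) auto
      finally show ?case by (simp only: sum_distrib_right mult.assoc)
    qed
  qed (use integrable_poisson[OF fi z] gi in auto)
  also have "\<dots> = (\<Sum>k\<le>K. c k * (LINT w|circle_measure. indicat_real (cball \<zeta> (2 ^ k * d)) w * cmod (f w)))"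
    using gi by (subst Bochner_Integration.integral_sum) auto
  also have "\<dots> \<le> (\<Sum>k\<le>K. c k * (s * (2 ^ k * d)))"
    using c0 d by (intro sum_mono mult_left_mono max) auto
  \<comment> \<open>The radius contributes \<open>2 ^ k\<close>, which turns the decay
    \<open>1 / 4 ^ k\<close> into a geometric series with sum at most 2.\<close>
  also have "\<dots> = (\<Sum>k\<le>K. 32 * s * (1/2) ^ k)"
  proof (rule sum.cong)
    fix k
    have "(4::real) ^ k = 2 ^ k * 2 ^ k" by (simp flip: power_mult_distrib)
    thus "c k * (s * (2 ^ k * d)) = 32 * s * (1/2) ^ k"
      using d by (simp add: c_def power_one_over field_simps)
  qed simp
  also have "\<dots> = 32 * s * (\<Sum>k\<le>K. (1/2) ^ k)" by (simp add: sum_distrib_left)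
  also have "\<dots> \<le> 32 * s * 2"
  proof (rule mult_left_mono)
    have "(\<Sum>k\<le>K. (1/2::real) ^ k) \<le> (\<Sum>k. (1/2) ^ k)"
      by (rule sum_le_suminf) auto
    thus "(\<Sum>k\<le>K. (1/2::real) ^ k) \<le> 2" by (simp add: suminf_geometric)
  qed (use s in simp)
  finally show ?thesis by simp
qed

section \<open>Convergence along radii almost everywhere\<close>

lemma fourier_coeff_poly: "fourier_coeff (poly p) (int n) = coeff p n"
proof (induction p arbitrary: n)
  case 0
  thus ?case by (simp add: fourier_coeff_def)
next
  case (pCons a p)
  have L: "poly p \<in> L2" by (intro H2_L2 H2_poly)
  have "fourier_coeff (poly (pCons a p)) (int n) =
      fourier_coeff (\<lambda>z. a) (int n) + fourier_coeff (\<lambda>z. z * poly p z) (int n)"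
  proof -
    have "poly (pCons a p) = (\<lambda>z. a + z * poly p z)" by (simp add: fun_eq_iff)
    thus ?thesis using fourier_coeff_add[OF L2_const L2_z_mult[OF L]] by simp
  qed
  also have "fourier_coeff (\<lambda>z. a) (int n) = (if n = 0 then a else 0)"
    using fourier_coeff_cmult[of a "\<lambda>z. z powi 0" "int n"] fourier_coeff_powi[of 0 "int n"] by simp
  also have "fourier_coeff (\<lambda>z. z * poly p z) (int n) = fourier_coeff (poly p) (int n - 1)"
    by (rule fourier_coeff_z_mult[OF L])
  also have "\<dots> = (if n = 0 then 0 else coeff p (n - 1))"
  proof (cases n)
    case 0
    have "fourier_coeff (poly p) (-1) = 0" using H2_poly[of p] by (simp add: H2_def)
    thus ?thesis using 0 by simp
  next
    case (Suc m)
    thus ?thesis using pCons.IH[of m] by simp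
  qed
  finally show ?case by (simp add: coeff_pCons split: nat.split)
qed

text \<open>Polynomials form the dense class on which radial convergence is plain
  continuity.\<close>

lemma disk_ext_poly: "disk_ext (poly p) z = poly p z"
proof -
  have "disk_ext (poly p) z = (\<Sum>n. coeff p n * z ^ n)"
    unfolding disk_ext_def fourier_coeff_poly ..
  also have "\<dots> = (\<Sum>n\<le>degree p. coeff p n * z ^ n)"
    by (rule suminf_finite) (auto simp: coeff_eq_0)
  finally show ?thesis by (simp add: poly_altdef)
qed

lemma disk_ext_diff:
  assumes "f \<in> L2" "g \<in> L2" "cmod z < 1"
  shows "disk_ext (\<lambda>w. f w - g w) z = disk_ext f z - disk_ext g z"
proof -
  have "(\<lambda>n. fourier_coeff f (int n) * z ^ n - fourier_coeff g (int n) * z ^ n) sums (disk_ext f z - disk_ext g z)"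
    by (intro sums_diff disk_ext_sums assms)
  hence "(\<lambda>n. fourier_coeff (\<lambda>w. f w - g w) (int n) * z ^ n) sums (disk_ext f z - disk_ext g z)"
    using assms by (simp add: fourier_coeff_diff left_diff_distrib)
  thus ?thesis unfolding disk_ext_def by (simp add: sums_iff)
qed

lemma eventually_at_left_1: "eventually (\<lambda>r::real. 0 \<le> r \<and> r < 1) (at_left 1)"
  unfolding eventually_at_left_field by (intro exI[of _ 0]) auto

text \<open>Split \<open>f\<close> into a polynomial and a remainder \<open>q\<close> of small norm.
  Off \<open>E\<close> the maximal estimate bounds the extension of \<open>q\<close> along the
  radius; off \<open>E'\<close>, which is small by Markov's inequality, \<open>q\<close> itself is
  small.\<close>

lemma exceptional_set:
  assumes f: "f \<in> H2" and e: "e > 0" and \<eta>: "\<eta> > 0"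
  obtains E where "E \<in> sets borel" "emeasure circle_measure E \<le> ennreal \<eta>"
    "\<And>\<zeta>. cmod \<zeta> = 1 \<Longrightarrow> \<zeta> \<notin> E \<Longrightarrow>
      eventually (\<lambda>r. cmod (disk_ext f (of_real r * \<zeta>) - f \<zeta>) < e) (at_left (1::real))"
proof -
  \<comment> \<open>Three errors of size at most \<open>d\<close> occur: the extension of
    \<open>q\<close>, the increment of the polynomial, and \<open>q \<zeta>\<close>.\<close>
  define d where "d = e / 4"
  have d: "d > 0" using e by (simp add: d_def)
  \<comment> \<open>Chosen so that the bound \<open>64 * s\<close> on the extension of
    \<open>q\<close> becomes \<open>d\<close>.\<close>
  define s where "s = d / 64"
  have s: "s > 0" using d by (simp add: s_def)
  \<comment> \<open>The sum of the weak type constant for \<open>E\<close> and the Markov constant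
    for \<open>E'\<close>; a norm of \<open>q\<close> below \<open>\<eta> / C\<close> makes their
    union as small as required.\<close>
  define C where "C = 280 / s + 1 / d"
  have C: "C > 0" using s d by (simp add: C_def add_pos_pos)
  obtain p where p: "L2_norm (\<lambda>z. f z - poly p z) < \<eta> / C"
    using H2_poly_dense[OF f, of "\<eta> / C"] \<eta> C by auto
  define q where "q = (\<lambda>z. f z - poly p z)"
  have qH: "q \<in> H2" unfolding q_def by (rule L2_subspaceD(4)[OF H2_subspace f H2_poly])
  note qL = H2_L2[OF qH]
  note [measurable] = qL
  define J where "J = (LINT w|circle_measure. cmod (q w))"
  have J: "J \<le> \<eta> / C" "J \<ge> 0" using L1_le_L2_norm[OF qL] p by (auto simp: J_def q_def)
  have qi: "integrable circle_measure (\<lambda>w. cmod (q w))" using L2_integrable[OF qL] by auto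
  obtain E where E: "E \<in> sets borel"
    "\<And>\<zeta> \<rho>. \<rho> > 0 \<Longrightarrow> s * \<rho> < (LINT w|circle_measure. indicat_real (cball \<zeta> \<rho>) w * cmod (q w)) \<Longrightarrow> \<zeta> \<in> E"
    "emeasure circle_measure E \<le> ennreal (280 / s * J)"
    using maximal_weak_type[OF qi _ s] unfolding J_def by auto
  define E' where "E' = {w. cmod (q w) \<ge> d}"
  have E'[measurable]: "E' \<in> sets borel" unfolding E'_def by measurable
  have "emeasure circle_measure E' \<le> ennreal (1 / d * J)"
    using integral_Markov_inequality[OF qi _ d] by (simp add: E'_def J_def)
  hence "emeasure circle_measure (E \<union> E') \<le> ennreal (280 / s * J) + ennreal (1 / d * J)"
    using E(1,3) by (intro order_trans[OF emeasure_subadditive] add_mono) auto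
  also have "\<dots> = ennreal (C * J)"
    using s d J by (subst ennreal_plus[symmetric]) (auto simp: C_def algebra_simps)
  also have "\<dots> \<le> ennreal \<eta>" using J C by (intro ennreal_leI) (simp add: field_simps)
  finally have m: "emeasure circle_measure (E \<union> E') \<le> ennreal \<eta>" .
  show ?thesis
  proof (rule that[OF _ m])
    show "E \<union> E' \<in> sets borel" using E(1) E' by auto
    fix \<zeta> assume \<zeta>: "cmod \<zeta> = 1" "\<zeta> \<notin> E \<union> E'"
    have q\<zeta>: "cmod (q \<zeta>) < d" using \<zeta> by (simp add: E'_def)
    have qr: "cmod (disk_ext q (of_real r * \<zeta>)) \<le> d" if "0 \<le> r" "r < 1" for r
    proof -
      have "(LINT w|circle_measure. indicat_real (cball \<zeta> \<rho>) w * cmod (q w)) \<le> s * \<rho>" if "\<rho> > 0" for \<rho>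
        using E(2)[OF that, of \<zeta>] \<zeta>(2) by (meson UnI1 linorder_not_less)
      thus ?thesis using disk_ext_le[OF qH \<zeta>(1) that, of s] s by (simp add: s_def)
    qed
    have "((\<lambda>r. poly p (complex_of_real r * \<zeta>)) \<longlongrightarrow> poly p (complex_of_real 1 * \<zeta>)) (at_left 1)"
      by (intro tendsto_intros)
    hence "eventually (\<lambda>r. dist (poly p (complex_of_real r * \<zeta>)) (poly p \<zeta>) < d) (at_left 1)"
      using d by (auto dest: tendstoD)
    thus "eventually (\<lambda>r. cmod (disk_ext f (of_real r * \<zeta>) - f \<zeta>) < e) (at_left (1::real))"
      using eventually_at_left_1
    proof eventually_elim
      case (elim r)
      have "disk_ext q (of_real r * \<zeta>) = disk_ext f (of_real r * \<zeta>) - poly p (of_real r * \<zeta>)"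
        unfolding q_def using elim \<zeta>(1) H2_L2[OF f] H2_L2[OF H2_poly]
        by (subst disk_ext_diff) (auto simp: disk_ext_poly norm_mult)
      hence "disk_ext f (of_real r * \<zeta>) - f \<zeta> =
          disk_ext q (of_real r * \<zeta>) + (poly p (of_real r * \<zeta>) - poly p \<zeta>) - q \<zeta>"
        by (simp add: q_def)
      also have "cmod \<dots> \<le> cmod (disk_ext q (of_real r * \<zeta>)) + cmod (poly p (of_real r * \<zeta>) - poly p \<zeta>) + cmod (q \<zeta>)"
        by (intro order_trans[OF norm_triangle_ineq4] add_right_mono norm_triangle_ineq)
      also have "\<dots> < e" using qr[of r] elim q\<zeta> d by (simp add: dist_norm d_def)
      finally show ?case .
    qed
  qed
qed

text \<open>For fixed \<open>e\<close> the exceptional sets of measure at most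
  \<open>inverse (Suc n)\<close> have a null intersection; countably many values of \<open>e\<close>
  then suffice for the limit.\<close>

lemma Fatou:
  assumes f: "f \<in> H2"
  shows "AE \<zeta> in circle_measure. ((\<lambda>r. disk_ext f (of_real r * \<zeta>)) \<longlongrightarrow> f \<zeta>) (at_left (1::real))"
proof -
  have small: "AE \<zeta> in circle_measure. eventually (\<lambda>r. cmod (disk_ext f (of_real r * \<zeta>) - f \<zeta>) < e) (at_left (1::real))"
    if e: "e > 0" for e
  proof -
    have "\<exists>E. E \<in> sets borel \<and> emeasure circle_measure E \<le> ennreal (inverse (Suc n)) \<and>
      (\<forall>\<zeta>. cmod \<zeta> = 1 \<longrightarrow> \<zeta> \<notin> E \<longrightarrow>
        eventually (\<lambda>r. cmod (disk_ext f (of_real r * \<zeta>) - f \<zeta>) < e) (at_left (1::real)))" for n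
      by (rule exceptional_set[OF f e, of "inverse (Suc n)"]) auto
    then obtain E where E: "\<And>n. E n \<in> sets borel" "\<And>n. emeasure circle_measure (E n) \<le> ennreal (inverse (Suc n))"
      "\<And>n \<zeta>. cmod \<zeta> = 1 \<Longrightarrow> \<zeta> \<notin> E n \<Longrightarrow>
        eventually (\<lambda>r. cmod (disk_ext f (of_real r * \<zeta>) - f \<zeta>) < e) (at_left (1::real))"
      by metis
    have "emeasure circle_measure (\<Inter>n. E n) \<le> ennreal (inverse (Suc n))" for n
      using E(1,2) by (intro order_trans[OF emeasure_mono E(2)]) auto
    moreover have "(\<lambda>n. ennreal (inverse (Suc n))) \<longlonglongrightarrow> ennreal 0"
      by (intro tendsto_ennrealI LIMSEQ_inverse_real_of_nat)
    ultimately have "emeasure circle_measure (\<Inter>n. E n) \<le> ennreal 0"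
      by (intro LIMSEQ_le_const) auto
    hence "(\<Inter>n. E n) \<in> null_sets circle_measure" using E(1) by (intro null_setsI) auto
    hence "AE \<zeta> in circle_measure. \<zeta> \<notin> (\<Inter>n. E n)" by (rule AE_not_in)
    thus ?thesis using AE_circle_cmod by eventually_elim (use E(3) in blast)
  qed
  have "AE \<zeta> in circle_measure. \<forall>n. eventually (\<lambda>r. cmod (disk_ext f (of_real r * \<zeta>) - f \<zeta>) < inverse (Suc n)) (at_left (1::real))"
    unfolding AE_all_countable using small by auto
  thus ?thesis
  proof eventually_elim
    case (elim \<zeta>)
    show ?case
    proof (rule tendstoI)
      fix e :: real assume "e > 0"
      then obtain n where n: "inverse (Suc n) < e" using reals_Archimedean by blast
      from elim[rule_format, of n]
      show "eventually (\<lambda>r. dist (disk_ext f (of_real r * \<zeta>)) (f \<zeta>) < e) (at_left (1::real))"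
        by eventually_elim (use n in \<open>auto simp: dist_norm\<close>)
    qed
  qed
qed

text \<open>Boundedness comes from averaging a unimodular function against the nonnegative Poisson
  kernel of mass 1; unimodular radial limits come from Fatou's theorem.\<close>

lemma inner_function_disk_ext:
  assumes f: "f \<in> H2" and mod: "AE z in circle_measure. cmod (f z) = 1"
  shows "inner_function (disk_ext f)" "AE z in circle_measure. boundary (disk_ext f) z = f z"
proof -
  note fL = H2_L2[OF f]
  note [measurable] = fL
  have bound: "cmod (disk_ext f z) \<le> 1" if z: "cmod z < 1" for z
  proof -
    have i1: "integrable circle_measure (\<lambda>w. complex_of_real (poisson z w))"
      using integrable_poisson[of "\<lambda>_. 1", OF _ z] by simp
    \<comment> \<open>The mass of the kernel is read off from the representation of the constant
      polynomial 1.\<close>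
    have "disk_ext (poly 1) z = (LINT w|circle_measure. complex_of_real (poisson z w))"
      using H2_poisson[OF H2_poly z, of 1] by simp
    hence p1: "(LINT w|circle_measure. poisson z w) = 1"
      using disk_ext_poly[of 1 z] integral_complex_of_real[of circle_measure "poisson z"] by simp
    have "cmod (disk_ext f z) \<le> (LINT w|circle_measure. norm (f w * of_real (poisson z w)))"
      unfolding H2_poisson[OF f z] by (rule integral_norm_bound)
    also have "\<dots> = (LINT w|circle_measure. poisson z w)"
    proof (rule integral_cong_AE)
      show "AE w in circle_measure. norm (f w * of_real (poisson z w)) = poisson z w"
        using mod by eventually_elim (use poisson_nonneg[OF z] in \<open>simp add: norm_mult\<close>)
    qed measurable
    finally show ?thesis using p1 by simp
  qed
  show "inner_function (disk_ext f)"
    unfolding inner_function_def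
  proof (intro conjI)
    show "bounded (disk_ext f ` ball 0 1)"
      using bound by (auto simp: bounded_iff intro!: exI[of _ 1])
    show "AE \<zeta> in circle_measure. \<exists>l. cmod l = 1 \<and> ((\<lambda>r::real. disk_ext f (of_real r * \<zeta>)) \<longlongrightarrow> l) (at_left 1)"
      using Fatou[OF f] mod by eventually_elim auto
  qed (rule holomorphic_disk_ext[OF fL])
  show "AE z in circle_measure. boundary (disk_ext f) z = f z"
    using Fatou[OF f]
  proof eventually_elim
    case (elim z)
    thus ?case unfolding boundary_def by (intro tendsto_Lim) auto
  qed
qed

section \<open>The orthogonal complement of the model space\<close>

text \<open>Without its mean \<open>c\<close>, \<open>f\<close> has only positive frequencies, so
  the conjugate of \<open>f - c\<close> lies in \<open>conj_H2_0\<close> and is orthogonal to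
  \<open>g\<close>.\<close>

lemma H2_mult_integral:
  assumes f: "f \<in> H2" and g: "g \<in> H2"
  shows "(LINT z|circle_measure. f z * g z) = fourier_coeff f 0 * fourier_coeff g 0"
proof -
  define c where "c = fourier_coeff f 0"
  note fL = H2_L2[OF f] and gL = H2_L2[OF g]
  have c: "fourier_coeff (\<lambda>_. c) n = (if n = 0 then c else 0)" for n
    using fourier_coeff_cmult[of c "\<lambda>z. z powi 0" n] fourier_coeff_powi[of 0 n] by simp
  have L: "(\<lambda>z. f z - c) \<in> L2" using fL by auto
  have "fourier_coeff (\<lambda>z. f z - c) (- n) = 0" if "n \<ge> 0" for n
    using f that fourier_coeff_diff[OF fL L2_const[of c], of "- n"] c[of "- n"]
    by (cases "n = 0") (auto simp: c_def H2_def)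
  hence "(\<lambda>z. cnj (f z - c)) \<in> conj_H2_0"
    using L2_cnj[OF L] fourier_coeff_cnj[OF L] by (simp add: conj_H2_0_eq)
  from conj_H2_0_orth_H2[OF this g] have "L2_inner g (\<lambda>z. cnj (f z - c)) = 0"
    using L2_inner_commute[of g "\<lambda>z. cnj (f z - c)"] by simp
  hence "(LINT z|circle_measure. f z * g z - c * g z) = 0"
    unfolding L2_inner_def by (simp add: algebra_simps)
  hence "(LINT z|circle_measure. f z * g z) = c * (LINT z|circle_measure. g z)"
    using L2_mult_integrable[OF fL gL] L2_integrable[OF gL] by simp
  thus ?thesis by (simp add: c_def fourier_coeff_def)
qed

text \<open>A coefficient of negative index of the product is the integral of \<open>f\<close>
  against a positive shift of \<open>g\<close>, hence a product of zeroth coefficients, the second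
  of which is 0.\<close>

lemma H2_mult:
  assumes f: "f \<in> H2" and g: "g \<in> H2" and fg: "(\<lambda>z. f z * g z) \<in> L2"
  shows "(\<lambda>z. f z * g z) \<in> H2"
proof -
  have shift: "(\<lambda>z. z ^ j * g z) \<in> H2" for j
  proof (induction j)
    case (Suc j)
    from H2_z_mult[OF this] show ?case by (simp add: mult.assoc)
  qed (use g in simp)
  have "fourier_coeff (\<lambda>z. f z * g z) n = 0" if n: "n < 0" for n
  proof -
    obtain j where j: "- n = int (Suc j)" using n by (metis gr0_conv_Suc neg_0_less_iff_less zero_less_imp_eq_int)
    have "fourier_coeff (\<lambda>z. f z * g z) n = (LINT z|circle_measure. f z * (z * (z ^ j * g z)))"
      unfolding fourier_coeff_def j by (simp add: mult_ac power_int_add del: of_nat_Suc)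
    also have "\<dots> = fourier_coeff f 0 * fourier_coeff (\<lambda>z. z * (z ^ j * g z)) 0"
      by (rule H2_mult_integral[OF f H2_z_mult[OF shift]])
    also have "\<dots> = 0"
      using shift[of j] by (simp add: fourier_coeff_z_mult H2_L2) (simp add: H2_def)
    finally show ?thesis .
  qed
  thus ?thesis using fg by (simp add: H2_def)
qed

section \<open>Sums of subspaces\<close>

lemma L2_zero_iff: "f \<in> L2_zero \<longleftrightarrow> f \<in> L2 \<and> (AE z in circle_measure. f z = 0)"
  by (simp add: L2_zero_def saturate_def)

lemma L2_sum_iff:
  "f \<in> X \<oplus>\<^sub>2 Y \<longleftrightarrow> f \<in> L2 \<and> (\<exists>x\<in>X. \<exists>y\<in>Y. AE z in circle_measure. f z = x z + y z)"
  unfolding L2_sum_def saturate_def by auto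

lemma L2_sum_zero_right:
  assumes "L2_subspace X" shows "X \<oplus>\<^sub>2 L2_zero = X"
proof (intro set_eqI iffI)
  fix f assume "f \<in> X \<oplus>\<^sub>2 L2_zero"
  then obtain x y where f: "f \<in> L2" "x \<in> X" "AE z in circle_measure. y z = 0" "AE z in circle_measure. f z = x z + y z"
    by (auto simp: L2_sum_iff L2_zero_iff)
  have "AE z in circle_measure. f z = x z" using f(3,4) by eventually_elim simp
  thus "f \<in> X" by (rule L2_subspaceD(6)[OF assms f(2,1)])
next
  fix f assume "f \<in> X"
  thus "f \<in> X \<oplus>\<^sub>2 L2_zero"
    using L2_subspaceD(1)[OF assms] unfolding L2_sum_iff
    by (intro conjI bexI[of _ f] bexI[of _ "\<lambda>_. 0"]) (auto simp: L2_zero_iff)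
qed

lemma L2_sum_commute: "X \<oplus>\<^sub>2 Y = Y \<oplus>\<^sub>2 X"
proof -
  have "X \<oplus>\<^sub>2 Y \<subseteq> Y \<oplus>\<^sub>2 X" for X Y :: "(complex \<Rightarrow> complex) set"
    unfolding L2_sum_iff subset_iff by (metis (no_types, lifting) AE_cong add.commute)
  thus ?thesis by blast
qed

lemma conj_H2_0_subspace: "L2_subspace conj_H2_0"
proof -
  have *: "conj_H2_0 = L2_perp {\<lambda>z. z powi n |n. n \<ge> 0}"
    unfolding conj_H2_0_eq L2_perp_def by (auto simp: fourier_coeff_eq_inner)
  show ?thesis unfolding * by (rule L2_perp_subspace) force
qed

lemma L2_closedD:
  assumes "L2_closed M" "\<And>n::nat. F n \<in> M" "g \<in> L2" "(\<lambda>n. L2_norm (\<lambda>z. F n z - g z)) \<longlonglongrightarrow> 0"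
  shows "g \<in> M"
  by (rule assms(1)[unfolded L2_closed_def, rule_format, OF assms(3)]) (use assms in auto)

lemma cnj_z_conj_H2_0:
  assumes "x \<in> conj_H2_0" shows "(\<lambda>z. cnj (z * x z)) \<in> H2"
  using assms by (auto simp: H2_def conj_H2_0_eq fourier_coeff_cnj fourier_coeff_z_mult L2_z_mult
      simp del: complex_cnj_mult intro: L2_cnj)

text \<open>This makes components in the two spaces unique, which is what splits the invariance of a
  sum into conditions on its summands.\<close>

lemma H2_Int_conj_H2_0:
  assumes "f \<in> H2" "g \<in> conj_H2_0" "AE z in circle_measure. f z = g z"
  shows "AE z in circle_measure. f z = 0"
proof (rule L2_zeroI[OF H2_L2[OF assms(1)]])
  fix n
  have "fourier_coeff f n = fourier_coeff g n"
    using assms by (intro fourier_coeff_cong_AE L2_measurable) (auto simp: H2_def conj_H2_0_eq)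
  thus "fourier_coeff f n = 0" using assms by (cases "n < 0") (auto simp: H2_def conj_H2_0_eq)
qed

section \<open>Multiples of an inner function and the action of the dual shift\<close>

text \<open>The measurable representative \<open>b\<close> accompanies \<open>u\<close>, so that
  integrals never involve \<open>boundary u\<close>. The locale serves the given \<open>u\<close>
  and also the inner functions produced by Beurling's theorem.\<close>

locale inner_boundary =
  fixes u b :: "complex \<Rightarrow> complex"
  assumes inner: "inner_function u" and b_H2: "b \<in> H2"
    and bdry: "AE z in circle_measure. boundary u z = b z"
    and b_mod: "AE z in circle_measure. cmod (b z) = 1" and b_0: "fourier_coeff b 0 = u 0"
begin

lemma b_L2: "b \<in> L2" by (rule H2_L2[OF b_H2])

lemma b_mult_L2: "f \<in> L2 \<Longrightarrow> (\<lambda>z. b z * f z) \<in> L2"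
  using b_mod b_L2 by (intro L2_bounded_mult[of f b 1]) auto

lemma cnj_b_mult_L2: "f \<in> L2 \<Longrightarrow> (\<lambda>z. cnj (b z) * f z) \<in> L2"
  using b_mod b_L2 by (intro L2_bounded_mult[of f _ 1]) auto

lemma b_mult_H2: "f \<in> H2 \<Longrightarrow> (\<lambda>z. b z * f z) \<in> H2"
  by (intro H2_mult b_H2 b_mult_L2 H2_L2)

lemma mult_H2_iff:
  "f \<in> mult_H2 u \<longleftrightarrow> f \<in> L2 \<and> (\<exists>h\<in>H2. AE z in circle_measure. f z = b z * h z)"
proof -
  have "(AE z in circle_measure. f z = boundary u z * h z) \<longleftrightarrow> (AE z in circle_measure. f z = b z * h z)" for h
    using bdry by (intro eventually_subst) (auto elim: eventually_mono)
  thus ?thesis unfolding mult_H2_def saturate_def by auto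
qed

lemma mult_H2I:
  "f \<in> L2 \<Longrightarrow> h \<in> H2 \<Longrightarrow> AE z in circle_measure. f z = b z * h z \<Longrightarrow> f \<in> mult_H2 u"
  unfolding mult_H2_iff by blast

lemma mult_H2E:
  assumes "f \<in> mult_H2 u"
  obtains h where "f \<in> L2" "h \<in> H2" "AE z in circle_measure. f z = b z * h z"
  using assms unfolding mult_H2_iff by blast

lemma b_mult_mem: "h \<in> H2 \<Longrightarrow> (\<lambda>z. b z * h z) \<in> mult_H2 u"
  unfolding mult_H2_iff using b_mult_L2 H2_L2 by blast

text \<open>Multiplication by \<open>cnj b\<close> divides by \<open>b\<close>, as \<open>b\<close>
  has modulus 1. The existential becomes a membership in \<open>H2\<close>, from which closure
  properties are inherited.\<close>

lemma mult_H2_iff':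
  "f \<in> mult_H2 u \<longleftrightarrow> f \<in> L2 \<and> (\<lambda>z. cnj (b z) * f z) \<in> H2"
proof
  assume "f \<in> mult_H2 u"
  then obtain h where h: "f \<in> L2" "h \<in> H2" "AE z in circle_measure. f z = b z * h z"
    by (auto simp: mult_H2_iff)
  have "AE z in circle_measure. cnj (b z) * f z = h z"
    using h(3) b_mod by eventually_elim (simp add: circle_cnj_eq flip: mult.assoc)
  thus "f \<in> L2 \<and> (\<lambda>z. cnj (b z) * f z) \<in> H2"
    using L2_subspaceD(6)[OF H2_subspace h(2) cnj_b_mult_L2] h(1) by blast
next
  assume f: "f \<in> L2 \<and> (\<lambda>z. cnj (b z) * f z) \<in> H2"
  have "AE z in circle_measure. f z = b z * (cnj (b z) * f z)"
    using b_mod by eventually_elim (simp add: circle_cnj_eq flip: mult.assoc)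
  with f show "f \<in> mult_H2 u" by (intro mult_H2I) auto
qed

lemma mult_H2_subset: "mult_H2 u \<subseteq> H2"
proof
  fix f assume "f \<in> mult_H2 u"
  then obtain h where h: "f \<in> L2" "h \<in> H2" "AE z in circle_measure. f z = b z * h z"
    by (auto simp: mult_H2_iff)
  thus "f \<in> H2" using L2_subspaceD(6)[OF H2_subspace b_mult_H2[OF h(2)] h(1)] by blast
qed

lemma mult_H2_subspace: "L2_subspace (mult_H2 u)"
proof (rule L2_subspaceI)
  fix f g assume "f \<in> mult_H2 u" "g \<in> mult_H2 u"
  thus "(\<lambda>z. f z + g z) \<in> mult_H2 u"
    using L2_subspaceD(3)[OF H2_subspace] by (auto simp: mult_H2_iff' distrib_left)
next
  fix c f assume "f \<in> mult_H2 u"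
  thus "(\<lambda>z. c * f z) \<in> mult_H2 u"
    using L2_subspaceD(5)[OF H2_subspace, of "\<lambda>z. cnj (b z) * f z" c] by (auto simp: mult_H2_iff' mult.left_commute)
next
  fix f g assume "f \<in> mult_H2 u" and g: "g \<in> L2" "AE z in circle_measure. g z = f z"
  then obtain h where h: "h \<in> H2" "AE z in circle_measure. f z = b z * h z"
    by (auto simp: mult_H2_iff)
  have "AE z in circle_measure. g z = b z * h z" using g(2) h(2) by eventually_elim simp
  thus "g \<in> mult_H2 u" using g h by (auto simp: mult_H2_iff)
qed (use mult_H2_subset L2_subspaceD(2)[OF H2_subspace] in \<open>auto simp: mult_H2_iff' H2_L2\<close>)

lemma norm_b_mult: "f \<in> L2 \<Longrightarrow> L2_norm (\<lambda>z. b z * f z) = L2_norm f"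
  using b_mod b_mult_L2 by (intro L2_norm_cong_AE L2_measurable) (auto simp: norm_mult)

lemma norm_cnj_b_mult: "f \<in> L2 \<Longrightarrow> L2_norm (\<lambda>z. cnj (b z) * f z) = L2_norm f"
  using b_mod cnj_b_mult_L2 by (intro L2_norm_cong_AE L2_measurable) (auto simp: norm_mult)

lemma mult_H2_closed: "L2_closed (mult_H2 u)"
  unfolding L2_closed_def
proof (intro allI ballI impI, elim conjE)
  fix F g assume g: "g \<in> L2" and F: "\<forall>n::nat. F n \<in> mult_H2 u"
    and lim: "(\<lambda>n. L2_norm (\<lambda>z. F n z - g z)) \<longlonglongrightarrow> 0"
  have "L2_norm (\<lambda>z. cnj (b z) * F n z - cnj (b z) * g z) = L2_norm (\<lambda>z. F n z - g z)" for n
    using norm_cnj_b_mult[OF L2_diff[of "F n" g]] F g by (simp add: right_diff_distrib mult_H2_iff')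
  hence "(\<lambda>n. L2_norm (\<lambda>z. cnj (b z) * F n z - cnj (b z) * g z)) \<longlonglongrightarrow> 0" using lim by simp
  moreover have "(\<lambda>z. cnj (b z) * F n z) \<in> H2" for n using F by (simp add: mult_H2_iff')
  ultimately have "(\<lambda>z. cnj (b z) * g z) \<in> H2"
    by (intro L2_closedD[where F = "\<lambda>n z. cnj (b z) * F n z", OF H2_closed _ cnj_b_mult_L2[OF g]])
  thus "g \<in> mult_H2 u" using g by (simp add: mult_H2_iff')
qed

lemma model_space_subspace: "L2_subspace (model_space u)"
proof -
  have "mult_H2 u \<subseteq> L2" using L2_subspaceD(1)[OF mult_H2_subspace] .
  from L2_perp_subspace[OF this] H2_subspace show ?thesis
    unfolding model_space_def
    by (intro L2_subspaceI) (auto dest: L2_subspaceD)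
qed

lemma model_space_L2: "k \<in> model_space u \<Longrightarrow> k \<in> L2" and model_space_H2: "k \<in> model_space u \<Longrightarrow> k \<in> H2"
  by (auto simp: model_space_def H2_L2)

lemma model_space_perp: "k \<in> model_space u \<Longrightarrow> f \<in> mult_H2 u \<Longrightarrow> L2_inner f k = 0"
  using L2_inner_commute[of f k] by (auto simp: model_space_def L2_perp_def)

text \<open>Project the \<open>H2\<close> part of \<open>f\<close> onto \<open>mult_H2 u\<close>.
  What is left of it lies in the model space and is orthogonal to \<open>f\<close>, to
  \<open>f1\<close> and to \<open>g\<close>, hence to itself.\<close>

lemma perp_model_space:
  assumes f: "f \<in> L2_perp (model_space u)"
  shows "f \<in> conj_H2_0 \<oplus>\<^sub>2 mult_H2 u"
proof -
  have fL: "f \<in> L2" using f by (simp add: L2_perp_def)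
  obtain f1 f2 where f12: "f1 \<in> conj_H2_0" "f2 \<in> H2" "\<And>z. f z = f1 z + f2 z"
    using L2_decompose[OF fL] by blast
  have L: "f1 \<in> L2" "f2 \<in> L2" using f12 by (auto simp: conj_H2_0_eq H2_L2)
  obtain g where g: "g \<in> mult_H2 u" and orth: "\<And>h. h \<in> mult_H2 u \<Longrightarrow> L2_inner (\<lambda>z. f2 z - g z) h = 0"
    using L2_projection[OF mult_H2_subspace mult_H2_closed L(2)] by blast
  have gH: "g \<in> H2" using g mult_H2_subset by blast
  define h where "h = (\<lambda>z. f2 z - g z)"
  have hH: "h \<in> H2" unfolding h_def by (rule L2_subspaceD(4)[OF H2_subspace f12(2) gH])
  have hK: "h \<in> model_space u"
    unfolding model_space_def L2_perp_def using hH H2_L2[OF hH] orth by (auto simp: h_def)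
  have "L2_inner f h = 0" using f hK by (auto simp: L2_perp_def)
  moreover have "f = (\<lambda>z. f1 z + f2 z)" using f12(3) by auto
  ultimately have "L2_inner f1 h + L2_inner f2 h = 0"
    using L2_inner_add_left[OF L H2_L2[OF hH]] by simp
  moreover have "L2_inner f1 h = 0" by (rule conj_H2_0_orth_H2[OF f12(1) hH])
  moreover have "L2_inner g h = 0" by (rule model_space_perp[OF hK g])
  ultimately have "L2_inner h h = 0"
    using L2_inner_diff_left[OF L(2) H2_L2[OF gH] H2_L2[OF hH]] by (simp add: h_def)
  hence "AE z in circle_measure. h z = 0"
    using L2_norm_eq_0_iff[OF H2_L2[OF hH]] by (simp add: L2_inner_self)
  hence "AE z in circle_measure. f z = f1 z + g z"
    by eventually_elim (simp add: h_def f12(3))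
  thus ?thesis unfolding L2_sum_iff using fL f12(1) g by blast
qed

text \<open>As \<open>model_proj\<close> is a choice, its value is known only almost everywhere.
  Computing \<open>dual_shift\<close> thus reduces to exhibiting some \<open>k\<close> in the model
  space with orthogonal residual.\<close>

lemma dual_shift_AE:
  assumes f: "f \<in> L2" and k: "k \<in> model_space u"
    and orth: "\<And>h. h \<in> model_space u \<Longrightarrow> L2_inner (\<lambda>z. z * f z - k z) h = 0"
  shows "dual_shift u f \<in> L2" "AE z in circle_measure. dual_shift u f z = z * f z - k z"
proof -
  define p where "p = model_proj u (\<lambda>w. w * f w)"
  note kL = model_space_L2[OF k] and zL = L2_z_mult[OF f]
  have "k \<in> model_space u \<and> (\<lambda>z. z * f z - k z) \<in> L2_perp (model_space u)"
    using k orth L2_diff[OF zL kL] by (simp add: L2_perp_def)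
  hence p: "p \<in> model_space u \<and> (\<lambda>z. z * f z - p z) \<in> L2_perp (model_space u)"
    unfolding p_def model_proj_def
    by (rule someI[of "\<lambda>g. g \<in> model_space u \<and> (\<lambda>z. z * f z - g z) \<in> L2_perp (model_space u)"])
  hence pL: "p \<in> L2" by (simp add: model_space_L2)
  define w where "w = (\<lambda>z. p z - k z)"
  have w: "w \<in> model_space u" unfolding w_def using p k L2_subspaceD(4)[OF model_space_subspace] by blast
  note wL = model_space_L2[OF w]
  have "w = (\<lambda>z. (z * f z - k z) - (z * f z - p z))" by (simp add: w_def)
  hence "L2_inner w w = L2_inner (\<lambda>z. z * f z - k z) w - L2_inner (\<lambda>z. z * f z - p z) w"
    using L2_inner_diff_left[OF L2_diff[OF zL kL] L2_diff[OF zL pL] wL] by simp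
  also have "\<dots> = 0" using orth[OF w] p w by (simp add: L2_perp_def)
  finally have "AE z in circle_measure. w z = 0"
    using L2_norm_eq_0_iff[OF wL] by (simp add: L2_inner_self)
  thus "AE z in circle_measure. dual_shift u f z = z * f z - k z"
    by eventually_elim (simp add: dual_shift_def w_def p_def)
  show "dual_shift u f \<in> L2" unfolding dual_shift_def p_def[symmetric] by (rule L2_diff[OF zL pL])
qed

lemma mult_H2_shift: "y \<in> mult_H2 u \<Longrightarrow> (\<lambda>z. z * y z) \<in> mult_H2 u"
  using H2_z_mult[of "\<lambda>z. cnj (b z) * y z"] by (auto simp: mult_H2_iff' mult.left_commute)

text \<open>The shifted function stays in \<open>mult_H2 u\<close>, so its projection is null. The
  leading \<open>0\<close> shows the component in \<open>conj_H2_0\<close>, for the later comparison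
  of components.\<close>

lemma dual_shift_mult_H2:
  assumes "y \<in> mult_H2 u"
  shows "dual_shift u y \<in> L2" "AE z in circle_measure. dual_shift u y z = 0 + z * y z"
  using dual_shift_AE[of y "\<lambda>_. 0"] assms L2_subspaceD(1)[OF mult_H2_subspace]
    L2_subspaceD(2)[OF model_space_subspace] model_space_perp[OF _ mult_H2_shift[OF assms]] by auto

text \<open>The projection of the constant function \<open>1\<close> onto the model space is
  the reproducing kernel at the origin, \<open>1 - cnj (u 0) * u\<close>.\<close>

lemma kernel_mem: "(\<lambda>z. c * (1 - cnj (u 0) * b z)) \<in> model_space u"
proof -
  have one: "(\<lambda>_. 1) \<in> H2" using H2_power[of 0] by simp
  have kH: "(\<lambda>z. 1 - cnj (u 0) * b z) \<in> H2"
    by (rule L2_subspaceD(4)[OF H2_subspace one L2_subspaceD(5)[OF H2_subspace b_H2]])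
  have "L2_inner (\<lambda>z. 1 - cnj (u 0) * b z) g = 0" if g: "g \<in> mult_H2 u" for g
  proof -
    obtain h where gL: "g \<in> L2" and h: "h \<in> H2" "AE z in circle_measure. g z = b z * h z"
      using mult_H2E[OF g] by blast
    note [measurable] = b_L2 gL H2_L2[OF h(1)]
    \<comment> \<open>The functions \<open>1\<close> and \<open>cnj (u 0) * b\<close> have the same
      inner product with \<open>b * h\<close>: the first by multiplicativity of the zeroth
      coefficient, the second because \<open>b\<close> cancels.\<close>
    have "L2_inner g (\<lambda>_. 1) = (LINT z|circle_measure. b z * h z)"
      unfolding L2_inner_def by (rule integral_cong_AE) (use h in auto)
    hence 1: "L2_inner (\<lambda>_. 1) g = cnj (u 0) * cnj (fourier_coeff h 0)"
      using H2_mult_integral[OF b_H2 h(1)] L2_inner_commute[of "\<lambda>_. 1" g] b_0 by simp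
    have "L2_inner g b = (LINT z|circle_measure. h z)"
      unfolding L2_inner_def
    proof (rule integral_cong_AE)
      show "AE z in circle_measure. g z * cnj (b z) = h z"
        using h(2) b_mod by eventually_elim (simp add: circle_cnj_eq mult.commute mult.left_commute[of _ "b _"])
    qed measurable
    hence 2: "L2_inner b g = cnj (fourier_coeff h 0)"
      using L2_inner_commute[of b g] by (simp add: fourier_coeff_def)
    show ?thesis
      using L2_inner_diff_left[OF L2_const[of 1] L2_cmult[OF b_L2, of "cnj (u 0)"] gL] 1 2
      by (simp add: L2_inner_cmult_left)
  qed
  hence "(\<lambda>z. 1 - cnj (u 0) * b z) \<in> model_space u"
    using kH H2_L2[OF kH] by (simp add: model_space_def L2_perp_def)
  thus ?thesis by (rule L2_subspaceD(5)[OF model_space_subspace])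
qed

lemma b_mem: "b \<in> mult_H2 u"
  using b_mult_mem[OF H2_power[of 0]] by simp

text \<open>Multiplication by \<open>z\<close> moves the coefficient of index \<open>-1\<close> to
  index 0, the only place where \<open>conj_H2_0\<close> is left.\<close>

lemma conj_H2_0_shift:
  assumes "x \<in> conj_H2_0"
  shows "(\<lambda>z. z * x z - fourier_coeff x (-1)) \<in> conj_H2_0"
proof -
  have c: "fourier_coeff (\<lambda>_. c) n = (if n = 0 then c else 0)" for c n
    using fourier_coeff_cmult[of c "\<lambda>z. z powi 0" n] fourier_coeff_powi[of 0 n] by simp
  show ?thesis
    using assms L2_diff[OF L2_z_mult L2_const]
    by (auto simp: conj_H2_0_eq fourier_coeff_diff fourier_coeff_z_mult L2_z_mult c)
qed

text \<open>The projection of \<open>z * x\<close> is \<open>c\<close> times the kernel at the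
  origin, since the residual is a sum of a term in \<open>conj_H2_0\<close> and a multiple of
  \<open>b\<close>, both orthogonal to the model space.\<close>

lemma dual_shift_conj_H2_0:
  assumes x: "x \<in> conj_H2_0"
  defines "c \<equiv> fourier_coeff x (-1)"
  shows "dual_shift u x \<in> L2"
    "AE z in circle_measure. dual_shift u x z = (z * x z - c) + c * cnj (u 0) * b z"
proof -
  have xL: "x \<in> L2" using x by (simp add: conj_H2_0_eq)
  define k where "k = (\<lambda>z. c * (1 - cnj (u 0) * b z))"
  have k: "k \<in> model_space u" unfolding k_def by (rule kernel_mem)
  have orth: "L2_inner (\<lambda>z. z * x z - k z) h = 0" if h: "h \<in> model_space u" for h
  proof -
    have "L2_inner (\<lambda>z. (z * x z - c) + (c * cnj (u 0)) * b z) h =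
      L2_inner (\<lambda>z. z * x z - c) h + L2_inner (\<lambda>z. (c * cnj (u 0)) * b z) h"
      using xL b_L2 model_space_L2[OF h] by (intro L2_inner_add_left) auto
    also have "\<dots> = 0"
      using conj_H2_0_orth_H2[OF conj_H2_0_shift[OF x] model_space_H2[OF h]] model_space_perp[OF h b_mem]
      by (simp add: L2_inner_cmult_left c_def)
    finally show ?thesis by (simp add: k_def algebra_simps)
  qed
  show "dual_shift u x \<in> L2" by (rule dual_shift_AE(1)[OF xL k orth])
  show "AE z in circle_measure. dual_shift u x z = (z * x z - c) + c * cnj (u 0) * b z"
  proof -
    have "AE z in circle_measure. dual_shift u x z = z * x z - k z"
      by (rule dual_shift_AE(2)[OF xL k orth])
    thus ?thesis by eventually_elim (simp add: k_def algebra_simps)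
  qed
qed

end

section \<open>Invariant subspaces of the dual of the compressed shift\<close>

lemma mult_H2_boundary_iff:
  "f \<in> mult_H2 u \<longleftrightarrow> f \<in> L2 \<and> (\<exists>h\<in>H2. AE z in circle_measure. f z = boundary u z * h z)"
  unfolding mult_H2_def saturate_def by auto

text \<open>The passage from a generator found by Beurling's theorem on the circle back to an inner
  function on the disk.\<close>

lemma inner_boundary_disk_ext:
  assumes "\<phi> \<in> H2" "AE z in circle_measure. cmod (\<phi> z) = 1"
  shows "inner_boundary (disk_ext \<phi>) \<phi>"
proof
  show "fourier_coeff \<phi> 0 = disk_ext \<phi> 0"
    unfolding disk_ext_def by (subst suminf_finite[of "{0}"]) auto
qed (use inner_function_disk_ext[OF assms] assms in auto)

text \<open>The orthogonal complement in \<open>H2\<close> of the image of \<open>X\<close> under \<open>x \<mapsto> cnj (z * x)\<close>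
  is invariant under multiplication by \<open>z\<close>, so that Beurling's theorem applies to it.\<close>

lemma conj_H2_0_invariant_subspace:
  assumes X: "L2_subspace X" "L2_closed X" "X \<subseteq> conj_H2_0"
    and inv: "\<And>x. x \<in> X \<Longrightarrow> (\<lambda>z. z * x z - fourier_coeff x (-1)) \<in> X"
  shows "X = conj_H2_0 \<or> (\<exists>\<alpha>. inner_function \<alpha> \<and> X = conj_z (model_space \<alpha>))"
proof -
  define N where "N = {\<lambda>z. cnj (z * x z) |x. x \<in> X}"
  have NL: "N \<subseteq> L2" unfolding N_def using cnj_z_conj_H2_0 X(3) H2_L2 by blast
  define M where "M = H2 \<inter> L2_perp N"
  have XL: "x \<in> L2" if "x \<in> X" for x using L2_subspaceD(1)[OF X(1)] that by blast
  have M_sub: "L2_subspace M"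
    using H2_subspace L2_perp_subspace[OF NL] unfolding M_def
    by (intro L2_subspaceI) (auto dest: L2_subspaceD)
  have M_closed: "L2_closed M"
    using H2_closed L2_perp_closed[OF NL] unfolding M_def L2_closed_def by blast
  \<comment> \<open>As a bilinear integral the pairing is free of conjugates, and the factor
    \<open>z\<close> can move between \<open>g\<close> and \<open>x\<close>.\<close>
  have inner_N: "L2_inner g (\<lambda>z. cnj (z * x z)) = (LINT z|circle_measure. (z * g z) * x z)" for g x
    unfolding L2_inner_def by (simp add: mult_ac)
  have M_iff: "g \<in> M \<longleftrightarrow> g \<in> H2 \<and> (\<forall>x\<in>X. (LINT z|circle_measure. (z * g z) * x z) = 0)" for g
    unfolding M_def L2_perp_def N_def by (auto simp: H2_L2 simp flip: inner_N)
  have shift: "(\<lambda>z. z * g z) \<in> M" if g: "g \<in> M" for g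
    unfolding M_iff
  proof (intro conjI ballI)
    have gH: "g \<in> H2" using g by (simp add: M_iff)
    note gL = H2_L2[OF gH]
    show "(\<lambda>z. z * g z) \<in> H2" by (rule H2_z_mult[OF gH])
    fix x assume x: "x \<in> X"
    define c where "c = fourier_coeff x (-1)"
    \<comment> \<open>Replace \<open>z * x\<close> by \<open>z * x - c\<close>, which lies in
      \<open>X\<close> and is annihilated; the constant \<open>c\<close> meets \<open>z * g\<close>,
      whose mean is 0.\<close>
    have "(LINT z|circle_measure. (z * (z * g z)) * x z) =
        (LINT z|circle_measure. (z * g z) * (z * x z - c) + c * (z * g z))"
      by (simp add: algebra_simps)
    also have "\<dots> = (LINT z|circle_measure. (z * g z) * (z * x z - c)) + c * (LINT z|circle_measure. z * g z)"
    proof -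
      have "integrable circle_measure (\<lambda>z. (z * g z) * (z * x z - c))"
        by (rule L2_mult_integrable[OF L2_z_mult[OF gL] L2_diff[OF L2_z_mult[OF XL[OF x]] L2_const]])
      thus ?thesis using L2_integrable[OF L2_cmult[OF L2_z_mult[OF gL], of c]]
        by (subst Bochner_Integration.integral_add) auto
    qed
    also have "(LINT z|circle_measure. (z * g z) * (z * x z - c)) = 0"
      using g inv[OF x] by (auto simp: M_iff c_def)
    also have "(LINT z|circle_measure. z * g z) = fourier_coeff (\<lambda>z. z * g z) 0"
      by (simp add: fourier_coeff_def)
    also have "\<dots> = 0" using gH by (simp add: fourier_coeff_z_mult[OF gL] H2_def)
    finally show "(LINT z|circle_measure. (z * (z * g z)) * x z) = 0" by simp
  qed
  \<comment> \<open>Recovers \<open>X\<close> from its annihilator \<open>M\<close>. For the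
    residual \<open>w\<close> of \<open>x\<close> after projection onto \<open>X\<close>, the
    function \<open>cnj (z * w)\<close> lies in \<open>M\<close>, and testing \<open>x\<close>
    against it shows that \<open>w\<close> is orthogonal to \<open>x\<close>, hence null.\<close>
  have X_I: "x \<in> X" if x: "x \<in> conj_H2_0" and orth: "\<And>g. g \<in> M \<Longrightarrow> (LINT z|circle_measure. (z * g z) * x z) = 0" for x
  proof -
    have xL [measurable]: "x \<in> L2" using x by (simp add: conj_H2_0_eq)
    obtain p where p: "p \<in> X" and pr: "\<And>h. h \<in> X \<Longrightarrow> L2_inner (\<lambda>z. x z - p z) h = 0"
      using L2_projection[OF X(1,2) xL] by blast
    define w where "w = (\<lambda>z. x z - p z)"
    have w: "w \<in> conj_H2_0" unfolding w_def
      using L2_subspaceD(4)[OF conj_H2_0_subspace x] p X(3) by blast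
    hence wL [measurable]: "w \<in> L2" by (simp add: conj_H2_0_eq)
    have rev: "(LINT z|circle_measure. (z * cnj (z * w z)) * y z) = L2_inner y w" if yL: "y \<in> L2" for y
      unfolding L2_inner_def
    proof (rule integral_cong_AE)
      show "AE z in circle_measure. (z * cnj (z * w z)) * y z = y z * cnj (w z)"
        using AE_circle_cmod by eventually_elim (simp add: circle_cnj_eq flip: mult.assoc)
    qed (use yL in measurable)
    have "L2_inner y w = 0" if "y \<in> X" for y
      using pr[OF that] L2_inner_commute[of y w] by (simp add: w_def)
    hence "(\<lambda>z. cnj (z * w z)) \<in> M"
      unfolding M_iff using cnj_z_conj_H2_0[OF w] rev XL by (simp del: complex_cnj_mult)
    hence "L2_inner x w = 0" using orth rev[OF xL] by (simp del: complex_cnj_mult)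
    moreover have "L2_inner p w = 0" using pr[OF p] L2_inner_commute[of p w] by (simp add: w_def)
    ultimately have "L2_inner w w = 0"
      using L2_inner_diff_left[OF xL XL[OF p] wL] by (simp add: w_def)
    hence "AE z in circle_measure. w z = 0"
      using L2_norm_eq_0_iff[OF wL] by (simp add: L2_inner_self)
    hence "AE z in circle_measure. x z = p z" by eventually_elim (simp add: w_def)
    thus "x \<in> X" by (rule L2_subspaceD(6)[OF X(1) p xL])
  qed
  show ?thesis
  proof (cases "\<exists>f\<in>M. \<not> (AE z in circle_measure. f z = 0)")
    case False
    \<comment> \<open>With \<open>M\<close> trivial the orthogonality condition always holds, so
      \<open>X\<close> is everything.\<close>
    have "x \<in> X" if x: "x \<in> conj_H2_0" for x
    proof (rule X_I[OF x])
      fix g assume "g \<in> M"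
      hence "AE z in circle_measure. g z = 0" using False by blast
      hence "AE z in circle_measure. (z * g z) * x z = 0" by eventually_elim simp
      thus "(LINT z|circle_measure. (z * g z) * x z) = 0" by (rule integral_eq_zero_AE)
    qed
    thus ?thesis using X(3) by blast
  next
    case True
    then obtain f where f: "f \<in> M" "\<not> (AE z in circle_measure. f z = 0)" by blast
    have "M \<subseteq> H2" by (simp add: M_def)
    from Beurling[OF M_sub M_closed this shift f] obtain \<phi> where \<phi>: "\<phi> \<in> M" "AE z in circle_measure. cmod (\<phi> z) = 1"
      "\<And>f. f \<in> M \<longleftrightarrow> f \<in> L2 \<and> (\<exists>h\<in>H2. AE z in circle_measure. f z = \<phi> z * h z)"
      by blast
    have \<phi>H: "\<phi> \<in> H2" using \<phi>(1) by (simp add: M_def)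
    define \<alpha> where "\<alpha> = disk_ext \<phi>"
    interpret A: inner_boundary \<alpha> \<phi>
      unfolding \<alpha>_def by (rule inner_boundary_disk_ext[OF \<phi>H \<phi>(2)])
    have M_eq: "mult_H2 \<alpha> = M" by (rule set_eqI) (simp add: A.mult_H2_iff \<phi>(3))
    have "X = conj_z (model_space \<alpha>)"
    proof (intro set_eqI iffI)
      fix x assume x: "x \<in> X"
      define h where "h = (\<lambda>z. cnj (z * x z))"
      have hH: "h \<in> H2" unfolding h_def using x X(3) by (intro cnj_z_conj_H2_0) auto
      have "L2_inner h g = 0" if "g \<in> M" for g
        using that x L2_inner_commute[of h g] by (auto simp: M_iff h_def inner_N simp del: complex_cnj_mult)
      hence h: "h \<in> model_space \<alpha>"
        using hH H2_L2[OF hH] by (simp add: model_space_def L2_perp_def M_eq)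
      have "AE z in circle_measure. x z = cnj (z * h z)"
        using AE_circle_cmod by eventually_elim (simp add: h_def circle_cnj_eq flip: mult.assoc)
      thus "x \<in> conj_z (model_space \<alpha>)" unfolding conj_z_iff using h XL[OF x] by blast
    next
      fix x assume "x \<in> conj_z (model_space \<alpha>)"
      then obtain h where xL: "x \<in> L2" and h: "h \<in> model_space \<alpha>" and xh: "AE z in circle_measure. x z = cnj (z * h z)"
        unfolding conj_z_iff by blast
      have hH: "h \<in> H2" by (rule A.model_space_H2[OF h])
      note [measurable] = xL H2_L2[OF hH]
      show "x \<in> X"
      proof (rule X_I)
        show "x \<in> conj_H2_0" unfolding conj_H2_0_def conj_z_iff using xL hH xh by blast
        fix g assume g: "g \<in> M"
        have [measurable]: "g \<in> L2" using g by (simp add: M_iff H2_L2)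
        have "(LINT z|circle_measure. (z * g z) * x z) = L2_inner g h"
          unfolding L2_inner_def
        proof (rule integral_cong_AE)
          show "AE z in circle_measure. (z * g z) * x z = g z * cnj (h z)"
            using AE_circle_cmod xh
            by eventually_elim (simp add: circle_cnj_eq mult.assoc mult.left_commute[of _ "cnj _"])
        qed measurable
        thus "(LINT z|circle_measure. (z * g z) * x z) = 0"
          using A.model_space_perp[OF h] g M_eq by simp
      qed
    qed
    thus ?thesis using A.inner by blast
  qed
qed

context inner_boundary begin

text \<open>Division by \<open>b\<close> is isometric and commutes with multiplication by
  \<open>z\<close>. It carries \<open>Y\<close> to a closed invariant subspace \<open>M\<close> of
  \<open>H2\<close>, and the generator of \<open>M\<close> times \<open>b\<close> generates
  \<open>Y\<close>.\<close>

lemma mult_H2_invariant_subspace: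
  assumes Y: "L2_subspace Y" "L2_closed Y" "Y \<subseteq> mult_H2 u"
    and inv: "\<And>y. y \<in> Y \<Longrightarrow> (\<lambda>z. z * y z) \<in> Y"
  shows "Y = L2_zero \<or> (\<exists>\<gamma>. inner_function \<gamma> \<and> Y = mult_H2 (\<lambda>z. \<gamma> z * u z))"
proof -
  have YL: "y \<in> L2" if "y \<in> Y" for y using L2_subspaceD(1)[OF Y(1)] that by blast
  define M where "M = {h \<in> H2. (\<lambda>z. b z * h z) \<in> Y}"
  have M_ex: "\<exists>h\<in>M. AE z in circle_measure. y z = b z * h z" if y: "y \<in> Y" for y
  proof -
    obtain h where h: "h \<in> H2" "AE z in circle_measure. y z = b z * h z"
      using mult_H2E[of y] y Y(3) by blast
    have "AE z in circle_measure. b z * h z = y z" using h(2) by eventually_elim simp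
    hence "(\<lambda>z. b z * h z) \<in> Y" by (rule L2_subspaceD(6)[OF Y(1) y b_mult_L2[OF H2_L2[OF h(1)]]])
    thus ?thesis using h by (auto simp: M_def)
  qed
  have M_sub: "L2_subspace M"
  proof (rule L2_subspaceI)
    fix f g assume "f \<in> M" "g \<in> M"
    thus "(\<lambda>z. f z + g z) \<in> M"
      using L2_subspaceD(3)[OF H2_subspace, of f g] L2_subspaceD(3)[OF Y(1), of "\<lambda>z. b z * f z" "\<lambda>z. b z * g z"]
      by (simp add: M_def distrib_left)
  next
    fix c f assume "f \<in> M"
    thus "(\<lambda>z. c * f z) \<in> M"
      using L2_subspaceD(5)[OF H2_subspace, of f c] L2_subspaceD(5)[OF Y(1), of "\<lambda>z. b z * f z" c]
      by (simp add: M_def mult.left_commute)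
  next
    fix f g assume fg: "f \<in> M" "g \<in> L2" "AE z in circle_measure. g z = f z"
    have "AE z in circle_measure. b z * g z = b z * f z" using fg(3) by eventually_elim simp
    thus "g \<in> M"
      using fg L2_subspaceD(6)[OF H2_subspace, of f g]
        L2_subspaceD(6)[OF Y(1) _ b_mult_L2[OF fg(2)], of "\<lambda>z. b z * f z"] by (simp add: M_def)
  qed (use L2_subspaceD(2)[OF H2_subspace] L2_subspaceD(2)[OF Y(1)] in \<open>auto simp: M_def H2_L2\<close>)
  have M_closed: "L2_closed M"
    unfolding L2_closed_def
  proof (intro allI ballI impI, elim conjE)
    fix F g assume g: "g \<in> L2" and F: "\<forall>n::nat. F n \<in> M"
      and lim: "(\<lambda>n. L2_norm (\<lambda>z. F n z - g z)) \<longlonglongrightarrow> 0"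
    have "L2_norm (\<lambda>z. b z * F n z - b z * g z) = L2_norm (\<lambda>z. F n z - g z)" for n
      using norm_b_mult[OF L2_diff[of "F n" g]] F g by (simp add: right_diff_distrib M_def H2_L2)
    hence lim': "(\<lambda>n. L2_norm (\<lambda>z. b z * F n z - b z * g z)) \<longlonglongrightarrow> 0" using lim by simp
    have "g \<in> H2" by (rule L2_closedD[OF H2_closed _ g lim]) (use F in \<open>simp add: M_def\<close>)
    moreover have "(\<lambda>z. b z * g z) \<in> Y"
      by (rule L2_closedD[where F = "\<lambda>n z. b z * F n z", OF Y(2) _ b_mult_L2[OF g] lim'])
         (use F in \<open>simp add: M_def\<close>)
    ultimately show "g \<in> M" by (simp add: M_def)
  qed
  have shift: "(\<lambda>z. z * f z) \<in> M" if "f \<in> M" for f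
    using that H2_z_mult[of f] inv[of "\<lambda>z. b z * f z"] by (simp add: M_def mult.left_commute)
  show ?thesis
  proof (cases "\<exists>f\<in>M. \<not> (AE z in circle_measure. f z = 0)")
    case False
    have "Y = L2_zero"
    proof (intro set_eqI iffI)
      fix y assume y: "y \<in> Y"
      obtain h where h: "h \<in> M" "AE z in circle_measure. y z = b z * h z" using M_ex[OF y] by blast
      have "AE z in circle_measure. h z = 0" using False h(1) by blast
      with h(2) have "AE z in circle_measure. y z = 0" by eventually_elim simp
      thus "y \<in> L2_zero" using YL[OF y] by (simp add: L2_zero_iff)
    next
      fix y assume "y \<in> L2_zero"
      thus "y \<in> Y" using L2_subspaceD(6)[OF Y(1) L2_subspaceD(2)[OF Y(1)]] by (simp add: L2_zero_iff)
    qed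
    thus ?thesis ..
  next
    case True
    then obtain f where f: "f \<in> M" "\<not> (AE z in circle_measure. f z = 0)" by blast
    have "M \<subseteq> H2" by (auto simp: M_def)
    from Beurling[OF M_sub M_closed this shift f] obtain \<phi> where \<phi>: "\<phi> \<in> M" "AE z in circle_measure. cmod (\<phi> z) = 1"
      "\<And>f. f \<in> M \<longleftrightarrow> f \<in> L2 \<and> (\<exists>h\<in>H2. AE z in circle_measure. f z = \<phi> z * h z)"
      by blast
    have \<phi>H: "\<phi> \<in> H2" using \<phi>(1) by (simp add: M_def)
    interpret G: inner_boundary "disk_ext \<phi>" \<phi>
      by (rule inner_boundary_disk_ext[OF \<phi>H \<phi>(2)])
    have bd: "AE z in circle_measure. boundary (\<lambda>z. disk_ext \<phi> z * u z) z = \<phi> z * b z"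
      using boundary_mult[OF G.inner inner] G.bdry bdry by eventually_elim simp
    have "Y = mult_H2 (\<lambda>z. disk_ext \<phi> z * u z)"
    proof (intro set_eqI iffI)
      fix y assume y: "y \<in> Y"
      obtain h where h: "h \<in> M" "AE z in circle_measure. y z = b z * h z" using M_ex[OF y] by blast
      obtain k where k: "k \<in> H2" "AE z in circle_measure. h z = \<phi> z * k z" using h(1) \<phi>(3) by blast
      have "AE z in circle_measure. y z = boundary (\<lambda>z. disk_ext \<phi> z * u z) z * k z"
        using h(2) k(2) bd by eventually_elim simp
      thus "y \<in> mult_H2 (\<lambda>z. disk_ext \<phi> z * u z)"
        unfolding mult_H2_boundary_iff using YL[OF y] k(1) by blast
    next
      fix y assume "y \<in> mult_H2 (\<lambda>z. disk_ext \<phi> z * u z)"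
      then obtain k where k: "y \<in> L2" "k \<in> H2"
        "AE z in circle_measure. y z = boundary (\<lambda>z. disk_ext \<phi> z * u z) z * k z"
        unfolding mult_H2_boundary_iff by blast
      have "(\<lambda>z. \<phi> z * k z) \<in> M" unfolding \<phi>(3)
        using G.b_mult_L2[OF H2_L2[OF k(2)]] k(2) by blast
      hence "(\<lambda>z. b z * (\<phi> z * k z)) \<in> Y" by (simp add: M_def)
      moreover have "AE z in circle_measure. y z = b z * (\<phi> z * k z)"
        using k(3) bd by eventually_elim simp
      ultimately show "y \<in> Y" using L2_subspaceD(6)[OF Y(1) _ k(1)] by blast
    qed
    thus ?thesis using G.inner by blast
  qed
qed

text \<open>If \<open>w\<close> in \<open>mult_H2 u\<close> is orthogonal to all
  \<open>z ^ n * b\<close>, then \<open>cnj b * w\<close> has no coefficients of nonnegative index;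
  lying in \<open>H2\<close>, it has no others.\<close>

lemma mult_H2_invariant_eq:
  assumes Y: "L2_subspace Y" "L2_closed Y" "Y \<subseteq> mult_H2 u"
    and inv: "\<And>y. y \<in> Y \<Longrightarrow> (\<lambda>z. z * y z) \<in> Y" and bY: "b \<in> Y"
  shows "Y = mult_H2 u"
proof (intro set_eqI iffI)
  fix y assume y: "y \<in> mult_H2 u"
  hence yL: "y \<in> L2" by (simp add: mult_H2_iff)
  obtain p where p: "p \<in> Y" and orth: "\<And>h. h \<in> Y \<Longrightarrow> L2_inner (\<lambda>z. y z - p z) h = 0"
    using L2_projection[OF Y(1,2) yL] by blast
  define w where "w = (\<lambda>z. y z - p z)"
  have w: "w \<in> mult_H2 u" unfolding w_def
    using L2_subspaceD(4)[OF mult_H2_subspace y] p Y(3) by blast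
  hence wL [measurable]: "w \<in> L2" and v: "(\<lambda>z. cnj (b z) * w z) \<in> H2" by (auto simp: mult_H2_iff')
  note [measurable] = b_L2
  have pow: "(\<lambda>z. z ^ n * b z) \<in> Y" for n
  proof (induction n)
    case (Suc n)
    from inv[OF this] show ?case by (simp add: mult.assoc)
  qed (use bY in simp)
  have "fourier_coeff (\<lambda>z. cnj (b z) * w z) n = 0" for n
  proof (cases "n < 0")
    case True
    thus ?thesis using v by (simp add: H2_def)
  next
    case False
    have "fourier_coeff (\<lambda>z. cnj (b z) * w z) n = L2_inner w (\<lambda>z. z ^ nat n * b z)"
      unfolding fourier_coeff_def L2_inner_def
    proof (rule integral_cong_AE)
      show "AE z in circle_measure. cnj (b z) * w z * z powi - n = w z * cnj (z ^ nat n * b z)"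
        using AE_circle_cmod
      proof eventually_elim
        case (elim z)
        have "z ^ nat n = z powi n" using False by (simp add: power_int_def)
        thus ?case using circle_cnj_powi(2)[OF elim, of n] by (simp only: complex_cnj_mult mult_ac)
      qed
    qed measurable
    thus ?thesis using orth[OF pow] by (simp add: w_def)
  qed
  hence "AE z in circle_measure. cnj (b z) * w z = 0" using L2_zeroI[OF cnj_b_mult_L2[OF wL]] by blast
  hence "AE z in circle_measure. y z = p z"
    using b_mod by eventually_elim (auto simp: w_def)
  thus "y \<in> Y" by (rule L2_subspaceD(6)[OF Y(1) p yL])
qed (use Y(3) in blast)

end

theorem theorem8p1:
  fixes u :: "complex \<Rightarrow> complex" and S X Y :: "(complex \<Rightarrow> complex) set"
  assumes "inner_function u"
    and "dual_shift_invariant u S"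
    and "S \<noteq> L2_zero" and "S \<noteq> L2_perp (model_space u)"
    and "L2_subspace X" and "L2_closed X" and "X \<subseteq> conj_H2_0"
    and "L2_subspace Y" and "L2_closed Y" and "Y \<subseteq> mult_H2 u"
    and "S = X \<oplus>\<^sub>2 Y"
  shows "(u 0 \<noteq> 0 \<longrightarrow>
           (\<exists>\<gamma>. inner_function \<gamma> \<and> S = mult_H2 (\<lambda>z. \<gamma> z * u z)) \<or>
           (\<exists>\<alpha>. inner_function \<alpha> \<and> S = conj_z (model_space \<alpha>) \<oplus>\<^sub>2 mult_H2 u)) \<and>
         (u 0 = 0 \<longrightarrow>
           S = conj_H2_0 \<or>
           (\<exists>\<alpha>. inner_function \<alpha> \<and> S = conj_z (model_space \<alpha>)) \<or>
           (\<exists>\<gamma>. inner_function \<gamma> \<and> S = mult_H2 (\<lambda>z. \<gamma> z * u z)) \<or>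
           (\<exists>\<gamma>. inner_function \<gamma> \<and> S = conj_H2_0 \<oplus>\<^sub>2 mult_H2 (\<lambda>z. \<gamma> z * u z)) \<or>
           (\<exists>\<alpha> \<gamma>. inner_function \<alpha> \<and> inner_function \<gamma> \<and>
              S = conj_z (model_space \<alpha>) \<oplus>\<^sub>2 mult_H2 (\<lambda>z. \<gamma> z * u z)))"
proof -
  note X = assms(5-7) and Y = assms(8-10) and S = assms(11)
  obtain b where b: "b \<in> H2" "AE z in circle_measure. boundary u z = b z"
    "AE z in circle_measure. cmod (b z) = 1" "fourier_coeff b 0 = u 0"
    using inner_function_boundary_H2[OF assms(1)] by blast
  interpret inner_boundary u b by standard (use assms(1) b in auto)
  have XL: "x \<in> L2" if "x \<in> X" for x using L2_subspaceD(1)[OF X(1)] that by blast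
  have YL: "y \<in> L2" if "y \<in> Y" for y using L2_subspaceD(1)[OF Y(1)] that by blast
  have SI: "f \<in> S" if "f \<in> L2" "x \<in> X" "y \<in> Y" "AE z in circle_measure. f z = x z + y z" for f x y
    using that unfolding S L2_sum_iff by blast
  have inv: "dual_shift u f \<in> S" if "f \<in> S" for f
    using assms(2) that unfolding dual_shift_invariant_def by blast
  have X_in_S: "x \<in> S" if "x \<in> X" for x
    using SI[OF XL[OF that] that L2_subspaceD(2)[OF Y(1)]] by simp
  have Y_in_S: "y \<in> S" if "y \<in> Y" for y
    using SI[OF YL[OF that] L2_subspaceD(2)[OF X(1)] that] by simp
  \<comment> \<open>Two decompositions of \<open>f\<close> differ by a function in both
    \<open>H2\<close> and \<open>conj_H2_0\<close>, so any decomposition agrees with the one given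
    by \<open>X\<close> and \<open>Y\<close>.\<close>
  have split: "x' \<in> X \<and> y' \<in> Y"
    if f: "f \<in> S" "x' \<in> conj_H2_0" "y' \<in> H2" "AE z in circle_measure. f z = x' z + y' z" for f x' y'
  proof -
    obtain x y where xy: "x \<in> X" "y \<in> Y" "AE z in circle_measure. f z = x z + y z"
      using f(1) unfolding S L2_sum_iff by blast
    have yH: "y \<in> H2" using xy(2) Y(3) mult_H2_subset by blast
    have eq: "AE z in circle_measure. y' z - y z = x z - x' z"
      using f(4) xy(3) by eventually_elim (simp add: algebra_simps)
    have *: "AE z in circle_measure. y' z - y z = 0"
    proof (rule H2_Int_conj_H2_0[OF _ _ eq])
      show "(\<lambda>z. y' z - y z) \<in> H2" by (rule L2_subspaceD(4)[OF H2_subspace f(3) yH])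
      show "(\<lambda>z. x z - x' z) \<in> conj_H2_0"
        using L2_subspaceD(4)[OF conj_H2_0_subspace _ f(2)] xy(1) X(3) by blast
    qed
    have "AE z in circle_measure. y' z = y z" using * by eventually_elim simp
    moreover have "AE z in circle_measure. x' z = x z" using * eq by eventually_elim simp
    moreover have "x' \<in> L2" "y' \<in> L2" using f by (auto simp: conj_H2_0_eq H2_L2)
    ultimately show ?thesis
      using L2_subspaceD(6)[OF X(1) xy(1)] L2_subspaceD(6)[OF Y(1) xy(2)] by blast
  qed
  have Y_inv: "(\<lambda>z. z * y z) \<in> Y" if y: "y \<in> Y" for y
  proof -
    have ym: "y \<in> mult_H2 u" using y Y(3) by blast
    have "(\<lambda>z. z * y z) \<in> H2" using mult_H2_shift[OF ym] mult_H2_subset by blast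
    thus ?thesis
      using split[OF inv[OF Y_in_S[OF y]] L2_subspaceD(2)[OF conj_H2_0_subspace] _ dual_shift_mult_H2(2)[OF ym]]
      by blast
  qed
  \<comment> \<open>Both components of the image of \<open>x\<close> are used: the first makes
    \<open>X\<close> invariant under the conjugated backward shift, the second puts multiples of
    \<open>b\<close> into \<open>Y\<close>.\<close>
  have X_inv: "(\<lambda>z. z * x z - fourier_coeff x (-1)) \<in> X \<and>
      (\<lambda>z. fourier_coeff x (-1) * cnj (u 0) * b z) \<in> Y" if x: "x \<in> X" for x
  proof -
    have xc: "x \<in> conj_H2_0" using x X(3) by blast
    show ?thesis
      by (rule split[OF inv[OF X_in_S[OF x]] conj_H2_0_shift[OF xc] _ dual_shift_conj_H2_0(2)[OF xc]])
         (rule L2_subspaceD(5)[OF H2_subspace b_H2])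
  qed
  have X_cases: "X = conj_H2_0 \<or> (\<exists>\<alpha>. inner_function \<alpha> \<and> X = conj_z (model_space \<alpha>))"
    using X_inv by (intro conj_H2_0_invariant_subspace X) blast
  have Y_cases: "Y = L2_zero \<or> (\<exists>\<gamma>. inner_function \<gamma> \<and> Y = mult_H2 (\<lambda>z. \<gamma> z * u z))"
    by (rule mult_H2_invariant_subspace[OF Y Y_inv])
  show ?thesis
  proof (intro conjI impI)
    assume "u 0 = 0"
    \<comment> \<open>The form \<open>\<gamma> u H2\<close> is included in the last alternative,
      with a constant \<open>\<alpha>\<close>, whose model space is zero.\<close>
    have "S = X" if "Y = L2_zero" using S that L2_sum_zero_right[OF X(1)] by simp
    thus "S = conj_H2_0 \<or>
           (\<exists>\<alpha>. inner_function \<alpha> \<and> S = conj_z (model_space \<alpha>)) \<or>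
           (\<exists>\<gamma>. inner_function \<gamma> \<and> S = mult_H2 (\<lambda>z. \<gamma> z * u z)) \<or>
           (\<exists>\<gamma>. inner_function \<gamma> \<and> S = conj_H2_0 \<oplus>\<^sub>2 mult_H2 (\<lambda>z. \<gamma> z * u z)) \<or>
           (\<exists>\<alpha> \<gamma>. inner_function \<alpha> \<and> inner_function \<gamma> \<and>
              S = conj_z (model_space \<alpha>) \<oplus>\<^sub>2 mult_H2 (\<lambda>z. \<gamma> z * u z))"
      using X_cases Y_cases S by blast
  next
    assume u0: "u 0 \<noteq> 0"
    show "(\<exists>\<gamma>. inner_function \<gamma> \<and> S = mult_H2 (\<lambda>z. \<gamma> z * u z)) \<or>
           (\<exists>\<alpha>. inner_function \<alpha> \<and> S = conj_z (model_space \<alpha>) \<oplus>\<^sub>2 mult_H2 u)"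
    proof (cases "\<exists>x\<in>X. fourier_coeff x (-1) \<noteq> 0")
      case True
      then obtain x where x: "x \<in> X" "fourier_coeff x (-1) \<noteq> 0" by blast
      define c where "c = fourier_coeff x (-1) * cnj (u 0)"
      have "(\<lambda>z. inverse c * (c * b z)) \<in> Y"
        using L2_subspaceD(5)[OF Y(1)] X_inv[OF x(1)] unfolding c_def by blast
      moreover have "c \<noteq> 0" using x u0 by (simp add: c_def)
      ultimately have bY: "b \<in> Y" by (simp flip: mult.assoc)
      have Yu: "Y = mult_H2 u" by (rule mult_H2_invariant_eq[OF Y Y_inv bY])
      \<comment> \<open>Otherwise \<open>S\<close> would be the whole complement of the model space,
        contrary to non-triviality.\<close>
      have "X \<noteq> conj_H2_0"
      proof
        assume "X = conj_H2_0"
        hence "L2_perp (model_space u) \<subseteq> S" unfolding S Yu using perp_model_space by blast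
        moreover have "S \<subseteq> L2_perp (model_space u)" using assms(2) by (simp add: dual_shift_invariant_def)
        ultimately show False using assms(4) by blast
      qed
      thus ?thesis using X_cases S Yu by blast
    next
      case False
      \<comment> \<open>With every coefficient of index \<open>-1\<close> zero, \<open>X\<close> is
        closed under plain multiplication by \<open>z\<close>, and \<open>k\<close> such steps raise
        the index \<open>- 1 - k\<close> to \<open>-1\<close>.\<close>
      have coeff: "fourier_coeff x (- 1 - int k) = 0" if "x \<in> X" for x k
        using that
      proof (induction k arbitrary: x)
        case 0
        thus ?case using False by simp
      next
        case (Suc k)
        define c where "c = fourier_coeff x (-1)"
        have "c = 0" using False Suc.prems by (simp add: c_def)
        hence "(\<lambda>z. z * x z) \<in> X" using X_inv[OF Suc.prems] by (simp add: c_def)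
        from Suc.IH[OF this] show ?case
          using XL[OF Suc.prems] by (simp add: fourier_coeff_z_mult algebra_simps)
      qed
      have "X = L2_zero"
      proof (intro set_eqI iffI)
        fix x assume x: "x \<in> X"
        have "fourier_coeff x n = 0" for n
        proof (cases "n \<ge> 0")
          case True
          thus ?thesis using x X(3) by (auto simp: conj_H2_0_eq)
        next
          case False
          thus ?thesis using coeff[OF x, of "nat (- 1 - n)"] by simp
        qed
        thus "x \<in> L2_zero" using L2_zeroI[OF XL[OF x]] XL[OF x] by (simp add: L2_zero_iff)
      next
        fix x assume "x \<in> L2_zero"
        thus "x \<in> X" using L2_subspaceD(6)[OF X(1) L2_subspaceD(2)[OF X(1)]] by (simp add: L2_zero_iff)
      qed
      \<comment> \<open>Non-triviality of \<open>S\<close> now excludes the zero case for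
        \<open>Y\<close>.\<close>
      hence "S = Y" using S L2_sum_commute[of X Y] L2_sum_zero_right[OF Y(1)] by simp
      thus ?thesis using Y_cases assms(3) by blast
    qed
  qed
qed

end
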